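(* For every $\delta>0$ and $K,M\in\mathbb{N}$ there exist $N_0,c_0,\theta>0$ such that for every $N\ge N_0$ the following holds. Let $B$ be an $M$-homogeneous set of positive integers. Let $\nu:[N]\to[0,\infty)$ satisfy a $4.995$-restriction estimate with constant $K$ and have Fourier decay of level $\theta$. Then for every $f:[N]\to[0,\infty)$ with $f\le\nu$ pointwise and $\|f\|_1\ge\delta\|\nu\|_1$ we have $$T_1(f;B)\ \ge\ c_0\|\nu\|_1^2N^{1/2}.$$
   Context: $[N]=\{1,\dots,\lfloor N\rfloor\}$; functions on $[N]$ are regarded as functions on $\mathbb{Z}$ vanishing off $[N]$. For finitely supported $f:\mathbb{Z}\to\mathbb{C}$, $\|f\|_1=\sum_x|f(x)|$, $\hat f(\alpha)=\sum_x f(x)e(\alpha x)$ with $e(x)=e^{2\pi i x}$, and $\mathbb{T}=\mathbb{R}/\mathbb{Z}$ carries Haar probability measure. $\nu:[N]\to[0,\infty)$ has Fourier decay of level $\theta$ if $\sup_{\alpha\in\mathbb{T}}\bigl|\hat\nu(\alpha)/\|\nu\|_1-\hat 1_{[N]}(\alpha)/\|1_{[N]}\|_1\bigr|\le\theta$. $\nu$ satisfies a $p$-restriction estimate with constant $K$ if $\sup_{\phi:\mathbb{Z}\to\mathbb{C},\,|\phi|\le\nu}\int_{\mathbb{T}}|\hat\phi(\alpha)|^p\,d\alpha\le K\|\nu\|_1^pN^{-1}$. For $q\in\mathbb{N}$, $q\cdot[M]=\{q,\dots,Mq\}$; a set $B$ of positive integers is $M$-homogeneous if $B\cap q\cdot[M]\ne\emptyset$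 for all $q\in\mathbb{N}$. For $f:\mathbb{Z}\to\mathbb{C}$ of finite support and $B\subseteq\mathbb{Z}$, $T_1(f;B)=\sum_{x_1-x_2=y_1^2+y_2^2+y_3^2}f(x_1)f(x_2)1_B(y_1)1_B(y_2)1_B(y_3)$, the sum over $(x_1,x_2,y_1,y_2,y_3)\in\mathbb{Z}^5$. *)

theory Defs
  imports "HOL-Analysis.Analysis"
begin

text \<open>
  A function on [N] is a function on the integers vanishing off [N].  All sums below are written as
  unconditional sums over the integers; for finitely supported \<open>f\<close> they are finite sums.
\<close>

definition bracket :: "real \<Rightarrow> int set" where
  "bracket N = {1..\<lfloor>N\<rfloor>}"

definition l1_norm :: "(int \<Rightarrow> 'a::real_normed_vector) \<Rightarrow> real" where
  "l1_norm f = (\<Sum>\<^sub>\<infinity>x. norm (f x))"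

definition add_char :: "real \<Rightarrow> complex" where
  "add_char x = exp (2 * of_real pi * \<i> * of_real x)"

text \<open>
  The Fourier transform lives on \<open>\<real>/\<int>\<close>; it is represented by the corresponding 1-periodic function
  on the reals, and the Haar probability measure by Lebesgue measure on the unit interval.
\<close>

definition fourier :: "(int \<Rightarrow> complex) \<Rightarrow> real \<Rightarrow> complex" where
  "fourier f \<alpha> = (\<Sum>\<^sub>\<infinity>x. f x * add_char (\<alpha> * of_int x))"

definition fourier_decay :: "real \<Rightarrow> real \<Rightarrow> (int \<Rightarrow> real) \<Rightarrow> bool" where
  "fourier_decay N \<theta> \<nu> \<longleftrightarrow>
    (\<forall>\<alpha>. cmod (fourier (\<lambda>x. of_real (\<nu> x)) \<alpha> / of_real (l1_norm \<nu>)
          - fourier (indicator (bracket N)) \<alpha>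
              / of_real (l1_norm (indicator (bracket N) :: int \<Rightarrow> complex))) \<le> \<theta>)"

definition restriction_estimate :: "real \<Rightarrow> real \<Rightarrow> real \<Rightarrow> (int \<Rightarrow> real) \<Rightarrow> bool" where
  "restriction_estimate N p K \<nu> \<longleftrightarrow>
    (\<forall>\<phi>. (\<forall>x. cmod (\<phi> x) \<le> \<nu> x) \<longrightarrow>
       (LBINT \<alpha>:{0..1}. cmod (fourier \<phi> \<alpha>) powr p) \<le> K * l1_norm \<nu> powr p / N)"

text \<open>Here the dilation parameter ranges over the positive integers.\<close>

definition homogeneous :: "nat \<Rightarrow> int set \<Rightarrow> bool" where
  "homogeneous M B \<longleftrightarrow> (\<forall>q::nat. q \<ge> 1 \<longrightarrow> B \<inter> (\<lambda>m. int q * m) ` bracket (real M) \<noteq> {})"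

text \<open>
  The count is polymorphic in the scalar field so that it can be used both for complex-valued
  and, with a real value, for real-valued \<open>f\<close>.
\<close>

definition T\<^sub>1 :: "(int \<Rightarrow> 'a::real_normed_field) \<Rightarrow> int set \<Rightarrow> 'a" where
  "T\<^sub>1 f B =
    (\<Sum>\<^sub>\<infinity>(x\<^sub>1, x\<^sub>2, y\<^sub>1, y\<^sub>2, y\<^sub>3) \<in> {(x\<^sub>1, x\<^sub>2, y\<^sub>1, y\<^sub>2, y\<^sub>3). x\<^sub>1 - x\<^sub>2 = y\<^sub>1^2 + y\<^sub>2^2 + y\<^sub>3^2}.
       f x\<^sub>1 * f x\<^sub>2 * indicator B y\<^sub>1 * indicator B y\<^sub>2 * indicator B y\<^sub>3)"

end

theory Submission
  imports Defs
begin

text \<open>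
  Let \<open>F\<close> be the Fourier transform of \<open>f\<close> and \<open>S\<close> that of the squares of \<open>B'\<close>, for a subset
  \<open>B'\<close> of \<open>B\<close> in \<open>[1, \<surd>N]\<close>; then \<open>T\<^sub>1(f; B)\<close> is at least \<open>\<integral> |F|\<^sup>2 Re S\<^sup>3\<close>. No dense model of \<open>f\<close> is
  needed: the level sets \<open>A\<^sub>i = {|F| \<ge> \<kappa>\<^sub>i |\<nu>|}\<close> have boundedly many points at scale \<open>1/N\<close>, and Fourier
  decay bounds the energy of \<open>F\<close> on them by \<open>O(|\<nu>|\<^sup>2/N)\<close>, so for a rapidly decreasing sequence
  \<open>\<kappa>\<^sub>i\<close> some difference \<open>A\<^bsub>i+1\<^esub> - A\<^sub>i\<close> carries little energy. Simultaneous quadratic recurrence and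
  homogeneity give a \<open>B'\<close> of positive density with \<open>\<alpha> y\<^sup>2\<close> close to an integer for \<open>\<alpha> \<in> A\<^sub>i\<close> and \<open>y \<in> B'\<close>,
  which makes the contribution of \<open>A\<^sub>i\<close> large and positive. Off \<open>A\<^bsub>i+1\<^esub>\<close> the integral is small by the restriction
  estimate for \<open>\<nu>\<close> together with an \<open>L\<^sup>5\<close> estimate for \<open>S\<close>. The latter follows Bourgain: a
  \<open>TT*\<close> argument reduces level sets of \<open>S\<close> to pairs at which a full Weyl sum is large; such pairs
  differ by nearly a rational with small denominator, and are counted by moments of a truncated
  divisor function, so that no logarithm of \<open>N\<close> is lost. All integrals are discretised to a grid
  \<open>t + j/G\<close> with \<open>G \<approx> 16 N\<close>.
\<close>

section \<open>Additive characters\<close>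

text \<open>\<open>N\<^sub>0\<close>, \<open>c\<^sub>0\<close> and \<theta> are fixed before
  \<open>N\<close>, \<open>B\<close> and \<open>f\<close>, so no estimate may lose even a logarithm
  of \<open>N\<close>. By Hoelder, \<open>|F|^2 |S|^3\<close> pairs a fifth moment of
  \<open>S\<close> with a fifth moment of \<open>F\<close>; a restriction exponent slightly below 5
  leaves a spare factor \<open>\<kappa> powr (1/500)\<close> where
  \<open>|F| \<le> \<kappa> |\<nu>|\<close>. For squares the fourth moment carries logarithms,
  whereas level sets of \<open>S\<close> at relative height \<eta> have
  \<open>O(\<eta> powr -4.85)\<close> points, and 4.85 < 5 makes the sum over dyadic heights
  converge. The density of \<open>B'\<close> worsens with the number of frequencies it must control.
  So the next threshold can be chosen only after the density belonging to the current one, and a gap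
  between the two is unavoidable; as the energy bound does not grow with the number of thresholds,
  one of boundedly many gaps is harmless. \<theta> is fixed after all of them, from the size of the
  last level set. On the grid, Parseval is orthogonality modulo \<open>G\<close>. The translate
  \<open>t\<close> is chosen so that the restriction integral bounds the grid sum, and
  \<open>t \<le> 1/G\<close> keeps the point \<open>j = 0\<close> close to frequency zero.\<close>

lemma add_char_cis: "add_char x = cis (2 * pi * x)"
  by (simp add: add_char_def cis_conv_exp mult_ac)

lemma add_char_add: "add_char (x + y) = add_char x * add_char y"
  by (simp add: add_char_cis cis_mult distrib_left)

lemma add_char_0 [simp]: "add_char 0 = 1"
  by (simp add: add_char_def)

lemma norm_add_char [simp]: "cmod (add_char x) = 1"
  by (simp add: add_char_cis)

lemma cnj_add_char: "cnj (add_char x) = add_char (- x)"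
  by (simp add: add_char_cis cis_cnj)

lemma add_char_of_int [simp]: "add_char (of_int n) = 1"
proof -
  have "sin (2 * pi * of_int n) = 0" "cos (2 * pi * of_int n) = 1"
    by (auto simp: sin_zero_iff_int2 cos_one_2pi_int intro: exI[of _ "2*n"] exI[of _ n])
  then show ?thesis by (simp add: add_char_cis complex_eq_iff)
qed

lemma add_char_add_of_int [simp]: "add_char (x + of_int n) = add_char x"
  by (simp add: add_char_add)

lemma add_char_mult_of_nat: "add_char (of_nat n * x) = add_char x ^ n"
  by (simp add: add_char_cis Complex.DeMoivre mult_ac)

lemma add_char_eq_1_iff: "add_char x = 1 \<longleftrightarrow> x \<in> \<int>"
proof
  assume "add_char x = 1"
  then have "cos (2 * pi * x) = 1" by (simp add: add_char_cis complex_eq_iff)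
  then obtain n :: int where "2 * pi * x = n * 2 * pi" using cos_one_2pi_int by auto
  then have "x = of_int n" by simp
  then show "x \<in> \<int>" by simp
next
  assume "x \<in> \<int>" then show "add_char x = 1" by (auto elim: Ints_cases)
qed

text \<open>Equal to \<open>2 |sin (pi x)|\<close>, hence comparable to the distance from
  \<open>x\<close> to the nearest integer. It inherits the triangle inequality and 1-periodicity
  directly from the characters, so no nearest integer has to be chosen.\<close>

definition chord :: "real \<Rightarrow> real" where
  "chord x = cmod (add_char x - 1)"

lemma chord_nonneg [simp]: "0 \<le> chord x"
  by (simp add: chord_def)

lemma chord_eq: "chord x = 2 * \<bar>sin (pi * x)\<bar>"
proof -
  have "(chord x)\<^sup>2 = (cos (2*pi*x) - 1)\<^sup>2 + (sin (2*pi*x))\<^sup>2"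
    by (simp add: chord_def add_char_cis cmod_def)
  also have "\<dots> = 2 - 2 * cos (2 * (pi*x))"
    using sin_cos_squared_add[of "2*pi*x"] by (simp add: power2_eq_square algebra_simps)
  also have "\<dots> = (2 * \<bar>sin (pi * x)\<bar>)\<^sup>2"
    by (simp add: cos_double_sin power_mult_distrib)
  finally show ?thesis
    by (rule power2_eq_imp_eq) auto
qed

lemma chord_0 [simp]: "chord 0 = 0"
  by (simp add: chord_def)

lemma chord_upper: "chord x \<le> 2 * pi * \<bar>x\<bar>"
  using abs_sin_x_le_abs_x[of "pi * x"] by (simp add: chord_eq abs_mult)

lemma chord_add: "chord (x + y) \<le> chord x + chord y"
proof -
  have "add_char (x + y) - 1 = add_char x * (add_char y - 1) + (add_char x - 1)"
    by (simp add: add_char_add algebra_simps)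
  then have "chord (x + y) \<le> cmod (add_char x * (add_char y - 1)) + cmod (add_char x - 1)"
    unfolding chord_def by (metis norm_triangle_ineq)
  then show ?thesis by (simp add: norm_mult chord_def)
qed

lemma chord_minus [simp]: "chord (- x) = chord x"
  by (simp add: chord_eq)

lemma chord_add_of_int [simp]: "chord (x + of_int n) = chord x"
  by (simp add: chord_def)

lemma chord_diff_of_int [simp]: "chord (x - of_int n) = chord x"
  using chord_add_of_int[of "x - of_int n" n] by simp

lemma chord_mult_of_nat: "chord (of_nat n * x) \<le> of_nat n * chord x"
proof (induction n)
  case (Suc n)
  have "chord (of_nat (Suc n) * x) = chord (of_nat n * x + x)" by (simp add: algebra_simps)
  also have "\<dots> \<le> chord (of_nat n * x) + chord x" by (rule chord_add)
  finally show ?case using Suc by (simp add: algebra_simps)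
qed simp

lemma chord_sum: "chord (sum g A) \<le> (\<Sum>a\<in>A. chord (g a))"
proof (induction A rule: infinite_finite_induct)
  case (insert x F)
  then show ?case using chord_add[of "g x" "sum g F"] by simp
qed auto

text \<open>Jordan's inequality: sine is concave on \<open>[0, pi/2]\<close> and so lies above its
  secant there.\<close>

lemma chord_lower:
  assumes "\<bar>x\<bar> \<le> 1 / 2"
  shows "4 * \<bar>x\<bar> \<le> chord x"
proof -
  have main: "2 * z \<le> sin (pi * z)" if "0 \<le> z" "z \<le> 1/2" for z :: real
  proof -
    have conc: "concave_on {0..pi/2} sin"
      by (rule f''_le0_imp_concave[where f' = cos and f'' = "\<lambda>x. - sin x"])
         (auto intro!: derivative_eq_intros sin_ge_zero)
    have "(1 - 2*z) * sin 0 + (2*z) * sin (pi/2) \<le> sin ((1 - 2*z) *\<^sub>R 0 + (2*z) *\<^sub>R (pi/2))"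
      using concave_onD[OF conc, of "2*z" 0 "pi/2"] that by simp
    then show ?thesis by (simp add: mult_ac)
  qed
  have "2 * \<bar>x\<bar> \<le> sin (pi * \<bar>x\<bar>)" using main[of "\<bar>x\<bar>"] assms by auto
  also have "\<dots> \<le> \<bar>sin (pi * x)\<bar>" by (cases "x \<ge> 0") auto
  finally show ?thesis by (simp add: chord_eq)
qed

text \<open>The geometric sum telescopes after multiplication by \<open>add_char x - 1\<close>. The
  product form remains true at integers \<open>x\<close>, where a quotient would fail.\<close>

lemma norm_add_char_interval_sum_le:
  fixes m n :: nat
  shows "cmod (\<Sum>z\<in>{m..<n}. add_char (of_nat z * x)) * chord x \<le> 2"
proof -
  have "(\<Sum>z\<in>{m..<n}. add_char (of_nat z * x)) * (add_char x - 1)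
      = (if m \<le> n then add_char x ^ n - add_char x ^ m else 0)"
  proof (cases "m \<le> n")
    case True
    then show ?thesis
    proof (induction rule: dec_induct)
      case (step k)
      have "(\<Sum>z\<in>{m..<Suc k}. add_char (of_nat z * x)) * (add_char x - 1)
          = (\<Sum>z\<in>{m..<k}. add_char (of_nat z * x)) * (add_char x - 1) + add_char x ^ k * (add_char x - 1)"
        using step.hyps by (simp add: add_char_mult_of_nat distrib_right)
      also have "\<dots> = add_char x ^ Suc k - add_char x ^ m"
        using step.hyps by (subst step.IH) (simp add: algebra_simps)
      finally show ?case using step.hyps by simp
    qed simp
  qed simp
  then have "cmod (\<Sum>z\<in>{m..<n}. add_char (of_nat z * x)) * chord x
      = cmod (if m \<le> n then add_char x ^ n - add_char x ^ m else 0)"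
    by (simp only: chord_def norm_mult[symmetric])
  also have "\<dots> \<le> 2"
    using norm_triangle_ineq4[of "add_char x ^ n" "add_char x ^ m"] by (simp add: norm_power)
  finally show ?thesis .
qed

lemma add_char_orthogonality:
  fixes G :: nat and n :: int
  assumes "G > 0"
  shows "(\<Sum>j<G. add_char (of_int n * of_nat j / of_nat G)) = (if int G dvd n then of_nat G else 0)"
proof -
  let ?x = "of_int n / of_nat G :: real"
  have eq: "(\<Sum>j<G. add_char (of_int n * of_nat j / of_nat G)) = (\<Sum>j<G. add_char ?x ^ j)"
    by (intro sum.cong refl) (simp add: add_char_mult_of_nat[symmetric] mult_ac)
  have int_iff: "?x \<in> \<int> \<longleftrightarrow> int G dvd n"
  proof
    assume "?x \<in> \<int>"
    then obtain k where "?x = of_int k" by (auto elim: Ints_cases)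
    then have "real_of_int n = of_int (k * int G)" using assms by (simp add: field_simps)
    then have "n = k * int G" by (simp only: of_int_eq_iff)
    then show "int G dvd n" by simp
  next
    assume "int G dvd n"
    then obtain k where "n = int G * k" by auto
    then have "?x = of_int k" using assms by simp
    then show "?x \<in> \<int>" by simp
  qed
  show ?thesis
  proof (cases "int G dvd n")
    case True
    then have "add_char ?x = 1" using int_iff add_char_eq_1_iff by blast
    then show ?thesis using True eq by simp
  next
    case False
    then have ne: "add_char ?x \<noteq> 1" using int_iff add_char_eq_1_iff by blast
    have "add_char ?x ^ G = add_char (of_int n)"
      using assms by (simp add: add_char_mult_of_nat[symmetric])
    then have "add_char ?x ^ G = 1" by simp
    then show ?thesis using eq False geometric_sum[OF ne, of G] by simp
  qed
qed

text \<open>The identity lives in the complex numbers so that the double sum can be reordered before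
  moduli are taken; the second moments below are expanded with it.\<close>

lemma norm_sum_add_char_squared:
  fixes u :: "'a \<Rightarrow> complex" and g :: "'a \<Rightarrow> real"
  shows "of_real ((cmod (\<Sum>i\<in>A. u i * add_char (g i)))\<^sup>2)
    = (\<Sum>i\<in>A. \<Sum>k\<in>A. u i * cnj (u k) * add_char (g i - g k))"
proof -
  have "of_real ((cmod (\<Sum>i\<in>A. u i * add_char (g i)))\<^sup>2)
      = (\<Sum>i\<in>A. u i * add_char (g i)) * (\<Sum>k\<in>A. cnj (u k) * add_char (- g k))"
    by (simp only: complex_norm_square cnj_sum complex_cnj_mult cnj_add_char)
  also have "\<dots> = (\<Sum>i\<in>A. \<Sum>k\<in>A. u i * cnj (u k) * add_char (g i - g k))"
    unfolding sum_product
    by (intro sum.cong refl) (simp add: diff_conv_add_uminus add_char_add mult_ac del: add_uminus_conv_diff)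
  finally show ?thesis .
qed

text \<open>Distinct members of \<open>R\<close> are incongruent modulo \<open>G\<close>, so
  orthogonality leaves only the diagonal terms.\<close>

lemma parseval:
  fixes u :: "nat \<Rightarrow> complex"
  assumes "R \<subseteq> {..<G}"
  shows "(\<Sum>n<G. (cmod (\<Sum>j\<in>R. u j * add_char (of_nat n * of_nat j / of_nat G)))\<^sup>2)
    = of_nat G * (\<Sum>j\<in>R. (cmod (u j))\<^sup>2)"
proof (cases "G > 0")
  case True
  have fin: "finite R" using assms finite_subset by blast
  have "complex_of_real (\<Sum>n<G. (cmod (\<Sum>j\<in>R. u j * add_char (of_nat n * of_nat j / of_nat G)))\<^sup>2)
    = (\<Sum>n<G. \<Sum>j\<in>R. \<Sum>k\<in>R. u j * cnj (u k) *
        add_char (of_nat n * of_nat j / of_nat G - of_nat n * of_nat k / of_nat G))"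
    by (simp only: of_real_sum norm_sum_add_char_squared)
  also have "\<dots> = (\<Sum>j\<in>R. \<Sum>k\<in>R. u j * cnj (u k) *
      (\<Sum>n<G. add_char (of_int (int j - int k) * of_nat n / of_nat G)))"
  proof -
    have "(\<Sum>n<G. \<Sum>j\<in>R. \<Sum>k\<in>R. u j * cnj (u k) *
        add_char (of_nat n * of_nat j / of_nat G - of_nat n * of_nat k / of_nat G))
      = (\<Sum>j\<in>R. \<Sum>k\<in>R. \<Sum>n<G. u j * cnj (u k) *
        add_char (of_nat n * of_nat j / of_nat G - of_nat n * of_nat k / of_nat G))"
      by (subst sum.swap, rule sum.cong[OF refl], rule sum.swap)
    moreover have "real n * real j / real G - real n * real k / real G
        = of_int (int j - int k) * real n / real G" for n j k
      by (simp add: diff_divide_distrib right_diff_distrib mult.commute)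
    ultimately show ?thesis
      by (simp only: sum_distrib_left)
  qed
  also have "\<dots> = (\<Sum>j\<in>R. \<Sum>k\<in>R. if k = j then u j * cnj (u k) * of_nat G else 0)"
  proof (intro sum.cong refl)
    fix j k assume jk: "j \<in> R" "k \<in> R"
    have "int G dvd int j - int k \<longleftrightarrow> k = j"
    proof
      assume dv: "int G dvd int j - int k"
      have "j < G" "k < G" using jk assms by auto
      then have "\<bar>int j - int k\<bar> < int G" by linarith
      then have "int j - int k = 0" using dv zdvd_not_zless[of "\<bar>int j - int k\<bar>" "int G"] by fastforce
      then show "k = j" by simp
    qed simp
    then show "u j * cnj (u k) * (\<Sum>n<G. add_char (of_int (int j - int k) * of_nat n / of_nat G))
      = (if k = j then u j * cnj (u k) * of_nat G else 0)"
      unfolding add_char_orthogonality[OF True] by simp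
  qed
  also have "\<dots> = complex_of_real (of_nat G * (\<Sum>j\<in>R. (cmod (u j))\<^sup>2))"
    using fin by (simp add: complex_norm_square[symmetric] sum_distrib_left mult_ac)
  finally show ?thesis by (simp only: of_real_eq_iff)
qed simp

section \<open>Divisor sums\<close>

definition divisor_count :: "nat \<Rightarrow> nat" where
  "divisor_count n = card {q. q dvd n}"

text \<open>Truncation at \<open>Q\<close> is what saves the logarithms of \<open>N\<close>: the
  moments over \<open>n \<le> X\<close> cost powers of \<open>log Q\<close> only, and
  \<open>Q\<close> will be bounded in terms of the height of a level set.\<close>

definition small_divisor_count :: "nat \<Rightarrow> nat \<Rightarrow> nat" where
  "small_divisor_count Q n = card {q\<in>{1..Q}. q dvd n}"

lemma divisor_count_mult_le:
  assumes "a > 0" "b > 0"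
  shows "divisor_count (a * b) \<le> divisor_count a * divisor_count b"
proof -
  have "{q. q dvd a * b} \<subseteq> (\<lambda>p. fst p * snd p) ` ({q. q dvd a} \<times> {q. q dvd b})"
  proof
    fix q assume "q \<in> {q. q dvd a * b}"
    then obtain b' c' where "q = b' * c'" "b' dvd a" "c' dvd b" using division_decomp by blast
    then show "q \<in> (\<lambda>p. fst p * snd p) ` ({q. q dvd a} \<times> {q. q dvd b})"
      by (intro image_eqI[of _ _ "(b', c')"]) auto
  qed
  then have "card {q. q dvd a * b} \<le> card ({q. q dvd a} \<times> {q. q dvd b})"
    using assms by (intro surj_card_le[where f = "\<lambda>p. fst p * snd p"] finite_cartesian_product finite_divisors_nat)
  then show ?thesis by (simp add: divisor_count_def card_cartesian_product)
qed

text \<open>One factor \<open>divisor_count q\<close> counts the factorisations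
  \<open>q = a b\<close>; by submultiplicativity the remaining powers split over \<open>a\<close>
  and \<open>b\<close>, so raising \<open>k\<close> by one at most squares the sum.\<close>

lemma sum_divisor_count_power_le:
  "(\<Sum>q=1..Q. real (divisor_count q) ^ k / real q) \<le> (harm Q :: real) ^ (2 ^ k)"
proof (induction k)
  case 0
  show ?case by (simp add: harm_def divide_inverse)
next
  case (Suc k)
  let ?g = "\<lambda>q. real (divisor_count q) ^ k / real q"
  have "(\<Sum>q=1..Q. real (divisor_count q) ^ Suc k / real q)
      = (\<Sum>q=1..Q. \<Sum>a\<in>{a. a dvd q}. ?g q)"
    by (simp add: divisor_count_def)
  also have "\<dots> = (\<Sum>p\<in>(SIGMA q:{1..Q}. {a. a dvd q}). ?g (fst p))"
    by (subst sum.Sigma) (auto simp: case_prod_beta intro: finite_divisors_nat)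
  also have "\<dots> \<le> (\<Sum>p\<in>{1..Q} \<times> {1..Q}. ?g (fst p) * ?g (snd p))"
  proof (rule sum_le_included[where i = "\<lambda>p. (fst p * snd p, fst p)"])
    show "finite (SIGMA q:{1..Q}. {a. a dvd q})"
      by (intro finite_SigmaI) (auto intro: finite_divisors_nat)
    show "\<forall>x\<in>SIGMA q:{1..Q}. {a. a dvd q}. \<exists>y\<in>{1..Q} \<times> {1..Q}.
        (fst y * snd y, fst y) = x \<and> ?g (fst x) \<le> ?g (fst y) * ?g (snd y)"
    proof
      fix x assume "x \<in> (SIGMA q:{1..Q}. {a. a dvd q})"
      then obtain q a where x: "x = (q, a)" "q \<in> {1..Q}" "a dvd q" by auto
      then obtain b where b: "q = a * b" by auto
      have pos: "a > 0" "b > 0" using x b by (auto intro: Nat.gr0I)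
      have "a \<le> q" "b \<le> q" "q \<le> Q" using pos b x by auto
      then have mem: "(a, b) \<in> {1..Q} \<times> {1..Q}" using pos by auto
      have "real (divisor_count (a * b)) \<le> real (divisor_count a) * real (divisor_count b)"
        using divisor_count_mult_le[OF pos] by (metis of_nat_le_iff of_nat_mult)
      then have "real (divisor_count (a * b)) ^ k \<le> (real (divisor_count a) * real (divisor_count b)) ^ k"
        by (intro power_mono) auto
      then have "?g (a * b) \<le> ?g a * ?g b"
        using pos by (simp add: power_mult_distrib divide_right_mono)
      then show "\<exists>y\<in>{1..Q} \<times> {1..Q}.
        (fst y * snd y, fst y) = x \<and> ?g (fst x) \<le> ?g (fst y) * ?g (snd y)"
        using mem x b by (intro bexI[of _ "(a, b)"]) auto
    qed
  qed auto
  also have "\<dots> = (\<Sum>q=1..Q. ?g q) * (\<Sum>q=1..Q. ?g q)"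
    by (simp add: sum_product sum.cartesian_product case_prod_beta)
  also have "\<dots> \<le> harm Q ^ (2 ^ k) * harm Q ^ (2 ^ k)"
    using Suc.IH by (intro mult_mono) (auto intro!: sum_nonneg simp: harm_nonneg)
  also have "\<dots> = harm Q ^ (2 ^ Suc k)"
    by (simp add: power_add[symmetric] mult_2)
  finally show ?case .
qed

text \<open>The divisor \<open>m\<close> is carried along for the induction: expanding one factor as
  a sum over \<open>q \<le> Q\<close> turns the condition \<open>m dvd n\<close> into
  \<open>lcm m q dvd n\<close>, a condition of the same kind.\<close>

lemma small_divisor_moment_multiples:
  assumes "m > 0"
  shows "(\<Sum>n\<in>{n\<in>{1..X}. m dvd n}. real (small_divisor_count Q n) ^ k)
    \<le> real X / real m * real (divisor_count m) ^ k
        * (\<Prod>i<k. \<Sum>q=1..Q. real (divisor_count q) ^ i / real q)"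
  using assms
proof (induction k arbitrary: m)
  case 0
  have "inj_on (\<lambda>n. n div m) {n\<in>{1..X}. m dvd n}"
    by (rule inj_onI) (metis (mono_tags, lifting) dvd_mult_div_cancel mem_Collect_eq)
  moreover have "(\<lambda>n. n div m) ` {n\<in>{1..X}. m dvd n} \<subseteq> {1..X div m}"
    using 0 by (auto simp: div_le_mono Suc_le_eq div_greater_zero_iff dvd_imp_le)
  ultimately have "card {n\<in>{1..X}. m dvd n} \<le> card {1..X div m}"
    by (metis card_inj_on_le finite_atLeastAtMost)
  then have "real (card {n\<in>{1..X}. m dvd n}) \<le> real (X div m)" by simp
  also have "\<dots> \<le> real X / real m" by (simp add: of_nat_div_le_of_nat)
  finally show ?case by simp
next
  case (Suc k)
  let ?D = "\<lambda>n. real (small_divisor_count Q n)"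
  let ?P = "\<lambda>k. (\<Prod>i<k. \<Sum>q=1..Q. real (divisor_count q) ^ i / real q)"
  let ?f = "\<lambda>l. real X / real l * real (divisor_count l) ^ k * ?P k"
  have P_nonneg: "?P k \<ge> 0" by (intro prod_nonneg sum_nonneg) auto
  have "(\<Sum>n\<in>{n\<in>{1..X}. m dvd n}. ?D n ^ Suc k)
      = (\<Sum>n\<in>{n\<in>{1..X}. m dvd n}. \<Sum>q\<in>{q\<in>{1..Q}. q dvd n}. ?D n ^ k)"
    by (simp add: small_divisor_count_def)
  also have "\<dots> = (\<Sum>n\<in>{n\<in>{1..X}. m dvd n}. \<Sum>q=1..Q. if q dvd n then ?D n ^ k else 0)"
    by (rule sum.cong[OF refl], rule sum.inter_filter) simp
  also have "\<dots> = (\<Sum>q=1..Q. \<Sum>n\<in>{n\<in>{1..X}. m dvd n}. if q dvd n then ?D n ^ k else 0)"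
    by (rule sum.swap)
  also have "\<dots> = (\<Sum>q=1..Q. \<Sum>n\<in>{n\<in>{1..X}. lcm m q dvd n}. ?D n ^ k)"
  proof (rule sum.cong[OF refl])
    fix q
    have "{n\<in>{n\<in>{1..X}. m dvd n}. q dvd n} = {n\<in>{1..X}. lcm m q dvd n}" by auto
    then show "(\<Sum>n\<in>{n\<in>{1..X}. m dvd n}. if q dvd n then ?D n ^ k else 0)
        = (\<Sum>n\<in>{n\<in>{1..X}. lcm m q dvd n}. ?D n ^ k)"
      by (simp add: sum.inter_filter[symmetric])
  qed
  also have "\<dots> \<le> (\<Sum>q=1..Q. ?f (lcm m q))"
    using Suc.prems by (intro sum_mono Suc.IH) (auto intro: lcm_pos_nat)
  \<comment> \<open>Each \<open>q\<close> is recorded as \<open>g q'\<close> with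
    \<open>g = gcd m q\<close>; then \<open>lcm m q = m q'\<close>, and the choices of
    \<open>g\<close> cost one factor \<open>divisor_count m\<close>.\<close>
  also have "\<dots> \<le> (\<Sum>p\<in>{g. g dvd m} \<times> {1..Q}. ?f (m * snd p))"
  proof (rule sum_le_included[where i = "\<lambda>p. fst p * snd p"])
    show "\<forall>q\<in>{1..Q}. \<exists>p\<in>{g. g dvd m} \<times> {1..Q}. fst p * snd p = q \<and> ?f (lcm m q) \<le> ?f (m * snd p)"
    proof
      fix q assume q: "q \<in> {1..Q}"
      let ?g = "gcd m q"
      have "?g * (q div ?g) = q" by simp
      moreover have "q div ?g \<in> {1..Q}"
        using q by (auto simp: Suc_le_eq div_greater_zero_iff gcd_le2_nat intro: le_trans[OF div_le_dividend])
      moreover have "lcm m q = m * (q div ?g)"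
        by (simp add: lcm_nat_def div_mult_swap)
      ultimately show "\<exists>p\<in>{g. g dvd m} \<times> {1..Q}. fst p * snd p = q \<and> ?f (lcm m q) \<le> ?f (m * snd p)"
        by (intro bexI[of _ "(?g, q div ?g)"]) auto
    qed
  qed (use Suc.prems P_nonneg in \<open>auto intro!: mult_nonneg_nonneg finite_cartesian_product finite_divisors_nat\<close>)
  also have "\<dots> = (\<Sum>g\<in>{g. g dvd m}. \<Sum>q=1..Q. ?f (m * q))"
    by (simp only: sum.cartesian_product case_prod_unfold)
  also have "\<dots> = real (divisor_count m) * (\<Sum>q=1..Q. ?f (m * q))"
    by (simp add: divisor_count_def)
  also have "\<dots> \<le> real (divisor_count m) * (\<Sum>q=1..Q.
      real X / real m * real (divisor_count m) ^ k * ?P k * (real (divisor_count q) ^ k / real q))"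
  proof (intro mult_left_mono sum_mono)
    fix q assume "q \<in> {1..Q}"
    then have "divisor_count (m * q) \<le> divisor_count m * divisor_count q"
      using Suc.prems by (intro divisor_count_mult_le) auto
    then have "real (divisor_count (m * q)) ^ k \<le> (real (divisor_count m) * real (divisor_count q)) ^ k"
      by (intro power_mono) (simp_all flip: of_nat_mult)
    then have "real X / real (m * q) * real (divisor_count (m * q)) ^ k * ?P k
      \<le> real X / real (m * q) * (real (divisor_count m) * real (divisor_count q)) ^ k * ?P k"
      using P_nonneg by (intro mult_right_mono mult_left_mono) auto
    then show "?f (m * q) \<le> real X / real m * real (divisor_count m) ^ k * ?P k * (real (divisor_count q) ^ k / real q)"
      by (simp add: power_mult_distrib mult_ac)
  qed simp
  also have "\<dots> = real X / real m * real (divisor_count m) ^ Suc k * ?P (Suc k)"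
    by (simp only: sum_distrib_left[symmetric] prod.lessThan_Suc power_Suc) (simp only: mult_ac)
  finally show ?case .
qed

lemma harm_ge_1: "Q > 0 \<Longrightarrow> harm Q \<ge> (1 :: real)"
  using harm_mono[of 1 Q, where 'a = real] by (simp add: harm_def)

lemma small_divisor_moment:
  assumes "Q > 0"
  shows "(\<Sum>n=1..X. real (small_divisor_count Q n) ^ k) \<le> real X * harm Q ^ (2 ^ k)"
proof -
  let ?P = "\<lambda>k. (\<Prod>i<k. \<Sum>q=1..Q. real (divisor_count q) ^ i / real q)"
  \<comment> \<open>The extra factor \<open>harm Q\<close> makes the exponents add up exactly, since
    \<open>1 + (1 + 2 + ... + 2^(k-1)) = 2^k\<close>.\<close>
  have P: "0 \<le> ?P k \<and> ?P k * harm Q \<le> harm Q ^ (2 ^ k)" for k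
  proof (induction k)
    case (Suc k)
    have nn: "(\<Sum>q=1..Q. real (divisor_count q) ^ k / real q) \<ge> 0" by (intro sum_nonneg) auto
    have "?P (Suc k) * harm Q = (?P k * harm Q) * (\<Sum>q=1..Q. real (divisor_count q) ^ k / real q)"
      by simp
    also have "\<dots> \<le> harm Q ^ (2 ^ k) * harm Q ^ (2 ^ k)"
      using Suc nn by (intro mult_mono sum_divisor_count_power_le) (auto simp: harm_nonneg)
    also have "\<dots> = harm Q ^ (2 ^ Suc k)" by (simp add: power_add[symmetric] mult_2)
    finally show ?case using Suc nn by simp
  qed simp
  have "?P k * 1 \<le> ?P k * harm Q"
    using P[of k] harm_ge_1[OF assms] by (intro mult_left_mono) auto
  then have "?P k \<le> harm Q ^ (2 ^ k)" using P[of k] by linarith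
  then have "real X * ?P k \<le> real X * harm Q ^ (2 ^ k)" by (intro mult_left_mono) auto
  moreover have "(\<Sum>n=1..X. real (small_divisor_count Q n) ^ k) \<le> real X * ?P k"
  proof -
    have "{n\<in>{1..X}. 1 dvd n} = {1..X}" "divisor_count 1 = 1" by (auto simp: divisor_count_def)
    then show ?thesis using small_divisor_moment_multiples[OF zero_less_one, where X = X and Q = Q and k = k] by simp
  qed
  ultimately show ?thesis by linarith
qed

lemma sum_divisor_count_le:
  "(\<Sum>n=1..X. real (divisor_count n)) \<le> real X * harm X ^ 2"
proof (cases "X > 0")
  case True
  have "(\<Sum>n=1..X. real (divisor_count n)) = (\<Sum>n=1..X. real (small_divisor_count X n) ^ 1)"
  proof (intro sum.cong refl)
    fix n assume n: "n \<in> {1..X}"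
    have "{q. q dvd n} = {q\<in>{1..X}. q dvd n}"
      using n by (auto dest: dvd_imp_le simp: Suc_le_eq intro: Nat.gr0I)
    then show "real (divisor_count n) = real (small_divisor_count X n) ^ 1"
      by (simp add: divisor_count_def small_divisor_count_def)
  qed
  also have "\<dots> \<le> real X * harm X ^ (2 ^ 1)" by (rule small_divisor_moment[OF True])
  finally show ?thesis by simp
qed simp

text \<open>Follows from \<open>harm Q \<le> 1 + ln Q\<close> and
  \<open>ln Q \<le> Q powr s / s\<close> with \<open>s = \<epsilon>/k\<close>.\<close>

lemma harm_power_le_powr:
  fixes \<epsilon> :: real
  assumes "\<epsilon> > 0"
  shows "\<exists>C>0. \<forall>Q>0. (harm Q :: real) ^ k \<le> C * real Q powr \<epsilon>"
proof (cases "k = 0")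
  case True
  then show ?thesis using assms by (intro exI[of _ 1]) (auto simp: ge_one_powr_ge_zero)
next
  case False
  define s where "s = \<epsilon> / real k"
  have s: "s > 0" using assms False by (simp add: s_def)
  have "(harm Q :: real) ^ k \<le> (1 + 1 / s) ^ k * real Q powr \<epsilon>" if Q: "Q > 0" for Q
  proof -
    have "(harm (Suc (Q - 1)) :: real) - ln (Suc (Q - 1)) \<le> harm (Suc 0) - ln (Suc 0)"
      using decseqD[OF decseq_harm_diff_ln, of 0 "Q - 1"] by simp
    then have "(harm Q :: real) \<le> 1 + ln Q" using Q by (simp add: harm_def)
    also have "ln Q \<le> Q powr s / s" using ln_powr_bound[of "real Q" s] Q s by simp
    also have "(1::real) \<le> Q powr s" using Q s by (simp add: ge_one_powr_ge_zero)
    finally have "(harm Q :: real) \<le> (1 + 1 / s) * Q powr s" by (simp add: algebra_simps)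
    then have "(harm Q :: real) ^ k \<le> ((1 + 1 / s) * Q powr s) ^ k"
      by (intro power_mono) (auto simp: harm_nonneg)
    also have "\<dots> = (1 + 1 / s) ^ k * real Q powr \<epsilon>"
      using Q False by (simp add: power_mult_distrib powr_power s_def)
    finally show ?thesis .
  qed
  moreover have "(1 + 1 / s) ^ k > 0" using s by (intro zero_less_power) (simp add: add_pos_pos)
  ultimately show ?thesis by blast
qed

section \<open>Weyl sums\<close>

lemma of_real_eq_imp_le_norm:
  "complex_of_real x = z \<Longrightarrow> x \<le> cmod z"
  by auto

text \<open>In each row \<open>i\<close>, the difference 0 occurs once and every larger difference
  at most twice.\<close>

lemma sum_abs_diff_le:
  fixes g :: "nat \<Rightarrow> real"
  assumes g: "\<And>d. g d \<ge> 0"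
  shows "(\<Sum>i<L. \<Sum>j<L. g (if j \<le> i then i - j else j - i)) \<le> real L * (g 0 + 2 * (\<Sum>d=1..<L. g d))"
proof -
  have "(\<Sum>j<L. g (if j \<le> i then i - j else j - i)) \<le> g 0 + 2 * (\<Sum>d=1..<L. g d)" if i: "i < L" for i
  proof -
    have split: "{..<L} = ({..<i} \<union> {i}) \<union> {Suc i..<L}" using i by auto
    have "(\<Sum>j<L. g (if j \<le> i then i - j else j - i))
        = (\<Sum>j<i. g (i - j)) + g 0 + (\<Sum>j=Suc i..<L. g (j - i))"
      unfolding split by (subst sum.union_disjoint; auto intro!: sum.cong)+
    also have "(\<Sum>j<i. g (i - j)) \<le> (\<Sum>d=1..<L. g d)"
      by (rule sum_le_included[where i = "\<lambda>d. i - d"])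
         (use g i in \<open>auto intro!: bexI[of _ "i - _"]\<close>)
    also have "(\<Sum>j=Suc i..<L. g (j - i)) \<le> (\<Sum>d=1..<L. g d)"
      by (rule sum_le_included[where i = "\<lambda>d. d + i"])
         (use g i in \<open>auto intro!: bexI[of _ "_ - i"]\<close>)
    finally show ?thesis by simp
  qed
  then have "(\<Sum>i<L. \<Sum>j<L. g (if j \<le> i then i - j else j - i))
      \<le> (\<Sum>i<L. g 0 + 2 * (\<Sum>d=1..<L. g d))"
    by (intro sum_mono) auto
  then show ?thesis by simp
qed

section \<open>Differencing for quadratic Weyl sums\<close>

definition weyl_sum :: "nat \<Rightarrow> real \<Rightarrow> complex" where
  "weyl_sum Y \<beta> = (\<Sum>y=1..Y. add_char (real y ^ 2 * \<beta>))"

text \<open>The correlation of the summands of \<open>weyl_sum\<close> at distance \<open>d\<close>: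
  since \<open>(m + d)^2 - m^2 = d^2 + 2 d m\<close>, it is a linear exponential sum up to a
  unimodular factor, over those \<open>m\<close> for which both \<open>m\<close> and
  \<open>m + d\<close> lie in \<open>[1, Y]\<close>.\<close>

definition weyl_diff :: "nat \<Rightarrow> real \<Rightarrow> nat \<Rightarrow> real" where
  "weyl_diff Y \<beta> d = cmod (\<Sum>m\<in>{1..<Suc (Y - d)}. add_char (real m * (real (2 * d) * \<beta>)))"

lemma weyl_diff_nonneg: "weyl_diff Y \<beta> d \<ge> 0"
  by (simp add: weyl_diff_def)

lemma weyl_diff_le: "weyl_diff Y \<beta> d \<le> real Y"
proof -
  have "weyl_diff Y \<beta> d \<le> (\<Sum>m\<in>{1..<Suc (Y - d)}. cmod (add_char (real m * (real (2 * d) * \<beta>))))"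
    unfolding weyl_diff_def by (rule norm_sum)
  also have "\<dots> \<le> real Y" by simp
  finally show ?thesis .
qed

lemma weyl_diff_chord_le: "weyl_diff Y \<beta> d * chord (real (2 * d) * \<beta>) \<le> 2"
  unfolding weyl_diff_def by (rule norm_add_char_interval_sum_le)

text \<open>The sum is averaged over the shifts \<open>h < H\<close>. Cauchy-Schwarz over the at
  most \<open>2 Y\<close> positions leaves correlations at distances below \<open>H\<close>, each
  distance occurring at most \<open>2 H\<close> times.\<close>

lemma van_der_corput:
  assumes H: "1 \<le> H" "H \<le> Y"
  shows "(cmod (weyl_sum Y \<beta>))\<^sup>2 \<le> 2 * real Y / real H * (real Y + 2 * (\<Sum>d=1..<H. weyl_diff Y \<beta> d))"
proof -
  define F where "F m = (if m \<in> {1..int Y} then add_char (of_int m ^ 2 * \<beta>) else 0)" for m :: int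
  \<comment> \<open>\<open>I\<close> holds every position \<open>m\<close> for which some
    \<open>m + h\<close> with \<open>h < H\<close> lies in \<open>[1, Y]\<close>, so each shifted
    sum over \<open>I\<close> is the complete Weyl sum.\<close>
  define I where "I = {2 - int H..int Y}"
  have finI: "finite I" by (simp add: I_def)
  have V: "weyl_sum Y \<beta> = (\<Sum>m=1..int Y. F m)"
  proof -
    have "weyl_sum Y \<beta> = (\<Sum>y=1..Y. F (int y))"
      unfolding weyl_sum_def by (intro sum.cong) (auto simp: F_def)
    also have "\<dots> = (\<Sum>m\<in>int ` {1..Y}. F m)" by (subst sum.reindex) auto
    also have "int ` {1..Y} = {1..int Y}" using image_int_atLeastAtMost[of 1 Y] by simp
    finally show ?thesis .
  qed
  have shift: "(\<Sum>m\<in>I. F (m + int h)) = weyl_sum Y \<beta>" if h: "h < H" for h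
  proof -
    have "(\<Sum>m\<in>I. F (m + int h)) = (\<Sum>m\<in>(\<lambda>m. m + int h) ` I. F m)"
      by (subst sum.reindex) (auto simp: inj_on_def)
    also have "\<dots> = (\<Sum>m=1..int Y. F m)"
    proof (rule sum.mono_neutral_right)
      show "{1..int Y} \<subseteq> (\<lambda>m. m + int h) ` I"
      proof
        fix m assume "m \<in> {1..int Y}"
        then have "m - int h \<in> I" using h by (auto simp: I_def)
        then show "m \<in> (\<lambda>m. m + int h) ` I" by (intro image_eqI[of _ _ "m - int h"]) auto
      qed
    qed (auto simp: F_def finI)
    finally show ?thesis using V by simp
  qed
  define c where "c d = cmod (\<Sum>m=1..int Y. F (m + int d) * cnj (F m))" for d :: nat
  have corr: "cmod (\<Sum>m\<in>I. F (m + int h) * cnj (F (m + int h'))) = c (h - h')" if h: "h' \<le> h" "h < H" for h h'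
  proof -
    have "(\<Sum>m\<in>I. F (m + int h) * cnj (F (m + int h')))
        = (\<Sum>m\<in>(\<lambda>m. m + int h') ` I. F (m + int (h - h')) * cnj (F m))"
      using h by (subst sum.reindex) (auto simp: inj_on_def of_nat_diff)
    also have "\<dots> = (\<Sum>m=1..int Y. F (m + int (h - h')) * cnj (F m))"
    proof (rule sum.mono_neutral_right)
      show "{1..int Y} \<subseteq> (\<lambda>m. m + int h') ` I"
      proof
        fix m assume "m \<in> {1..int Y}"
        then have "m - int h' \<in> I" using h by (auto simp: I_def)
        then show "m \<in> (\<lambda>m. m + int h') ` I" by (intro image_eqI[of _ _ "m - int h'"]) auto
      qed
    qed (auto simp: F_def finI)
    finally show ?thesis by (simp add: c_def)
  qed
  have c_eq: "c d = weyl_diff Y \<beta> d" for d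
  proof -
    have "(\<Sum>m=1..int Y. F (m + int d) * cnj (F m)) = (\<Sum>m\<in>int ` {1..<Suc (Y - d)}. F (m + int d) * cnj (F m))"
    proof (rule sum.mono_neutral_right)
      have img: "int ` {1..<Suc (Y - d)} = {1..int (Y - d)}"
        using image_int_atLeastAtMost[of 1 "Y - d"] by (simp add: atLeastLessThanSuc_atLeastAtMost)
      show "int ` {1..<Suc (Y - d)} \<subseteq> {1..int Y}" unfolding img by auto
      show "\<forall>m\<in>{1..int Y} - int ` {1..<Suc (Y - d)}. F (m + int d) * cnj (F m) = 0"
      proof
        fix m assume "m \<in> {1..int Y} - int ` {1..<Suc (Y - d)}"
        then have "1 \<le> m" "\<not> m \<le> int (Y - d)" unfolding img by auto
        then have "int Y < m + int d" by linarith
        then show "F (m + int d) * cnj (F m) = 0" by (simp add: F_def)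
      qed
    qed auto
    also have "\<dots> = (\<Sum>m\<in>{1..<Suc (Y - d)}. F (int m + int d) * cnj (F (int m)))"
      by (subst sum.reindex) auto
    also have "\<dots> = (\<Sum>m\<in>{1..<Suc (Y - d)}. add_char (real d ^ 2 * \<beta>) * add_char (real m * (real (2 * d) * \<beta>)))"
    proof (intro sum.cong refl)
      fix m assume m: "m \<in> {1..<Suc (Y - d)}"
      then have "F (int m + int d) * cnj (F (int m)) = add_char (real (m + d) ^ 2 * \<beta> - real m ^ 2 * \<beta>)"
        by (auto simp: F_def cnj_add_char add_char_add[symmetric])
      also have "real (m + d) ^ 2 * \<beta> - real m ^ 2 * \<beta> = real d ^ 2 * \<beta> + real m * (real (2 * d) * \<beta>)"
        by (simp add: power2_eq_square algebra_simps)
      finally show "F (int m + int d) * cnj (F (int m))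
          = add_char (real d ^ 2 * \<beta>) * add_char (real m * (real (2 * d) * \<beta>))"
        by (simp only: add_char_add)
    qed
    also have "\<dots> = add_char (real d ^ 2 * \<beta>) * (\<Sum>m\<in>{1..<Suc (Y - d)}. add_char (real m * (real (2 * d) * \<beta>)))"
      by (rule sum_distrib_left[symmetric])
    finally show ?thesis by (simp only: c_def weyl_diff_def norm_mult norm_add_char mult_1)
  qed
  have corr2: "cmod (\<Sum>m\<in>I. F (m + int h) * cnj (F (m + int h'))) = c (if h' \<le> h then h - h' else h' - h)"
    if h: "h < H" "h' < H" for h h'
  proof (cases "h' \<le> h")
    case False
    have "cmod (\<Sum>m\<in>I. F (m + int h) * cnj (F (m + int h')))
        = cmod (cnj (\<Sum>m\<in>I. F (m + int h') * cnj (F (m + int h))))"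
      by (simp add: mult.commute)
    also have "\<dots> = c (h' - h)" using corr[of h h'] False h by (simp del: cnj_sum)
    finally show ?thesis using False by simp
  qed (use corr h in auto)
  have "real H * weyl_sum Y \<beta> = (\<Sum>h<H. \<Sum>m\<in>I. F (m + int h))"
    using shift by simp
  also have "\<dots> = (\<Sum>m\<in>I. \<Sum>h<H. F (m + int h))" by (rule sum.swap)
  finally have "real H * cmod (weyl_sum Y \<beta>) = cmod (\<Sum>m\<in>I. \<Sum>h<H. F (m + int h))"
    by (metis norm_mult norm_of_real abs_of_nat of_real_of_nat_eq)
  also have "\<dots> \<le> (\<Sum>m\<in>I. cmod (\<Sum>h<H. F (m + int h)))" by (rule norm_sum)
  finally have "(real H * cmod (weyl_sum Y \<beta>))\<^sup>2 \<le> (\<Sum>m\<in>I. 1 * cmod (\<Sum>h<H. F (m + int h)))\<^sup>2"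
    by (intro power_mono) auto
  also have "\<dots> \<le> (\<Sum>m\<in>I. 1\<^sup>2) * (\<Sum>m\<in>I. (cmod (\<Sum>h<H. F (m + int h)))\<^sup>2)"
    by (rule Cauchy_Schwarz_ineq_sum)
  also have "\<dots> \<le> (2 * real Y) * (real H * (real Y + 2 * (\<Sum>d=1..<H. weyl_diff Y \<beta> d)))"
  proof (intro mult_mono)
    show "(\<Sum>m\<in>I. 1\<^sup>2) \<le> 2 * real Y" using H by (simp add: I_def)
    have "complex_of_real (\<Sum>m\<in>I. (cmod (\<Sum>h<H. F (m + int h)))\<^sup>2)
        = (\<Sum>m\<in>I. \<Sum>h<H. \<Sum>h'<H. F (m + int h) * cnj (F (m + int h')))"
      by (simp only: of_real_sum complex_norm_square cnj_sum sum_product)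
    also have "\<dots> = (\<Sum>h<H. \<Sum>h'<H. \<Sum>m\<in>I. F (m + int h) * cnj (F (m + int h')))"
      by (subst sum.swap, rule sum.cong[OF refl], rule sum.swap)
    finally have "(\<Sum>m\<in>I. (cmod (\<Sum>h<H. F (m + int h)))\<^sup>2)
        \<le> cmod (\<Sum>h<H. \<Sum>h'<H. \<Sum>m\<in>I. F (m + int h) * cnj (F (m + int h')))"
      by (rule of_real_eq_imp_le_norm)
    also have "\<dots> \<le> (\<Sum>h<H. \<Sum>h'<H. cmod (\<Sum>m\<in>I. F (m + int h) * cnj (F (m + int h'))))"
      by (intro sum_norm_le norm_sum)
    also have "\<dots> = (\<Sum>h<H. \<Sum>h'<H. c (if h' \<le> h then h - h' else h' - h))"
      using corr2 by (intro sum.cong refl) auto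
    also have "\<dots> \<le> real H * (c 0 + 2 * (\<Sum>d=1..<H. c d))"
      by (intro sum_abs_diff_le) (simp add: c_def)
    also have "\<dots> \<le> real H * (real Y + 2 * (\<Sum>d=1..<H. weyl_diff Y \<beta> d))"
      unfolding c_eq using weyl_diff_le by (intro mult_left_mono add_mono) auto
    finally show "(\<Sum>m\<in>I. (cmod (\<Sum>h<H. F (m + int h)))\<^sup>2) \<le> \<dots>" .
  qed (auto intro!: sum_nonneg)
  finally have "real H * (real H * (cmod (weyl_sum Y \<beta>))\<^sup>2)
      \<le> real H * (2 * real Y * (real Y + 2 * (\<Sum>d=1..<H. weyl_diff Y \<beta> d)))"
    by (simp add: power_mult_distrib power2_eq_square mult_ac)
  then have "real H * (cmod (weyl_sum Y \<beta>))\<^sup>2 \<le> 2 * real Y * (real Y + 2 * (\<Sum>d=1..<H. weyl_diff Y \<beta> d))"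
    using H by (subst (asm) mult_le_cancel_left_pos) auto
  then show ?thesis using H by (simp add: pos_le_divide_eq mult.commute)
qed

section \<open>Weyl sums near a rational point\<close>

lemma chord_near_rational:
  fixes a :: int and q :: nat
  assumes "q > 0" "\<not> int q dvd a" "\<bar>\<delta>\<bar> \<le> 1 / (2 * real q)"
  shows "2 / real q \<le> chord (of_int a / real q + \<delta>)"
proof -
  let ?x = "of_int a / real q + \<delta>"
  let ?n = "round ?x"
  have "a - int q * ?n \<noteq> 0" using assms(2) by (metis dvd_triv_left eq_iff_diff_eq_0)
  then have "1 \<le> \<bar>a - int q * ?n\<bar>" by linarith
  then have "1 \<le> \<bar>real_of_int (a - int q * ?n)\<bar>" by linarith
  also have "real_of_int (a - int q * ?n) = real q * (of_int a / real q - of_int ?n)"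
    using assms(1) by (simp add: field_simps)
  finally have "1 \<le> real q * \<bar>of_int a / real q - of_int ?n\<bar>" by (simp add: abs_mult)
  then have "1 / real q \<le> \<bar>of_int a / real q - of_int ?n\<bar>" using assms(1) by (simp add: field_simps)
  also have "\<dots> \<le> \<bar>?x - of_int ?n\<bar> + \<bar>\<delta>\<bar>" by linarith
  finally have "1 / real q - 1 / (2 * real q) \<le> \<bar>?x - of_int ?n\<bar>" using assms(3) by linarith
  then have "1 / (2 * real q) \<le> \<bar>?x - of_int ?n\<bar>" by simp
  moreover have "4 * \<bar>?x - of_int ?n\<bar> \<le> chord (?x - of_int ?n)"
    using of_int_round_abs_le[of ?x] by (intro chord_lower) (simp add: abs_minus_commute)
  ultimately have "4 * (1 / (2 * real q)) \<le> chord ?x" unfolding chord_diff_of_int by (meson mult_left_mono order_trans zero_le_numeral)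
  then show ?thesis by simp
qed

text \<open>If \<open>q\<close> does not divide \<open>2 d\<close>, then \<open>2 d \<beta>\<close>
  stays at distance at least \<open>1/(2q)\<close> from the integers and the correlation is at most
  \<open>q\<close>; if \<open>2 d = q k\<close>, then \<open>2 d \<beta>\<close> is
  \<open>k \<theta>\<close> modulo 1. The bound \<open>b\<close> is left abstract so that a trivial
  and a sharper estimate can be drawn from one decomposition.\<close>

lemma sum_weyl_diff_le:
  fixes a :: int and q :: nat and b :: "nat \<Rightarrow> real"
  assumes q: "q > 0" "coprime a (int q)" and \<theta>: "\<theta> = real q * \<beta> - of_int a" "\<bar>\<theta>\<bar> \<le> 1 / (4 * real H)"
    and H: "H > 0"
    and b: "\<And>k x. k \<ge> 1 \<Longrightarrow> 0 \<le> x \<Longrightarrow> x \<le> real Y \<Longrightarrow> x * (4 * real k * \<bar>\<theta>\<bar>) \<le> 2 \<Longrightarrow> x \<le> b k"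
  shows "(\<Sum>d=1..<H. weyl_diff Y \<beta> d) \<le> real H * real q + (\<Sum>k=1..2 * H div q. b k)"
proof -
  have \<beta>: "\<beta> = of_int a / real q + \<theta> / real q" using q \<theta> by (simp add: field_simps)
  have b_nonneg: "0 \<le> b k" if "k \<ge> 1" for k using b[of k 0] that by simp
  let ?S = "{d\<in>{1..<H}. q dvd 2 * d}"
  have off: "weyl_diff Y \<beta> d \<le> real q" if d: "d \<in> {1..<H} - ?S" for d
  proof -
    have nd: "\<not> int q dvd int (2 * d) * a"
    proof
      assume "int q dvd int (2 * d) * a"
      then have "int q dvd int (2 * d)" using q(2) by (metis coprime_commute coprime_dvd_mult_left_iff)
      then have "q dvd 2 * d" by (simp only: int_dvd_int_iff)
      then show False using d by auto
    qed
    have "real (2 * d) * \<bar>\<theta>\<bar> \<le> real (2 * H) * (1 / (4 * real H))"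
      using d \<theta>(2) by (intro mult_mono) auto
    also have "\<dots> = 1 / 2" using H by simp
    finally have "\<bar>real (2 * d) * (\<theta> / real q)\<bar> \<le> 1 / (2 * real q)"
      using q by (simp add: abs_mult field_simps)
    then have "2 / real q \<le> chord (of_int (int (2 * d) * a) / real q + real (2 * d) * (\<theta> / real q))"
      by (intro chord_near_rational q nd)
    also have "of_int (int (2 * d) * a) / real q + real (2 * d) * (\<theta> / real q) = real (2 * d) * \<beta>"
      by (simp add: \<beta> algebra_simps)
    finally have "weyl_diff Y \<beta> d * (2 / real q) \<le> weyl_diff Y \<beta> d * chord (real (2 * d) * \<beta>)"
      by (intro mult_left_mono weyl_diff_nonneg)
    also have "\<dots> \<le> 2" by (rule weyl_diff_chord_le)
    finally show ?thesis using q by (simp add: field_simps)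
  qed
  have on: "weyl_diff Y \<beta> d \<le> b (2 * d div q)" "2 * d div q \<in> {1..2 * H div q}" if d: "d \<in> ?S" for d
  proof -
    obtain k where k: "2 * d = q * k" using d by auto
    then have kd: "2 * d div q = k" using q by simp
    have k1: "k \<ge> 1" using k d by (cases k) auto
    have k2: "k \<le> 2 * H div q" using d by (auto simp flip: kd intro!: div_le_mono)
    have "k \<le> 2 * H" using k2 div_le_dividend le_trans by blast
    then have "real k * \<bar>\<theta>\<bar> \<le> real (2 * H) * (1 / (4 * real H))"
      using \<theta>(2) by (intro mult_mono) auto
    also have "\<dots> = 1 / 2" using H by simp
    finally have "4 * \<bar>real k * \<theta>\<bar> \<le> chord (real k * \<theta>)" by (intro chord_lower) (simp add: abs_mult)
    also have "chord (real k * \<theta>) = chord (real k * \<theta> + of_int (int k * a))" by (rule chord_add_of_int[symmetric])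
    also have "real k * \<theta> + of_int (int k * a) = real (2 * d) * \<beta>"
      unfolding k \<theta>(1) by (simp add: algebra_simps)
    finally have "weyl_diff Y \<beta> d * (4 * \<bar>real k * \<theta>\<bar>) \<le> weyl_diff Y \<beta> d * chord (real (2 * d) * \<beta>)"
      by (intro mult_left_mono weyl_diff_nonneg)
    also have "\<dots> \<le> 2" by (rule weyl_diff_chord_le)
    finally show "weyl_diff Y \<beta> d \<le> b (2 * d div q)"
      using k1 by (simp add: kd b weyl_diff_nonneg weyl_diff_le abs_mult mult.assoc)
    show "2 * d div q \<in> {1..2 * H div q}" using k1 k2 kd by simp
  qed
  have "(\<Sum>d=1..<H. weyl_diff Y \<beta> d)
      = (\<Sum>d\<in>{1..<H} - ?S. weyl_diff Y \<beta> d) + (\<Sum>d\<in>?S. weyl_diff Y \<beta> d)"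
    by (rule sum.subset_diff) auto
  also have "(\<Sum>d\<in>{1..<H} - ?S. weyl_diff Y \<beta> d) \<le> (\<Sum>d\<in>{1..<H} - ?S. real q)"
    by (intro sum_mono off)
  also have "\<dots> \<le> (\<Sum>d\<in>{1..<H}. real q)" by (intro sum_mono2) auto
  also have "\<dots> \<le> real H * real q" by (simp add: mult_right_mono)
  also have "(\<Sum>d\<in>?S. weyl_diff Y \<beta> d) \<le> (\<Sum>k=1..2 * H div q. b k)"
  proof (rule sum_le_included[where i = "\<lambda>k. q * k div 2"])
    show "\<forall>d\<in>?S. \<exists>k\<in>{1..2 * H div q}. q * k div 2 = d \<and> weyl_diff Y \<beta> d \<le> b k"
    proof
      fix d assume d: "d \<in> ?S"
      then have "q * (2 * d div q) div 2 = d" by auto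
      then show "\<exists>k\<in>{1..2 * H div q}. q * k div 2 = d \<and> weyl_diff Y \<beta> d \<le> b k"
        using on[OF d] by blast
    qed
  qed (use b_nonneg in auto)
  finally show ?thesis by simp
qed

text \<open>Comparison with the integral of \<open>x powr (-9/10)\<close>, one unit interval at a
  time through the mean value theorem.\<close>

lemma sum_powr_le: "(\<Sum>k=1..n. real k powr (-9/10)) \<le> 10 * real n powr (1/10)"
proof (induction n)
  case (Suc n)
  have "real (Suc n) powr (-9/10) \<le> 10 * (real (Suc n) powr (1/10) - real n powr (1/10))"
  proof (cases "n = 0")
    case False
    have "((\<lambda>x. x powr (1/10)) has_real_derivative 1/10 * x powr (1/10 - 1)) (at x)"
      if "real n \<le> x" for x
      using that False by (intro has_real_derivative_powr) auto
    then obtain z where z: "real n < z" "z < real (Suc n)"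
      "real (Suc n) powr (1/10) - real n powr (1/10) = (real (Suc n) - real n) * (1/10 * z powr (1/10 - 1))"
      using MVT2[of "real n" "real (Suc n)" "\<lambda>x. x powr (1/10)" "\<lambda>x. 1/10 * x powr (1/10 - 1)"] by auto
    have "real (Suc n) powr (-9/10) \<le> z powr (-9/10)"
      using z False by (intro powr_mono2') auto
    then show ?thesis using z(3) by simp
  qed simp
  then show ?case using Suc by simp
qed simp

text \<open>In the first estimate the correlations with \<open>q dvd 2 d\<close> are bounded
  trivially by \<open>Y\<close>. The second interpolates, with weights 1/10 and 9/10, between
  \<open>Y\<close> and \<open>1/(k |\<theta>|)\<close>, where \<theta> is the numerator error; a
  small power of \<open>Y\<close> then replaces the logarithm that summing \<open>1/k\<close> would
  produce.\<close>

lemma weyl_sum_near_rational: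
  fixes a :: int and q :: nat
  assumes q: "q > 0" "coprime a (int q)" and \<theta>: "\<bar>real q * \<beta> - of_int a\<bar> \<le> 1 / (4 * real H)"
    and H: "1 \<le> H" "H \<le> Y"
  shows "(cmod (weyl_sum Y \<beta>))\<^sup>2 \<le> 2 * real Y / real H * (real Y + 2 * (real H * real q + 2 * real H / real q * real Y))"
    and "real q * \<beta> \<noteq> of_int a \<Longrightarrow> (cmod (weyl_sum Y \<beta>))\<^sup>2 \<le> 2 * real Y / real H *
      (real Y + 2 * (real H * real q + 20 * real Y powr (1/5) * \<bar>real q * \<beta> - of_int a\<bar> powr (-9/10)))"
proof -
  let ?\<theta> = "real q * \<beta> - of_int a"
  have "(\<Sum>d=1..<H. weyl_diff Y \<beta> d) \<le> real H * real q + (\<Sum>k=1..2 * H div q. real Y)"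
    by (rule sum_weyl_diff_le[OF q refl \<theta>]) (use H in auto)
  also have "(\<Sum>k=1..2 * H div q. real Y) \<le> 2 * real H / real q * real Y"
  proof -
    have "real (2 * H div q) * real Y \<le> 2 * real H / real q * real Y"
      using of_nat_div_le_of_nat[of "2 * H" q, where 'a = real] by (intro mult_right_mono) auto
    then show ?thesis by simp
  qed
  finally have 1: "(\<Sum>d=1..<H. weyl_diff Y \<beta> d) \<le> real H * real q + 2 * real H / real q * real Y"
    by simp
  show "(cmod (weyl_sum Y \<beta>))\<^sup>2 \<le> 2 * real Y / real H * (real Y + 2 * (real H * real q + 2 * real H / real q * real Y))"
    by (rule order_trans[OF van_der_corput[OF H]]) (intro mult_left_mono add_left_mono 1; simp)
  assume "real q * \<beta> \<noteq> of_int a"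
  then have t: "\<bar>?\<theta>\<bar> > 0" by simp
  have "(\<Sum>d=1..<H. weyl_diff Y \<beta> d)
      \<le> real H * real q + (\<Sum>k=1..2 * H div q. real Y powr (1/10) * (real k * \<bar>?\<theta>\<bar>) powr (-9/10))"
  proof (rule sum_weyl_diff_le[OF q refl \<theta>])
    fix k :: nat and x :: real
    assume k: "k \<ge> 1" and x: "0 \<le> x" "x \<le> real Y" "x * (4 * real k * \<bar>?\<theta>\<bar>) \<le> 2"
    let ?z = "real k * \<bar>?\<theta>\<bar>"
    have z: "?z > 0" using k t by simp
    show "x \<le> real Y powr (1/10) * ?z powr (-9/10)"
    proof (cases "x = 0")
      case False
      have "x * ?z \<le> 1" using x by (simp add: mult_ac)
      then have "x \<le> 1 / ?z" using z by (simp add: field_simps)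
      then have "x powr (9/10) \<le> (1 / ?z) powr (9/10)" using x by (intro powr_mono2) auto
      also have "(1 / ?z) powr (9/10) = ?z powr (-9/10)"
        using z by (simp add: powr_minus_divide powr_divide del: mult_pos_pos)
      finally have "x powr (1/10) * x powr (9/10) \<le> real Y powr (1/10) * ?z powr (-9/10)"
        using x by (intro mult_mono powr_mono2) auto
      then show ?thesis using x False by (simp add: powr_add[symmetric])
    qed simp
  qed (use H in auto)
  also have "(\<Sum>k=1..2 * H div q. real Y powr (1/10) * (real k * \<bar>?\<theta>\<bar>) powr (-9/10))
      = real Y powr (1/10) * \<bar>?\<theta>\<bar> powr (-9/10) * (\<Sum>k=1..2 * H div q. real k powr (-9/10))"
    by (simp add: sum_distrib_left powr_mult mult_ac)
  also have "\<dots> \<le> real Y powr (1/10) * \<bar>?\<theta>\<bar> powr (-9/10) * (20 * real Y powr (1/10))"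
  proof (intro mult_left_mono)
    have "(\<Sum>k=1..2 * H div q. real k powr (-9/10)) \<le> 10 * real (2 * H div q) powr (1/10)" by (rule sum_powr_le)
    also have "real (2 * H div q) powr (1/10) \<le> (2 * real Y) powr (1/10)"
    proof (intro powr_mono2)
      have "2 * H div q \<le> 2 * Y" using H div_le_dividend[of "2 * H" q] by linarith
      then have "real (2 * H div q) \<le> real (2 * Y)" by (simp only: of_nat_le_iff)
      then show "real (2 * H div q) \<le> 2 * real Y" by simp
    qed auto
    also have "(2 * real Y) powr (1/10) = 2 powr (1/10) * real Y powr (1/10)" by (simp add: powr_mult)
    also have "(2::real) powr (1/10) \<le> 2 powr 1" by (intro powr_mono) auto
    finally show "(\<Sum>k=1..2 * H div q. real k powr (-9/10)) \<le> 20 * real Y powr (1/10)"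
      by (simp add: mult_right_mono)
  qed auto
  also have "\<dots> = 20 * (real Y powr (1/10) * real Y powr (1/10)) * \<bar>?\<theta>\<bar> powr (-9/10)" by simp
  also have "real Y powr (1/10) * real Y powr (1/10) = real Y powr (1/5)" by (simp add: powr_add[symmetric])
  finally have 2: "(\<Sum>d=1..<H. weyl_diff Y \<beta> d) \<le> real H * real q + 20 * real Y powr (1/5) * \<bar>?\<theta>\<bar> powr (-9/10)"
    by simp
  show "(cmod (weyl_sum Y \<beta>))\<^sup>2 \<le> 2 * real Y / real H *
      (real Y + 2 * (real H * real q + 20 * real Y powr (1/5) * \<bar>?\<theta>\<bar> powr (-9/10)))"
    by (rule order_trans[OF van_der_corput[OF H]]) (intro mult_left_mono add_left_mono 2; simp)
qed

text \<open>
  The Dirichlet denominator at scale \<open>H \<approx> \<xi>\<^sup>2 Y / 64\<close> already has size \<open>O(\<xi>\<^sup>-\<^sup>2)\<close>, and its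
  numerator error is small enough to run the van der Corput estimate again with \<open>H = Y\<close>; the
  second pass gives the sharp width.
\<close>

lemma weyl_inverse:
  assumes Y: "Y > 0" and \<xi>: "0 < \<xi>" "\<xi> \<le> 1" and large: "10 ^ 10 \<le> \<xi> ^ 6 * real Y"
    and V: "\<xi> * real Y \<le> cmod (weyl_sum Y \<beta>)"
  shows "\<exists>q a. q > (0::nat) \<and> real q \<le> 16 / \<xi>\<^sup>2 \<and>
    \<bar>real q * \<beta> - of_int (a::int)\<bar> \<le> 10 ^ 10 * \<xi> powr (-20/9) / (real Y)\<^sup>2"
proof -
  have y: "real Y > 0" using Y by simp
  have "\<xi> ^ 6 * real Y \<le> \<xi> ^ 4 * real Y" "\<xi> ^ 6 * real Y \<le> \<xi> ^ 2 * real Y"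
    using \<xi> by (auto intro!: mult_right_mono power_decreasing)
  then have l4: "10000000000 \<le> \<xi> ^ 4 * real Y" and l2: "10000000000 \<le> \<xi>\<^sup>2 * real Y" using large by auto
  have V2: "\<xi>\<^sup>2 * (real Y)\<^sup>2 \<le> (cmod (weyl_sum Y \<beta>))\<^sup>2"
    using power_mono[OF V, of 2] \<xi> by (simp add: power_mult_distrib)
  \<comment> \<open>The factor 1/64 keeps the term \<open>4 Y q\<close>, with
    \<open>q \<le> 4 H\<close>, below a quarter of \<open>\<xi>^2 Y^2\<close>.\<close>
  define H where "H = nat \<lfloor>\<xi>\<^sup>2 * real Y / 64\<rfloor>"
  have H_le: "real H \<le> \<xi>\<^sup>2 * real Y / 64" unfolding H_def using l2 by (intro of_nat_floor) auto
  have H_ge: "\<xi>\<^sup>2 * real Y / 128 \<le> real H"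
  proof -
    have "\<xi>\<^sup>2 * real Y / 64 < real H + 1" unfolding H_def using l2 by linarith
    moreover have "128 \<le> \<xi>\<^sup>2 * real Y" using l2 by simp
    ultimately show ?thesis by linarith
  qed
  have H1: "1 \<le> H" using H_ge l2 by linarith
  have "\<xi>\<^sup>2 * real Y \<le> 1 * real Y" using \<xi> by (intro mult_right_mono) (auto intro: power_le_one)
  then have "real H \<le> real Y" using H_le y by linarith
  then have HY: "H \<le> Y" by simp
  have "4 * H > 0" using H1 by simp
  then obtain a k where ak: "coprime a k" "0 < k" "k \<le> int (4 * H)" "\<bar>of_int k * \<beta> - of_int a\<bar> < 1 / real (4 * H)"
    using Dirichlet_approx_coprime by blast
  define q where "q = nat k"
  have q: "q > 0" "coprime a (int q)" "real q \<le> 4 * real H" using ak by (auto simp: q_def)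
  define \<theta> where "\<theta> = real q * \<beta> - of_int a"
  have th: "\<bar>real q * \<beta> - of_int a\<bar> \<le> 1 / (4 * real H)" using ak by (simp add: q_def)
  have e1: "2 * (real Y)\<^sup>2 / real H \<le> \<xi>\<^sup>2 * (real Y)\<^sup>2 / 4"
  proof -
    have "8 \<le> \<xi>\<^sup>2 * real H"
    proof -
      have "8 \<le> \<xi>\<^sup>2 * (\<xi>\<^sup>2 * real Y / 128)" using l4 by (simp add: power2_eq_square power4_eq_xxxx)
      also have "\<dots> \<le> \<xi>\<^sup>2 * real H" using H_ge by (intro mult_left_mono) auto
      finally show ?thesis .
    qed
    then have "(real Y)\<^sup>2 * 8 \<le> (real Y)\<^sup>2 * (\<xi>\<^sup>2 * real H)" by (intro mult_left_mono) auto
    then show ?thesis using H1 by (simp add: field_simps)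
  qed
  have e2: "4 * real Y * real q \<le> \<xi>\<^sup>2 * (real Y)\<^sup>2 / 4"
  proof -
    have "4 * real Y * real q \<le> 4 * real Y * (4 * (\<xi>\<^sup>2 * real Y / 64))"
      using q(3) H_le by (intro mult_left_mono) linarith+
    then show ?thesis by (simp add: power2_eq_square)
  qed
  have q_le: "real q \<le> 16 / \<xi>\<^sup>2"
  proof -
    have "(cmod (weyl_sum Y \<beta>))\<^sup>2 \<le> 2 * (real Y)\<^sup>2 / real H + 4 * real Y * real q + 8 * (real Y)\<^sup>2 / real q"
      using weyl_sum_near_rational(1)[OF q(1,2) th H1 HY] H1 q(1)
      by (simp add: field_simps power2_eq_square)
    then have "\<xi>\<^sup>2 * (real Y)\<^sup>2 / 2 \<le> 8 * (real Y)\<^sup>2 / real q" using V2 e1 e2 by linarith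
    then have "(real Y)\<^sup>2 * (\<xi>\<^sup>2 * real q) \<le> (real Y)\<^sup>2 * 16" using q(1) by (simp add: field_simps)
    then have "\<xi>\<^sup>2 * real q \<le> 16" using y by (simp only: mult_le_cancel_left_pos zero_less_power)
    then show ?thesis using \<xi> by (simp add: field_simps)
  qed
  have "\<bar>\<theta>\<bar> \<le> 10 ^ 10 * \<xi> powr (-20/9) / (real Y)\<^sup>2"
  proof (cases "\<theta> = 0")
    case False
    then have ne: "real q * \<beta> \<noteq> of_int a" by (simp add: \<theta>_def)
    define u where "u = \<bar>\<theta>\<bar> powr (9/10)"
    have u: "u > 0" using False by (simp add: u_def)
    have u_inv: "\<bar>real q * \<beta> - of_int a\<bar> powr (-9/10) = 1 / u"
      by (simp add: u_def \<theta>_def powr_minus_divide)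
    define w where "w = real Y powr (1/5)"
    define z where "z = real Y powr (9/5)"
    have wz: "w > 0" "z > 0" "(real Y)\<^sup>2 = w * z"
      using y by (auto simp: w_def z_def powr_add[symmetric] powr_numeral)
    have bound1: "\<xi> ^ 4 * (z * u) \<le> 20480"
    proof -
      have "(cmod (weyl_sum Y \<beta>))\<^sup>2 \<le> 2 * (real Y)\<^sup>2 / real H + 4 * real Y * real q + 80 * real Y / real H * w / u"
        using weyl_sum_near_rational(2)[OF q(1,2) th H1 HY ne] H1 q(1)
        unfolding u_inv w_def[symmetric] by (simp add: field_simps power2_eq_square)
      then have "\<xi>\<^sup>2 * (real Y)\<^sup>2 / 2 \<le> 80 * real Y / real H * w / u" using V2 e1 e2 by linarith
      also have "80 * real Y / real H \<le> 80 * real Y / (\<xi>\<^sup>2 * real Y / 128)"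
        using H_ge \<xi> y H1 by (intro divide_left_mono mult_pos_pos) auto
      also have "\<dots> = 10240 / \<xi>\<^sup>2" using y by simp
      finally have "\<xi>\<^sup>2 * (w * z) / 2 \<le> 10240 / \<xi>\<^sup>2 * w / u"
        using wz u by (simp add: divide_right_mono mult_right_mono)
      then have "w * (\<xi> ^ 4 * (z * u)) \<le> w * 20480"
        using u \<xi> by (simp add: field_simps power2_eq_square power4_eq_xxxx)
      then show ?thesis using wz by simp
    qed
    \<comment> \<open>An error above \<open>1/(4Y)\<close> would contradict the first pass: it would
      bound \<open>\<xi>^4 Y powr (9/10)\<close> by 81920, whereas \<open>\<xi>^6 Y\<close> is at
      least \<open>10^10\<close> and 6 times 9/10 exceeds 4.\<close>
    have th2: "\<bar>real q * \<beta> - of_int a\<bar> \<le> 1 / (4 * real Y)"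
    proof (rule ccontr)
      assume "\<not> ?thesis"
      then have "1 / (4 * real Y) \<le> \<bar>\<theta>\<bar>" by (simp add: \<theta>_def)
      then have "(1 / (4 * real Y)) powr (9/10) \<le> u" unfolding u_def using y by (intro powr_mono2) auto
      then have "z * (1 / (4 * real Y)) powr (9/10) \<le> z * u" using wz by (intro mult_left_mono) auto
      also have "z * (1 / (4 * real Y)) powr (9/10) = real Y powr (9/10) / 4 powr (9/10)"
      proof -
        have "z = real Y powr (9/10) * real Y powr (9/10)" by (simp add: z_def powr_add[symmetric])
        then show ?thesis using y by (simp add: powr_divide powr_mult)
      qed
      finally have "\<xi> ^ 4 * (real Y powr (9/10) / 4 powr (9/10)) \<le> \<xi> ^ 4 * (z * u)"
        using \<xi> by (intro mult_left_mono) auto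
      also have "\<dots> \<le> 20480" by (rule bound1)
      finally have b: "\<xi> ^ 4 * real Y powr (9/10) \<le> 20480 * 4 powr (9/10)"
        by (simp add: field_simps)
      have "(4::real) powr (9/10) \<le> 4 powr 1" by (intro powr_mono) auto
      then have b': "\<xi> ^ 4 * real Y powr (9/10) \<le> 81920" using b by simp
      have "((10::real) ^ 10) powr (9/10) = 10 ^ 9"
        using powr_realpow[of "10::real" 10, symmetric] powr_realpow[of "10::real" 9] by (simp add: powr_powr)
      moreover have "(10 ^ 10) powr (9/10) \<le> (\<xi> ^ 6 * real Y) powr (9/10)" using large by (intro powr_mono2) auto
      moreover have "(\<xi> ^ 6 * real Y) powr (9/10) = \<xi> powr (27/5) * real Y powr (9/10)"
      proof -
        have "\<xi> ^ 6 = \<xi> powr 6" using \<xi> by (simp add: powr_numeral)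
        then have "(\<xi> ^ 6 * real Y) powr (9/10) = (\<xi> powr 6) powr (9/10) * real Y powr (9/10)"
          using \<xi> y by (simp only: powr_mult)
        then show ?thesis unfolding powr_powr by simp
      qed
      moreover have "\<xi> powr (27/5) \<le> \<xi> powr 4" using \<xi> by (intro powr_mono') auto
      then have "\<xi> powr (27/5) * real Y powr (9/10) \<le> \<xi> ^ 4 * real Y powr (9/10)"
        using \<xi> by (intro mult_right_mono) auto
      ultimately show False using b' by simp
    qed
    have "(cmod (weyl_sum Y \<beta>))\<^sup>2 \<le> 2 * real Y + 4 * real Y * real q + 80 * w / u"
      using weyl_sum_near_rational(2)[OF q(1,2) th2 _ order_refl ne] Y q(1)
      unfolding u_inv w_def[symmetric] by (simp add: field_simps power2_eq_square)
    moreover have "2 * real Y + 4 * real Y * real q \<le> \<xi>\<^sup>2 * (real Y)\<^sup>2 / 2"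
    proof -
      have "1 \<le> 1 / \<xi>\<^sup>2" using \<xi> by (simp add: power_le_one)
      then have "2 * 1 + 4 * real q \<le> 66 / \<xi>\<^sup>2" using q_le by simp
      also have "\<dots> \<le> \<xi>\<^sup>2 * real Y / 2" using l4 \<xi> by (simp add: field_simps power2_eq_square power4_eq_xxxx)
      finally have "real Y * (2 * 1 + 4 * real q) \<le> real Y * (\<xi>\<^sup>2 * real Y / 2)" by (intro mult_left_mono) auto
      then show ?thesis by (simp add: power2_eq_square algebra_simps)
    qed
    ultimately have "\<xi>\<^sup>2 * (real Y)\<^sup>2 / 2 \<le> 80 * w / u" using V2 by linarith
    then have "\<xi>\<^sup>2 * (w * z) / 2 \<le> 80 * w / u" unfolding wz(3) .
    then have "w * (u * (\<xi>\<^sup>2 * z)) \<le> w * 160" using u by (simp add: field_simps)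
    then have "u * (\<xi>\<^sup>2 * z) \<le> 160" using wz by simp
    then have u_le: "u \<le> 160 / (\<xi>\<^sup>2 * z)" using wz \<xi> by (simp add: field_simps)
    \<comment> \<open>Undoing the power 9/10 turns \<open>\<xi>^2\<close> into
      \<open>\<xi> powr (20/9)\<close> and \<open>Y powr (9/5)\<close> into
      \<open>Y^2\<close>.\<close>
    have "\<bar>\<theta>\<bar> = u powr (10/9)" by (simp add: u_def powr_powr)
    also have "\<dots> \<le> (160 / (\<xi>\<^sup>2 * z)) powr (10/9)" using u_le u by (intro powr_mono2) auto
    also have "\<dots> = 160 powr (10/9) * (\<xi> powr (-20/9) / (real Y)\<^sup>2)"
    proof -
      have "(\<xi>\<^sup>2 * z) powr (10/9) = \<xi> powr (20/9) * (real Y)\<^sup>2"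
      proof -
        have "\<xi>\<^sup>2 = \<xi> powr 2" "(real Y)\<^sup>2 = real Y powr 2" using \<xi> y by (simp_all add: powr_numeral)
        moreover have "(\<xi> powr 2 * z) powr (10/9) = (\<xi> powr 2) powr (10/9) * (real Y powr (9/5)) powr (10/9)"
          unfolding z_def by (rule powr_mult)
        ultimately show ?thesis unfolding powr_powr by simp
      qed
      then show ?thesis using wz \<xi> by (simp add: powr_divide powr_minus_divide)
    qed
    also have "\<dots> \<le> 10 ^ 10 * (\<xi> powr (-20/9) / (real Y)\<^sup>2)"
    proof (intro mult_right_mono)
      have "(160::real) powr (10/9) \<le> 160 powr 2" by (intro powr_mono) auto
      then show "(160::real) powr (10/9) \<le> 10 ^ 10" by simp
    qed auto
    finally show ?thesis by simp
  qed simp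
  then show ?thesis using q(1) q_le unfolding \<theta>_def by blast
qed

section \<open>Counting pairs whose difference is nearly rational\<close>

lemma norm_geometric_sum_ge:
  assumes "L > 0" "\<bar>x - of_int a\<bar> \<le> 1 / (16 * real L)"
  shows "real L / 2 \<le> cmod (\<Sum>m<L. add_char (real m * x))"
proof -
  have c: "chord (real m * x) \<le> 1 / 2" if "m < L" for m
  proof -
    have "chord (real m * x) = chord (real m * x - of_int (int m * a))" by (rule chord_diff_of_int[symmetric])
    also have "real m * x - of_int (int m * a) = real m * (x - of_int a)" by (simp add: algebra_simps)
    also have "chord \<dots> \<le> 2 * pi * \<bar>real m * (x - of_int a)\<bar>" by (rule chord_upper)
    also have "\<dots> \<le> 2 * pi * (real L * (1 / (16 * real L)))"
      unfolding abs_mult using assms that by (intro mult_left_mono mult_mono) auto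
    also have "2 * pi * (real L * (1 / (16 * real L))) \<le> 2 * 4 * (real L * (1 / (16 * real L)))"
      using pi_less_4 by (intro mult_right_mono) auto
    also have "\<dots> = 1 / 2" using assms(1) by simp
    finally show ?thesis .
  qed
  have "(\<Sum>m<L. add_char (real m * x)) - of_nat L = (\<Sum>m<L. add_char (real m * x) - 1)"
    by (simp add: sum_subtractf)
  then have "cmod ((\<Sum>m<L. add_char (real m * x)) - of_nat L) \<le> (\<Sum>m<L. chord (real m * x))"
    by (simp add: chord_def norm_sum)
  also have "\<dots> \<le> (\<Sum>m<L. 1 / 2)" using c by (intro sum_mono) auto
  finally have "cmod ((\<Sum>m<L. add_char (real m * x)) - of_nat L) \<le> real L / 2" by simp
  moreover have "real L - cmod ((\<Sum>m<L. add_char (real m * x)) - of_nat L) \<le> cmod (\<Sum>m<L. add_char (real m * x))"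
    using norm_triangle_ineq2[of "of_nat L :: complex" "\<Sum>m<L. add_char (real m * x)"]
      norm_triangle_ineq3[of "of_nat L :: complex" "\<Sum>m<L. add_char (real m * x)"]
    by (simp add: norm_minus_commute abs_le_iff)
  ultimately show ?thesis by linarith
qed

text \<open>The Fourier transform modulo \<open>G\<close> of the indicator of \<open>R\<close>; the
  frequency is a real number so that negative and dilated frequencies need no conversion.\<close>

definition set_fourier :: "nat set \<Rightarrow> nat \<Rightarrow> real \<Rightarrow> complex" where
  "set_fourier R G r = (\<Sum>j\<in>R. add_char (r * real j / real G))"

lemma cmod_set_fourier_minus: "cmod (set_fourier R G (- r)) = cmod (set_fourier R G r)"
proof -
  have "set_fourier R G (- r) = cnj (set_fourier R G r)"
    by (simp add: set_fourier_def cnj_add_char)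
  then show ?thesis by simp
qed

lemma cmod_set_fourier_le: "cmod (set_fourier R G r) \<le> real (card R)"
proof -
  have "cmod (set_fourier R G r) \<le> (\<Sum>j\<in>R. cmod (add_char (r * real j / real G)))"
    unfolding set_fourier_def by (rule norm_sum)
  then show ?thesis by simp
qed

lemma sum_swap_pairs:
  "(\<Sum>i\<in>A. \<Sum>j\<in>B. \<Sum>k\<in>C. \<Sum>l\<in>D. f i j k l) = (\<Sum>k\<in>C. \<Sum>l\<in>D. \<Sum>i\<in>A. \<Sum>j\<in>B. f i j k l)"
proof -
  have "(\<Sum>i\<in>A. \<Sum>j\<in>B. \<Sum>k\<in>C. \<Sum>l\<in>D. f i j k l) = (\<Sum>i\<in>A. \<Sum>k\<in>C. \<Sum>l\<in>D. \<Sum>j\<in>B. f i j k l)"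
    by (rule sum.cong[OF refl], subst sum.swap, rule sum.cong[OF refl], rule sum.swap)
  also have "\<dots> = (\<Sum>k\<in>C. \<Sum>l\<in>D. \<Sum>i\<in>A. \<Sum>j\<in>B. f i j k l)"
    by (subst sum.swap, rule sum.cong[OF refl], rule sum.swap)
  finally show ?thesis .
qed

text \<open>The square of the geometric sum is a Fejer kernel. Opened as a double sum over
  \<open>m\<close> and \<open>m'\<close>, it turns the sum over pairs of \<open>R\<close> into the
  squared modulus of \<open>set_fourier\<close> at \<open>q (m - m')\<close>.\<close>

lemma fejer_pair_sum:
  fixes R :: "nat set"
  shows "(\<Sum>j\<in>R. \<Sum>k\<in>R. (cmod (\<Sum>m<L. add_char (real m * (q * ((real j - real k) / real G)))))\<^sup>2)
    \<le> real L * ((real (card R))\<^sup>2 + 2 * (\<Sum>d=1..<L. (cmod (set_fourier R G (q * real d)))\<^sup>2))"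
proof -
  define g where "g d = (cmod (set_fourier R G (q * real d)))\<^sup>2" for d :: nat
  have "complex_of_real (\<Sum>j\<in>R. \<Sum>k\<in>R. (cmod (\<Sum>m<L. 1 * add_char (real m * (q * ((real j - real k) / real G)))))\<^sup>2)
      = (\<Sum>j\<in>R. \<Sum>k\<in>R. \<Sum>m<L. \<Sum>m'<L.
          add_char (real m * (q * ((real j - real k) / real G)) - real m' * (q * ((real j - real k) / real G))))"
    unfolding of_real_sum norm_sum_add_char_squared by simp
  also have "\<dots> = (\<Sum>m<L. \<Sum>m'<L. \<Sum>j\<in>R. \<Sum>k\<in>R.
          add_char (real m * (q * ((real j - real k) / real G)) - real m' * (q * ((real j - real k) / real G))))"
    by (rule sum_swap_pairs)
  also have "\<dots> = (\<Sum>m<L. \<Sum>m'<L. \<Sum>j\<in>R. \<Sum>k\<in>R. 1 * cnj 1 *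
          add_char (q * (real m - real m') * real j / real G - q * (real m - real m') * real k / real G))"
    by (intro sum.cong refl) (simp add: diff_divide_distrib algebra_simps)
  also have "\<dots> = complex_of_real (\<Sum>m<L. \<Sum>m'<L. (cmod (\<Sum>j\<in>R. 1 * add_char (q * (real m - real m') * real j / real G)))\<^sup>2)"
    unfolding of_real_sum norm_sum_add_char_squared ..
  finally have "(\<Sum>j\<in>R. \<Sum>k\<in>R. (cmod (\<Sum>m<L. 1 * add_char (real m * (q * ((real j - real k) / real G)))))\<^sup>2)
      = (\<Sum>m<L. \<Sum>m'<L. (cmod (\<Sum>j\<in>R. 1 * add_char (q * (real m - real m') * real j / real G)))\<^sup>2)"
    by (simp only: of_real_eq_iff)
  also have "\<dots> = (\<Sum>m<L. \<Sum>m'<L. g (if m' \<le> m then m - m' else m' - m))"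
  proof (intro sum.cong refl)
    fix m m' :: nat
    have "(cmod (\<Sum>j\<in>R. 1 * add_char (q * (real m - real m') * real j / real G)))\<^sup>2
        = (cmod (set_fourier R G (q * (real m - real m'))))\<^sup>2" by (simp add: set_fourier_def)
    also have "\<dots> = g (if m' \<le> m then m - m' else m' - m)"
    proof (cases "m' \<le> m")
      case False
      then have "q * (real m - real m') = - (q * real (m' - m))" by (simp add: of_nat_diff algebra_simps)
      then show ?thesis using False by (simp add: g_def cmod_set_fourier_minus)
    qed (simp add: g_def of_nat_diff)
    finally show "(cmod (\<Sum>j\<in>R. 1 * add_char (q * (real m - real m') * real j / real G)))\<^sup>2
        = g (if m' \<le> m then m - m' else m' - m)" .
  qed
  also have "\<dots> \<le> real L * (g 0 + 2 * (\<Sum>d=1..<L. g d))"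
    by (rule sum_abs_diff_le) (simp add: g_def)
  also have "g 0 = (real (card R))\<^sup>2" by (simp add: g_def set_fourier_def)
  finally show ?thesis by (simp add: g_def)
qed

text \<open>The products \<open>q m\<close> are collected by their value \<open>n\<close>, which
  arises from at most \<open>small_divisor_count Q n\<close> pairs.\<close>

lemma sum_multiples_set_fourier:
  fixes g :: "nat \<Rightarrow> real"
  assumes "\<And>n. g n \<ge> 0" "Q * L \<le> X"
  shows "(\<Sum>q=1..Q. \<Sum>m=1..<L. g (q * m)) \<le> (\<Sum>n=1..X. real (small_divisor_count Q n) * g n)"
proof -
  have "(\<Sum>q=1..Q. \<Sum>m=1..<L. g (q * m)) = (\<Sum>p\<in>{1..Q} \<times> {1..<L}. g (fst p * snd p))"
    by (simp only: sum.cartesian_product case_prod_unfold)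
  also have "\<dots> \<le> (\<Sum>p\<in>(SIGMA n:{1..X}. {q\<in>{1..Q}. q dvd n}). g (fst p))"
  proof (rule sum_le_included[where i = "\<lambda>p. (snd p, fst p div snd p)"])
    show "\<forall>x\<in>{1..Q} \<times> {1..<L}. \<exists>y\<in>SIGMA n:{1..X}. {q\<in>{1..Q}. q dvd n}.
        (snd y, fst y div snd y) = x \<and> g (fst x * snd x) \<le> g (fst y)"
    proof
      fix x assume "x \<in> {1..Q} \<times> {1..<L}"
      then obtain q m where x: "x = (q, m)" "1 \<le> q" "q \<le> Q" "1 \<le> m" "m < L" by auto
      have "q * m \<le> Q * L" using x by (intro mult_mono) auto
      then have "q * m \<le> X" using assms(2) by linarith
      then show "\<exists>y\<in>SIGMA n:{1..X}. {q\<in>{1..Q}. q dvd n}.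
        (snd y, fst y div snd y) = x \<and> g (fst x * snd x) \<le> g (fst y)"
        using x by (intro bexI[of _ "(q * m, q)"]) auto
    qed
  qed (use assms in auto)
  also have "\<dots> = (\<Sum>n=1..X. \<Sum>q\<in>{q\<in>{1..Q}. q dvd n}. g n)"
    by (subst sum.Sigma) (auto simp: case_prod_unfold)
  also have "\<dots> = (\<Sum>n=1..X. real (small_divisor_count Q n) * g n)"
    by (simp add: small_divisor_count_def)
  finally show ?thesis .
qed

text \<open>
  The divisor function is split at the threshold \<open>r\<^bsup>1/k\<^esup>\<close>, \<open>r = card R\<close>: below it Parseval applies, above it
  the trivial bound on \<open>set_fourier\<close> and the \<open>k\<close>-th moment.
\<close>

lemma sum_small_divisor_set_fourier_le:
  assumes R: "R \<subseteq> {..<G}" "R \<noteq> {}" and Q: "Q > 0" and X: "X < G" and k: "k > 0"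
  shows "(\<Sum>n=1..X. real (small_divisor_count Q n) * (cmod (set_fourier R G (real n)))\<^sup>2)
    \<le> real G * real (card R) powr (1 + 1 / real k) * (1 + harm Q ^ (2 ^ k))"
proof -
  define r where "r = real (card R)"
  have fin: "finite R" using R finite_subset by blast
  have r: "r \<ge> 1" using R fin by (simp add: r_def Suc_le_eq card_gt_0_iff)
  define \<tau> where "\<tau> = r powr (1 / real k)"
  have \<tau>: "\<tau> > 0" "\<tau> ^ k = r" using r k by (auto simp: \<tau>_def powr_power)
  let ?D = "\<lambda>n. real (small_divisor_count Q n)"
  let ?g = "\<lambda>n. (cmod (set_fourier R G (real n)))\<^sup>2"
  \<comment> \<open>Above the threshold, \<open>D \<le> D^k / \<tau>^(k-1)\<close>, and
    \<open>\<tau>^k = r\<close> makes the denominator \<open>r / \<tau>\<close>.\<close>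
  have D: "?D n \<le> \<tau> + ?D n ^ k * (\<tau> / r)" for n
  proof (cases "?D n \<le> \<tau>")
    case True
    moreover have "0 \<le> ?D n ^ k * (\<tau> / r)" using \<tau> r by (intro mult_nonneg_nonneg divide_nonneg_nonneg) auto
    ultimately show ?thesis by linarith
  next
    case False
    obtain l where l: "k = Suc l" using k by (cases k) auto
    have "\<tau> ^ l \<le> ?D n ^ l" using \<tau> False by (intro power_mono) auto
    have "?D n * r = ?D n * \<tau> ^ l * \<tau>"
      unfolding \<tau>(2)[symmetric] l power_Suc by (simp only: mult_ac)
    also have "\<dots> \<le> ?D n * ?D n ^ l * \<tau>"
      using \<tau> \<open>\<tau> ^ l \<le> ?D n ^ l\<close> by (intro mult_right_mono mult_left_mono) auto
    also have "?D n * ?D n ^ l = ?D n ^ k" by (simp only: l power_Suc)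
    finally have "?D n \<le> ?D n ^ k * (\<tau> / r)" using r by (simp add: field_simps)
    then show ?thesis using \<tau> by linarith
  qed
  have g_le: "?g n \<le> r\<^sup>2" for n unfolding r_def by (intro power_mono cmod_set_fourier_le) auto
  have "(\<Sum>n=1..X. ?D n * ?g n) \<le> (\<Sum>n=1..X. \<tau> * ?g n + ?D n ^ k * (\<tau> * r))"
  proof (intro sum_mono)
    fix n
    have "?D n * ?g n \<le> (\<tau> + ?D n ^ k * (\<tau> / r)) * ?g n" using D by (intro mult_right_mono) auto
    also have "\<dots> = \<tau> * ?g n + ?D n ^ k * (\<tau> / r) * ?g n" by (simp add: distrib_right)
    also have "\<dots> \<le> \<tau> * ?g n + ?D n ^ k * (\<tau> / r) * r\<^sup>2"
      using g_le \<tau> r by (intro add_left_mono mult_left_mono) auto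
    finally show "?D n * ?g n \<le> \<tau> * ?g n + ?D n ^ k * (\<tau> * r)" using r by (simp add: power2_eq_square)
  qed
  also have "\<dots> = \<tau> * (\<Sum>n=1..X. ?g n) + (\<Sum>n=1..X. ?D n ^ k) * (\<tau> * r)"
    by (simp only: sum.distrib sum_distrib_left sum_distrib_right)
  also have "(\<Sum>n=1..X. ?g n) \<le> (\<Sum>n<G. ?g n)" using X by (intro sum_mono2) auto
  also have "(\<Sum>n<G. ?g n) = real G * r"
    using parseval[OF R(1), of "\<lambda>_. 1"] by (simp add: set_fourier_def r_def)
  also have "(\<Sum>n=1..X. ?D n ^ k) \<le> real X * harm Q ^ (2 ^ k)" by (rule small_divisor_moment[OF Q])
  also have "\<dots> \<le> real G * harm Q ^ (2 ^ k)" using X by (intro mult_right_mono) (auto simp: harm_nonneg)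
  finally have "(\<Sum>n=1..X. ?D n * ?g n) \<le> \<tau> * (real G * r) + real G * harm Q ^ (2 ^ k) * (\<tau> * r)"
    using \<tau> r by (simp add: mult_left_mono mult_right_mono)
  also have "\<dots> = real G * (r * \<tau>) * (1 + harm Q ^ (2 ^ k))" by (simp add: algebra_simps)
  also have "r * \<tau> = r powr (1 + 1 / real k)" using r by (simp add: \<tau>_def powr_add)
  finally show ?thesis by (simp add: r_def)
qed

text \<open>For a pair near a rational with denominator \<open>q\<close>, the \<open>L\<close> terms
  of the geometric sum in \<open>q (i - j) / G\<close> align, so its square is at least
  \<open>L^2 / 4\<close>. Summing this majorant over all pairs of \<open>R\<close> and all
  \<open>q \<le> Q\<close> produces frequencies \<open>q m\<close>, which \<open>Q L < G\<close>
  keeps in the range of Parseval.\<close>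

lemma card_pairs_near_rational_le:
  assumes R: "R \<subseteq> {..<G}" "R \<noteq> {}" and Q: "Q > 0" and L: "L > 0" and QL: "Q * L < G" and k: "k > 0"
    and P: "P \<subseteq> R \<times> R"
    and near: "\<And>i j. (i, j) \<in> P \<Longrightarrow> \<exists>q\<in>{1..Q}. \<exists>a::int. \<bar>real q * ((real i - real j) / real G) - of_int a\<bar> \<le> 1 / (16 * real L)"
  shows "real (card P) \<le> 4 / real L * (real Q * (real (card R))\<^sup>2
    + 2 * (real G * real (card R) powr (1 + 1 / real k) * (1 + harm Q ^ (2 ^ k))))"
proof -
  have fin: "finite R" using R finite_subset by blast
  let ?f = "\<lambda>q i j. (cmod (\<Sum>m<L. add_char (real m * (real q * ((real i - real j) / real G)))))\<^sup>2"
  have one: "1 \<le> (\<Sum>q=1..Q. 4 / (real L)\<^sup>2 * ?f q (fst p) (snd p))" if p: "p \<in> P" for p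
  proof -
    obtain q a where q: "q \<in> {1..Q}" "\<bar>real q * ((real (fst p) - real (snd p)) / real G) - of_int (a::int)\<bar> \<le> 1 / (16 * real L)"
      using near[of "fst p" "snd p"] p by auto
    have "(real L / 2)\<^sup>2 \<le> ?f q (fst p) (snd p)" using norm_geometric_sum_ge[OF L q(2)] by (intro power_mono) auto
    then have "1 \<le> 4 / (real L)\<^sup>2 * ?f q (fst p) (snd p)" using L by (simp add: field_simps power2_eq_square)
    also have "\<dots> \<le> (\<Sum>q=1..Q. 4 / (real L)\<^sup>2 * ?f q (fst p) (snd p))"
      using q(1) by (intro member_le_sum) auto
    finally show ?thesis .
  qed
  have "real (card P) = (\<Sum>p\<in>P. 1)" by simp
  also have "\<dots> \<le> (\<Sum>p\<in>P. \<Sum>q=1..Q. 4 / (real L)\<^sup>2 * ?f q (fst p) (snd p))" using one by (intro sum_mono)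
  also have "\<dots> \<le> (\<Sum>p\<in>R \<times> R. \<Sum>q=1..Q. 4 / (real L)\<^sup>2 * ?f q (fst p) (snd p))"
    using fin P by (intro sum_mono2 finite_cartesian_product) (auto intro!: sum_nonneg mult_nonneg_nonneg)
  also have "\<dots> = (\<Sum>q=1..Q. \<Sum>p\<in>R \<times> R. 4 / (real L)\<^sup>2 * ?f q (fst p) (snd p))" by (rule sum.swap)
  also have "\<dots> = (\<Sum>q=1..Q. 4 / (real L)\<^sup>2 * (\<Sum>i\<in>R. \<Sum>j\<in>R. ?f q i j))"
    by (simp only: sum.cartesian_product case_prod_unfold sum_distrib_left)
  also have "\<dots> \<le> (\<Sum>q=1..Q. 4 / (real L)\<^sup>2 * (real L * ((real (card R))\<^sup>2
      + 2 * (\<Sum>m=1..<L. (cmod (set_fourier R G (real q * real m)))\<^sup>2))))"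
    by (intro sum_mono mult_left_mono fejer_pair_sum) auto
  also have "\<dots> = (\<Sum>q=1..Q. 4 / real L * ((real (card R))\<^sup>2
      + 2 * (\<Sum>m=1..<L. (cmod (set_fourier R G (real q * real m)))\<^sup>2)))"
    using L by (simp add: power2_eq_square)
  also have "\<dots> = 4 / real L * (real Q * (real (card R))\<^sup>2
      + 2 * (\<Sum>q=1..Q. \<Sum>m=1..<L. (cmod (set_fourier R G (real (q * m))))\<^sup>2))"
    by (simp only: sum_distrib_left[symmetric] sum.distrib sum_constant) simp
  also have "\<dots> \<le> 4 / real L * (real Q * (real (card R))\<^sup>2
    + 2 * (real G * real (card R) powr (1 + 1 / real k) * (1 + harm Q ^ (2 ^ k))))"
  proof -
    have "(\<Sum>q=1..Q. \<Sum>m=1..<L. (cmod (set_fourier R G (real (q * m))))\<^sup>2)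
        \<le> (\<Sum>n=1..Q * L. real (small_divisor_count Q n) * (cmod (set_fourier R G (real n)))\<^sup>2)"
      by (rule sum_multiples_set_fourier) auto
    also have "\<dots> \<le> real G * real (card R) powr (1 + 1 / real k) * (1 + harm Q ^ (2 ^ k))"
      by (rule sum_small_divisor_set_fourier_le[OF R Q QL k])
    finally show ?thesis by (intro mult_left_mono add_left_mono) auto
  qed
  finally show ?thesis .
qed

text \<open>Each \<open>a\<close> is charged to the first level \<open>i\<close> that it reaches,
  where \<open>v a \<le> 2 / 2^i\<close>; for \<open>i = 0\<close> this comes from
  \<open>v a \<le> 1\<close>.\<close>

lemma dyadic_sum_le:
  fixes v :: "'a \<Rightarrow> real"
  assumes A: "finite A" and v: "\<And>a. a \<in> A \<Longrightarrow> 0 \<le> v a" "\<And>a. a \<in> A \<Longrightarrow> v a \<le> 1"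
  shows "(\<Sum>a\<in>{a\<in>A. 1 / 2 ^ n \<le> v a}. v a ^ p) \<le> (\<Sum>i\<le>n. (2 / 2 ^ i) ^ p * real (card {a\<in>A. 1 / 2 ^ i \<le> v a}))"
proof -
  have pt: "v a ^ p \<le> (\<Sum>i\<le>n. if 1 / 2 ^ i \<le> v a then (2 / 2 ^ i) ^ p else 0)"
    if a: "a \<in> A" "1 / 2 ^ n \<le> v a" for a
  proof -
    define i where "i = (LEAST i. 1 / 2 ^ i \<le> v a)"
    have i: "1 / 2 ^ i \<le> v a" unfolding i_def using a(2) by (rule LeastI)
    have "i \<le> n" unfolding i_def using a(2) by (rule Least_le)
    have "v a \<le> 2 / 2 ^ i"
    proof (cases i)
      case 0
      then show ?thesis using v(2)[OF a(1)] by simp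
    next
      case (Suc k)
      then have "\<not> 1 / 2 ^ k \<le> v a" using not_less_Least[of k "\<lambda>i. 1 / 2 ^ i \<le> v a"] by (simp add: i_def)
      then show ?thesis using Suc by simp
    qed
    then have "v a ^ p \<le> (2 / 2 ^ i) ^ p" using v(1)[OF a(1)] by (intro power_mono) auto
    also have "\<dots> = (if 1 / 2 ^ i \<le> v a then (2 / 2 ^ i) ^ p else 0)" using i by simp
    also have "\<dots> \<le> (\<Sum>i\<le>n. if 1 / 2 ^ i \<le> v a then (2 / 2 ^ i) ^ p else 0)"
      using \<open>i \<le> n\<close> by (intro member_le_sum) auto
    finally show ?thesis .
  qed
  have "(\<Sum>a\<in>{a\<in>A. 1 / 2 ^ n \<le> v a}. v a ^ p)
      \<le> (\<Sum>a\<in>{a\<in>A. 1 / 2 ^ n \<le> v a}. \<Sum>i\<le>n. if 1 / 2 ^ i \<le> v a then (2 / 2 ^ i) ^ p else 0)"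
    using pt by (intro sum_mono) auto
  also have "\<dots> \<le> (\<Sum>a\<in>A. \<Sum>i\<le>n. if 1 / 2 ^ i \<le> v a then (2 / 2 ^ i) ^ p else 0)"
    using A by (intro sum_mono2) (auto intro!: sum_nonneg)
  also have "\<dots> = (\<Sum>i\<le>n. \<Sum>a\<in>A. if 1 / 2 ^ i \<le> v a then (2 / 2 ^ i) ^ p else 0)" by (rule sum.swap)
  also have "\<dots> = (\<Sum>i\<le>n. (2 / 2 ^ i) ^ p * real (card {a\<in>A. 1 / 2 ^ i \<le> v a}))"
    using A by (intro sum.cong refl) (simp add: sum.inter_filter[symmetric] mult.commute)
  finally show ?thesis .
qed

section \<open>Restriction for squares\<close>

text \<open>The inverse theorem supplies \<open>Q\<close> of order \<open>\<xi> powr -2\<close> and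
  \<open>L\<close> of order \<open>\<xi> powr (20/9) Y^2\<close>. With the sixteenth divisor moment
  the exponents \<open>2 + 20/9\<close> and \<open>20/9 + 1/25\<close> arise, rounded up to 5 and
  2.27; the \<open>1/25\<close> pays for the powers of \<open>log Q\<close>.\<close>

lemma weyl_sum_pair_count:
  "\<exists>A>0. \<forall>Y G R \<xi>. Y > 0 \<longrightarrow> Y\<^sup>2 < G \<longrightarrow> G \<le> 65 * Y\<^sup>2 \<longrightarrow> R \<subseteq> {..<G} \<longrightarrow> R \<noteq> {} \<longrightarrow>
    0 < \<xi> \<longrightarrow> \<xi> \<le> 1 \<longrightarrow> 10 ^ 12 \<le> \<xi> ^ 6 * real Y \<longrightarrow>
    real (card {p\<in>R \<times> R. \<xi> * real Y \<le> cmod (weyl_sum Y ((real (fst p) - real (snd p)) / real G))})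
      \<le> A * (\<xi> powr (-5) * (real (card R))\<^sup>2 / (real Y)\<^sup>2 + \<xi> powr (-227/100) * real (card R) powr (17/16))"
proof -
  obtain C where C: "C > 0" "\<And>Q. Q > 0 \<Longrightarrow> (harm Q :: real) ^ (2 ^ 16) \<le> C * real Q powr (1/50)"
    using harm_power_le_powr[of "1/50" "2 ^ 16"] by auto
  define A where "A = 1280000000000 * (16 + 130 * (1 + 16 * C))"
  have A: "A > 0" using C by (simp add: A_def)
  show ?thesis
  proof (intro exI[of _ A] conjI A allI impI)
    fix Y G R and \<xi> :: real
    assume Y: "Y > 0" and G: "Y\<^sup>2 < G" "G \<le> 65 * Y\<^sup>2" and R: "R \<subseteq> {..<G}" "R \<noteq> {}"
      and \<xi>: "0 < \<xi>" "\<xi> \<le> 1" and large: "10 ^ 12 \<le> \<xi> ^ 6 * real Y"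
    define r where "r = real (card R)"
    define Q where "Q = nat \<lfloor>16 / \<xi>\<^sup>2\<rfloor>"
    \<comment> \<open>\<open>1 / (16 X)\<close> is exactly the error granted by
      \<open>weyl_inverse\<close>, so every \<open>L \<le> X\<close> is admissible in the pair
      count.\<close>
    define X where "X = (real Y)\<^sup>2 * \<xi> powr (20/9) / 160000000000"
    define L where "L = nat \<lfloor>X\<rfloor>"
    have xi2: "\<xi>\<^sup>2 \<le> 1" "\<xi>\<^sup>2 > 0" using \<xi> by (auto intro: power_le_one)
    have "16 \<le> 16 / \<xi>\<^sup>2" using xi2 by (simp add: pos_le_divide_eq)
    then have Q_le: "real Q \<le> 16 / \<xi>\<^sup>2" and Q0: "Q > 0" unfolding Q_def by linarith+
    have xi6: "\<xi> ^ 6 \<le> 1" using \<xi> by (intro power_le_one) auto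
    have X1: "2 \<le> X"
    proof -
      have "\<xi> ^ 6 * real Y \<le> 1 * real Y" using xi6 by (intro mult_right_mono) auto
      then have y12: "10 ^ 12 \<le> real Y" using large by linarith
      have "\<xi> ^ 6 = \<xi> powr 6" using \<xi> by (simp add: powr_numeral)
      also have "\<dots> \<le> \<xi> powr (20/9)" using \<xi> by (intro powr_mono') auto
      finally have "(10 ^ 12) * (10 ^ 12) \<le> real Y * (real Y * \<xi> powr (20/9))"
        using large y12 by (intro mult_mono) (auto simp: mult.commute intro: order_trans mult_left_mono)
      then show ?thesis by (simp add: X_def power2_eq_square)
    qed
    have L: "real L \<le> X" "X / 2 \<le> real L" "L > 0" unfolding L_def using X1 by linarith+
    have Xpos: "X > 0" using X1 by linarith
    have QL: "Q * L < G"
    proof -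
      have "real Q * real L \<le> 16 / \<xi>\<^sup>2 * X" using Q_le L(1) by (intro mult_mono) auto
      also have "\<dots> = (real Y)\<^sup>2 * (\<xi> powr (20/9) / \<xi>\<^sup>2) / 10000000000" by (simp add: X_def)
      also have "\<xi> powr (20/9) / \<xi>\<^sup>2 = \<xi> powr (2/9)"
        using \<xi> powr_diff[of \<xi> "20/9" 2] by (simp add: powr_numeral)
      also have "(real Y)\<^sup>2 * \<xi> powr (2/9) / 10000000000 \<le> (real Y)\<^sup>2 * 1 / 1"
        using \<xi> by (intro frac_le mult_left_mono) (auto simp: powr_le1)
      finally have "real (Q * L) \<le> real (Y\<^sup>2)" by simp
      then have "Q * L \<le> Y\<^sup>2" by (simp only: of_nat_le_iff)
      then show ?thesis using G by linarith
    qed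
    let ?P = "{p\<in>R \<times> R. \<xi> * real Y \<le> cmod (weyl_sum Y ((real (fst p) - real (snd p)) / real G))}"
    have "real (card ?P) \<le> 4 / real L * (real Q * r\<^sup>2
        + 2 * (real G * r powr (1 + 1 / real 16) * (1 + harm Q ^ (2 ^ 16))))"
      unfolding r_def
    proof (rule card_pairs_near_rational_le[OF R Q0 L(3) QL])
      fix i j assume ij: "(i, j) \<in> ?P"
      have "10 ^ 10 \<le> \<xi> ^ 6 * real Y" using large by simp
      then obtain q a where q: "q > (0::nat)" "real q \<le> 16 / \<xi>\<^sup>2"
        "\<bar>real q * ((real i - real j) / real G) - of_int (a::int)\<bar> \<le> 10 ^ 10 * \<xi> powr (-20/9) / (real Y)\<^sup>2"
        using weyl_inverse[OF Y \<xi>, of "(real i - real j) / real G"] ij by auto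
      have "q \<in> {1..Q}" using q(1,2) by (simp add: Q_def le_nat_floor Suc_le_eq)
      moreover have "10 ^ 10 * \<xi> powr (-20/9) / (real Y)\<^sup>2 = 1 / (16 * X)"
        using \<xi> Y by (simp add: X_def powr_minus_divide)
      moreover have "1 / (16 * X) \<le> 1 / (16 * real L)" using L by (intro divide_left_mono) auto
      ultimately show "\<exists>q\<in>{1..Q}. \<exists>a::int. \<bar>real q * ((real i - real j) / real G) - of_int a\<bar> \<le> 1 / (16 * real L)"
        using q(3) by (intro bexI[of _ q] exI[of _ a]) linarith+
    qed auto
    also have "1 + 1 / real 16 = (17/16 :: real)" by simp
    also have "4 / real L * (real Q * r\<^sup>2 + 2 * (real G * r powr (17/16) * (1 + harm Q ^ (2 ^ 16))))
      \<le> 8 / X * (16 / \<xi>\<^sup>2 * r\<^sup>2 + 2 * (65 * (real Y)\<^sup>2 * r powr (17/16) * ((1 + 16 * C) * \<xi> powr (-1/25))))"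
    proof (intro mult_mono add_mono mult_left_mono)
      have "4 / real L \<le> 4 / (X / 2)" using L Xpos by (intro divide_left_mono) auto
      then show "4 / real L \<le> 8 / X" by simp
      show "real Q \<le> 16 / \<xi>\<^sup>2" by (rule Q_le)
      have "real G \<le> real (65 * Y\<^sup>2)" using G(2) by (simp only: of_nat_le_iff)
      then show "real G \<le> 65 * (real Y)\<^sup>2" by simp
      have "(harm Q :: real) ^ (2 ^ 16) \<le> C * real Q powr (1/50)" by (rule C(2)[OF Q0])
      also have "\<dots> \<le> C * (16 / \<xi>\<^sup>2) powr (1/50)" using C Q_le by (intro mult_left_mono powr_mono2) auto
      also have "(16 / \<xi>\<^sup>2) powr (1/50) = 16 powr (1/50) * \<xi> powr (-1/25)"
      proof -
        have "\<xi>\<^sup>2 = \<xi> powr 2" using \<xi> by (simp add: powr_numeral)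
        then have "(\<xi>\<^sup>2) powr (1/50) = \<xi> powr (1/25)" by (simp only: powr_powr) simp
        then show ?thesis using \<xi> by (simp add: powr_divide powr_minus_divide)
      qed
      also have "C * (16 powr (1/50) * \<xi> powr (-1/25)) \<le> C * (16 * \<xi> powr (-1/25))"
      proof -
        have "(16::real) powr (1/50) \<le> 16 powr 1" by (intro powr_mono) auto
        then show ?thesis using C by (intro mult_left_mono mult_right_mono) auto
      qed
      finally have "harm Q ^ (2 ^ 16) \<le> 16 * C * \<xi> powr (-1/25)" by simp
      moreover have "1 \<le> \<xi> powr (-1/25)"
        using \<xi> powr_mono'[of "-1/25" 0 \<xi>] by simp
      ultimately show "1 + harm Q ^ (2 ^ 16) \<le> (1 + 16 * C) * \<xi> powr (-1/25)"
        by (simp only: distrib_right)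
    qed (use Xpos C in \<open>auto intro!: add_nonneg_nonneg mult_nonneg_nonneg simp: harm_nonneg\<close>)
    also have "\<dots> = 1280000000000 * (16 * (\<xi> powr (-20/9) * \<xi> powr (-2)) * r\<^sup>2 / (real Y)\<^sup>2
        + 130 * (1 + 16 * C) * ((\<xi> powr (-20/9) * \<xi> powr (-1/25)) * r powr (17/16)))"
    proof -
      have X8: "8 / X = 1280000000000 * \<xi> powr (-20/9) / (real Y)\<^sup>2"
        using \<xi> by (simp add: X_def powr_minus_divide)
      have xi16: "16 / \<xi>\<^sup>2 = 16 * \<xi> powr (-2)"
        using \<xi> by (simp add: powr_minus_divide powr_numeral)
      show ?thesis unfolding X8 xi16 using Y by (simp add: field_simps)
    qed
    also have "\<dots> \<le> 1280000000000 * (16 * \<xi> powr (-5) * r\<^sup>2 / (real Y)\<^sup>2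
        + 130 * (1 + 16 * C) * (\<xi> powr (-227/100) * r powr (17/16)))"
      using C \<xi> unfolding powr_add[symmetric]
      by (intro mult_left_mono mult_right_mono add_mono divide_right_mono powr_mono') auto
    also have "\<dots> \<le> A * (\<xi> powr (-5) * r\<^sup>2 / (real Y)\<^sup>2 + \<xi> powr (-227/100) * r powr (17/16))"
    proof -
      define s where "s = \<xi> powr (-5) * r\<^sup>2 / (real Y)\<^sup>2"
      define t where "t = \<xi> powr (-227/100) * r powr (17/16)"
      have st: "s \<ge> 0" "t \<ge> 0" by (auto simp: s_def t_def)
      have "16 * s + 130 * (1 + 16 * C) * t \<le> (16 + 130 * (1 + 16 * C)) * (s + t)"
        using C st by (simp add: algebra_simps)
      then have "1280000000000 * (16 * s + 130 * (1 + 16 * C) * t)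
          \<le> 1280000000000 * ((16 + 130 * (1 + 16 * C)) * (s + t))" by (intro mult_left_mono) auto
      then have "1280000000000 * (16 * s + 130 * (1 + 16 * C) * t) \<le> A * (s + t)"
        unfolding A_def by (simp only: mult.assoc)
      then show ?thesis by (simp add: s_def t_def mult.assoc)
    qed
    finally show "real (card ?P) \<le> A * (\<xi> powr (-5) * (real (card R))\<^sup>2 / (real Y)\<^sup>2 + \<xi> powr (-227/100) * real (card R) powr (17/16))"
      by (simp add: r_def)
  qed
qed

text \<open>The weights \<open>a\<close> carry both the restriction to a subset of
  \<open>[1, Y]\<close> and the phases coming from the shift of the grid.\<close>

definition square_sum :: "(nat \<Rightarrow> complex) \<Rightarrow> nat \<Rightarrow> nat \<Rightarrow> nat \<Rightarrow> complex" where
  "square_sum a Y G j = (\<Sum>y=1..Y. a y * add_char (real y ^ 2 * real j / real G))"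

lemma cmod_square_sum_le:
  assumes "\<And>y. cmod (a y) \<le> 1"
  shows "cmod (square_sum a Y G j) \<le> real Y"
proof -
  have "cmod (square_sum a Y G j) \<le> (\<Sum>y=1..Y. 1)"
    unfolding square_sum_def using assms by (intro sum_norm_le) (simp add: norm_mult)
  then show ?thesis by simp
qed

lemma cmod_weyl_sum_le: "cmod (weyl_sum Y \<beta>) \<le> real Y"
proof -
  have "cmod (weyl_sum Y \<beta>) \<le> (\<Sum>y=1..Y. 1)"
    unfolding weyl_sum_def by (intro sum_norm_le) simp
  then show ?thesis by simp
qed

text \<open>The moduli are linearised by phases \<open>u\<close>, and Cauchy-Schwarz in
  \<open>y\<close> removes the arbitrary weights \<open>a\<close>, so that only the complete Weyl
  sum at differences of points of \<open>R\<close> remains.\<close>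

lemma level_set_duality:
  assumes a: "\<And>y. cmod (a y) \<le> 1" and fin: "finite R" and lam: "\<eta> \<ge> 0"
    and level: "\<And>j. j \<in> R \<Longrightarrow> \<eta> * real Y \<le> cmod (square_sum a Y G j)"
  shows "\<eta>\<^sup>2 * real Y * (real (card R))\<^sup>2
    \<le> (\<Sum>i\<in>R. \<Sum>j\<in>R. cmod (weyl_sum Y ((real i - real j) / real G)))"
proof (cases "Y = 0")
  case True
  then show ?thesis by (simp add: sum_nonneg)
next
  case False
  define u where "u j = cnj (sgn (square_sum a Y G j))" for j
  have u: "cmod (u j) \<le> 1" for j by (simp add: u_def norm_sgn)
  have usum: "u j * square_sum a Y G j = of_real (cmod (square_sum a Y G j))" for j
  proof (cases "square_sum a Y G j = 0")
    case False
    have "cnj (square_sum a Y G j) * square_sum a Y G j = of_real ((cmod (square_sum a Y G j))\<^sup>2)"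
      by (simp only: complex_norm_square mult.commute)
    then show ?thesis using False by (simp add: u_def sgn_eq power2_eq_square)
  qed simp
  define \<Phi> where "\<Phi> y = (\<Sum>j\<in>R. u j * add_char (real y ^ 2 * real j / real G))" for y :: nat
  have "real (card R) * (\<eta> * real Y) \<le> (\<Sum>j\<in>R. cmod (square_sum a Y G j))"
    using sum_mono[of R "\<lambda>_. \<eta> * real Y"] level by fastforce
  also have "(\<Sum>j\<in>R. cmod (square_sum a Y G j)) \<le> cmod (\<Sum>j\<in>R. u j * square_sum a Y G j)"
    by (rule of_real_eq_imp_le_norm) (simp add: usum)
  also have "(\<Sum>j\<in>R. u j * square_sum a Y G j) = (\<Sum>y=1..Y. a y * \<Phi> y)"
    unfolding square_sum_def \<Phi>_def sum_distrib_left by (subst sum.swap) (simp add: mult_ac)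
  also have "cmod \<dots> \<le> (\<Sum>y=1..Y. 1 * cmod (\<Phi> y))"
    by (intro sum_norm_le) (simp add: norm_mult mult_left_le_one_le a)
  finally have "(real (card R) * (\<eta> * real Y))\<^sup>2 \<le> (\<Sum>y=1..Y. 1 * cmod (\<Phi> y))\<^sup>2"
    using lam by (intro power_mono) auto
  also have "\<dots> \<le> (\<Sum>y=1..Y. 1\<^sup>2) * (\<Sum>y=1..Y. (cmod (\<Phi> y))\<^sup>2)" by (rule Cauchy_Schwarz_ineq_sum)
  also have "(\<Sum>y=1..Y. 1\<^sup>2) = real Y" by simp
  finally have "real Y * (\<eta>\<^sup>2 * real Y * (real (card R))\<^sup>2) \<le> real Y * (\<Sum>y=1..Y. (cmod (\<Phi> y))\<^sup>2)"
    by (simp add: power_mult_distrib power2_eq_square mult_ac)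
  then have bound: "\<eta>\<^sup>2 * real Y * (real (card R))\<^sup>2 \<le> (\<Sum>y=1..Y. (cmod (\<Phi> y))\<^sup>2)"
    using False by (subst (asm) mult_le_cancel_left_pos) auto
  have "complex_of_real (\<Sum>y=1..Y. (cmod (\<Phi> y))\<^sup>2) = (\<Sum>y=1..Y. \<Sum>i\<in>R. \<Sum>j\<in>R. u i * cnj (u j) *
      add_char (real y ^ 2 * real i / real G - real y ^ 2 * real j / real G))"
    by (simp only: of_real_sum \<Phi>_def norm_sum_add_char_squared)
  also have "\<dots> = (\<Sum>i\<in>R. \<Sum>j\<in>R. \<Sum>y=1..Y. u i * cnj (u j) *
      add_char (real y ^ 2 * real i / real G - real y ^ 2 * real j / real G))"
    by (subst sum.swap, rule sum.cong[OF refl], rule sum.swap)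
  also have "\<dots> = (\<Sum>i\<in>R. \<Sum>j\<in>R. u i * cnj (u j) * weyl_sum Y ((real i - real j) / real G))"
    by (simp add: weyl_sum_def sum_distrib_left diff_divide_distrib right_diff_distrib)
  finally have "(\<Sum>y=1..Y. (cmod (\<Phi> y))\<^sup>2)
      \<le> cmod (\<Sum>i\<in>R. \<Sum>j\<in>R. u i * cnj (u j) * weyl_sum Y ((real i - real j) / real G))"
    by (rule of_real_eq_imp_le_norm)
  also have "\<dots> \<le> (\<Sum>i\<in>R. \<Sum>j\<in>R. cmod (weyl_sum Y ((real i - real j) / real G)))"
  proof (intro sum_norm_le)
    fix i j
    have "cmod (u i) * cmod (u j) \<le> 1 * 1" using u by (intro mult_mono) auto
    then have "cmod (u i) * cmod (u j) * cmod (weyl_sum Y ((real i - real j) / real G))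
        \<le> 1 * cmod (weyl_sum Y ((real i - real j) / real G))" by (intro mult_right_mono) auto
    then show "cmod (u i * cnj (u j) * weyl_sum Y ((real i - real j) / real G))
        \<le> cmod (weyl_sum Y ((real i - real j) / real G))" by (simp add: norm_mult)
  qed
  finally show ?thesis using bound by linarith
qed

lemma geometric_sum_le_twice_last:
  fixes x :: real
  assumes "x \<ge> 2"
  shows "(\<Sum>i\<le>n. x ^ i) \<le> 2 * x ^ n"
proof (induction n)
  case (Suc n)
  have "2 * x ^ n \<le> x * x ^ n" using assms by (intro mult_right_mono) auto
  then show ?case using Suc by simp
qed simp

text \<open>Pairs whose relative Weyl sum is below \<open>\<eta>^2 / 2\<close> account for at most
  half of the lower bound from duality, so only heights \<xi> down to \<open>\<eta>^2 / 4\<close>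
  matter. Hence \<open>\<eta>^12 Y\<close> must be large, as the pair count asks this of
  \<open>\<xi>^6 Y\<close>. The second term of the pair count yields
  \<open>r powr (15/16) = O(\<eta> powr -4.54)\<close>, and 4.54 times 16/15 is below 4.85.\<close>

lemma level_set_bound:
  "\<exists>C>0. \<forall>Y G a R \<eta>. Y > 0 \<longrightarrow> Y\<^sup>2 < G \<longrightarrow> G \<le> 65 * Y\<^sup>2 \<longrightarrow> (\<forall>y. cmod (a y) \<le> 1) \<longrightarrow> R \<subseteq> {..<G} \<longrightarrow>
    0 < \<eta> \<longrightarrow> \<eta> \<le> 1 \<longrightarrow> C \<le> \<eta> ^ 12 * real Y \<longrightarrow> (\<forall>j\<in>R. \<eta> * real Y \<le> cmod (square_sum a Y G j)) \<longrightarrow>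
    real (card R) \<le> C * \<eta> powr (-97/20)"
proof -
  obtain A where A: "A > 0" and pairs: "\<And>Y G R \<xi>. Y > 0 \<Longrightarrow> Y\<^sup>2 < G \<Longrightarrow> G \<le> 65 * Y\<^sup>2 \<Longrightarrow> R \<subseteq> {..<G} \<Longrightarrow> R \<noteq> {} \<Longrightarrow>
    0 < \<xi> \<Longrightarrow> \<xi> \<le> 1 \<Longrightarrow> 10 ^ 12 \<le> \<xi> ^ 6 * real Y \<Longrightarrow>
    real (card {p\<in>R \<times> R. \<xi> * real Y \<le> cmod (weyl_sum Y ((real (fst p) - real (snd p)) / real G))})
      \<le> A * (\<xi> powr (-5) * (real (card R))\<^sup>2 / (real Y)\<^sup>2 + \<xi> powr (-227/100) * real (card R) powr (17/16))"
    using weyl_sum_pair_count by blast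
  \<comment> \<open>\<open>4096 = 4^6\<close> converts \<open>\<xi> \<ge> \<eta>^2 / 4\<close> into
    the condition \<open>10^12 \<le> \<xi>^6 Y\<close>. The second summand serves to absorb the
    first term of the pair count, the third is the constant of the final bound.\<close>
  define C where "C = 4096000000000000 + 4096 * A + (256 * A) powr (16/15)"
  have C: "C > 0" "4096000000000000 \<le> C" "4096 * A \<le> C" "(256 * A) powr (16/15) \<le> C"
    using A by (auto simp: C_def add_nonneg_nonneg intro!: add_pos_nonneg)
  have main: "real (card R) \<le> C * \<eta> powr (-97/20)"
    if Y: "Y > 0" and G: "Y\<^sup>2 < G" "G \<le> 65 * Y\<^sup>2" and a: "\<And>y. cmod (a y) \<le> 1" and R: "R \<subseteq> {..<G}"
      and lam: "0 < \<eta>" "\<eta> \<le> 1" and large: "C \<le> \<eta> ^ 12 * real Y"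
      and level: "\<And>j. j \<in> R \<Longrightarrow> \<eta> * real Y \<le> cmod (square_sum a Y G j)"
    for Y G a R and \<eta> :: real
  proof (cases "R = {}")
    case True
    then show ?thesis using C by simp
  next
    case ne: False
    have fin: "finite R" using R finite_subset by blast
    define r where "r = real (card R)"
    have r: "r \<ge> 1" using ne fin by (simp add: r_def Suc_le_eq card_gt_0_iff)
    have y: "real Y \<ge> 1" using Y by simp
    define v where "v p = cmod (weyl_sum Y ((real (fst p) - real (snd p)) / real G)) / real Y" for p
    have v: "0 \<le> v p" "v p \<le> 1" for p
      using cmod_weyl_sum_le[of Y "(real (fst p) - real (snd p)) / real G"] Y by (auto simp: v_def)
    have "\<exists>n. 1 / 2 ^ n \<le> \<eta>\<^sup>2 / 2"
      using real_arch_pow_inv[of "\<eta>\<^sup>2 / 2" "1/2"] lam by (auto simp: power_one_over intro: less_imp_le)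
    then obtain n where n: "1 / 2 ^ n \<le> \<eta>\<^sup>2 / 2" "\<And>m. m < n \<Longrightarrow> \<not> 1 / 2 ^ m \<le> \<eta>\<^sup>2 / 2"
      using exists_least_iff[of "\<lambda>n. 1 / 2 ^ n \<le> \<eta>\<^sup>2 / 2"] by blast
    have lam2: "\<eta>\<^sup>2 \<le> 1" "\<eta>\<^sup>2 > 0" using lam by (auto intro: power_le_one)
    have n_ge: "\<eta>\<^sup>2 / 4 \<le> 1 / 2 ^ n"
    proof (cases n)
      case 0
      then show ?thesis using lam2 by simp
    next
      case (Suc m)
      then have "\<not> 1 / 2 ^ m \<le> \<eta>\<^sup>2 / 2" using n(2) by simp
      then show ?thesis using Suc by simp
    qed
    then have pow_n: "2 ^ n \<le> 4 / \<eta>\<^sup>2" using lam2 by (simp add: field_simps)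
    have "\<eta>\<^sup>2 * real Y * r\<^sup>2 \<le> (\<Sum>i\<in>R. \<Sum>j\<in>R. cmod (weyl_sum Y ((real i - real j) / real G)))"
      unfolding r_def using level_set_duality[OF a fin _ level] lam by simp
    also have "\<dots> = real Y * (\<Sum>p\<in>R \<times> R. v p)"
      using Y by (simp add: sum.cartesian_product case_prod_unfold v_def sum_divide_distrib[symmetric])
    finally have "real Y * (\<eta>\<^sup>2 * r\<^sup>2) \<le> real Y * (\<Sum>p\<in>R \<times> R. v p)" by (simp add: mult_ac)
    then have "\<eta>\<^sup>2 * r\<^sup>2 \<le> (\<Sum>p\<in>R \<times> R. v p)" using Y by simp
    also have "\<dots> = (\<Sum>p\<in>R \<times> R - {p\<in>R \<times> R. 1 / 2 ^ n \<le> v p}. v p) + (\<Sum>p\<in>{p\<in>R \<times> R. 1 / 2 ^ n \<le> v p}. v p)"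
      using fin by (intro sum.subset_diff) auto
    also have "(\<Sum>p\<in>R \<times> R - {p\<in>R \<times> R. 1 / 2 ^ n \<le> v p}. v p) \<le> (\<Sum>p\<in>R \<times> R - {p\<in>R \<times> R. 1 / 2 ^ n \<le> v p}. \<eta>\<^sup>2 / 2)"
      using n(1) by (intro sum_mono) auto
    also have "\<dots> \<le> (\<Sum>p\<in>R \<times> R. \<eta>\<^sup>2 / 2)" using fin by (intro sum_mono2) auto
    also have "\<dots> = \<eta>\<^sup>2 / 2 * r\<^sup>2" by (simp add: r_def card_cartesian_product power2_eq_square)
    finally have "\<eta>\<^sup>2 / 2 * r\<^sup>2 \<le> (\<Sum>p\<in>{p\<in>R \<times> R. 1 / 2 ^ n \<le> v p}. v p ^ 1)" by simp
    also have "\<dots> \<le> (\<Sum>i\<le>n. (2 / 2 ^ i) ^ 1 * real (card {p\<in>R \<times> R. 1 / 2 ^ i \<le> v p}))"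
      using fin v by (intro dyadic_sum_le) auto
    also have "\<dots> \<le> (\<Sum>i\<le>n. 2 * A * (r\<^sup>2 / (real Y)\<^sup>2) * 16 ^ i + 2 * A * r powr (17/16) * (2 powr (127/100)) ^ i)"
    proof (intro sum_mono)
      fix i assume i: "i \<in> {..n}"
      have "(1::real) / 2 ^ n \<le> 1 / 2 ^ i" using i by (intro divide_left_mono power_increasing) auto
      then have "\<eta>\<^sup>2 / 4 \<le> 1 / 2 ^ i" using n_ge by linarith
      then have "(\<eta>\<^sup>2 / 4) ^ 6 \<le> (1 / 2 ^ i) ^ 6" using lam2 by (intro power_mono) auto
      then have "(\<eta>\<^sup>2 / 4) ^ 6 * real Y \<le> (1 / 2 ^ i) ^ 6 * real Y" by (intro mult_right_mono) auto
      moreover have "(\<eta>\<^sup>2 / 4) ^ 6 * real Y = \<eta> ^ 12 * real Y / 4096" by (simp add: power_divide power_mult[symmetric])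
      ultimately have big: "10 ^ 12 \<le> (1 / 2 ^ i) ^ 6 * real Y" using large C(2) by simp
      have "{p\<in>R \<times> R. 1 / 2 ^ i \<le> v p}
          = {p\<in>R \<times> R. 1 / 2 ^ i * real Y \<le> cmod (weyl_sum Y ((real (fst p) - real (snd p)) / real G))}"
        using Y by (auto simp: v_def field_simps)
      then have "real (card {p\<in>R \<times> R. 1 / 2 ^ i \<le> v p})
          \<le> A * ((1 / 2 ^ i) powr (-5) * r\<^sup>2 / (real Y)\<^sup>2 + (1 / 2 ^ i) powr (-227/100) * r powr (17/16))"
        using pairs[OF Y G R ne _ _ big] by (simp add: r_def)
      moreover have "(1 / 2 ^ i) powr (-5) = (32 ^ i :: real)"
      proof -
        have "((2::real) ^ i) ^ 5 = (2 ^ 5) ^ i" by (simp only: power_mult[symmetric] mult.commute)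
        then show ?thesis by (simp add: powr_divide powr_minus_divide)
      qed
      moreover have "(1 / 2 ^ i :: real) powr (-227/100) = (2 * 2 powr (127/100)) ^ i"
      proof -
        have "(1 / 2 ^ i) powr (-227/100) = ((2::real) powr real i) powr (227/100)"
          by (simp add: powr_divide powr_minus_divide powr_realpow)
        also have "\<dots> = (2 powr (1 + 127/100)) powr real i" by (simp add: powr_powr mult.commute)
        also have "\<dots> = (2 powr (1 + 127/100)) ^ i" by (simp add: powr_realpow)
        finally show ?thesis by (simp only: powr_add powr_one)
      qed
      ultimately have "real (card {p\<in>R \<times> R. 1 / 2 ^ i \<le> v p})
          \<le> A * (32 ^ i * r\<^sup>2 / (real Y)\<^sup>2 + (2 * 2 powr (127/100)) ^ i * r powr (17/16))" by simp
      then have "2 / 2 ^ i * real (card {p\<in>R \<times> R. 1 / 2 ^ i \<le> v p})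
          \<le> 2 / 2 ^ i * (A * (32 ^ i * r\<^sup>2 / (real Y)\<^sup>2 + (2 * 2 powr (127/100)) ^ i * r powr (17/16)))"
        by (intro mult_left_mono) auto
      also have "\<dots> = 2 * A * (r\<^sup>2 / (real Y)\<^sup>2) * (32 ^ i / 2 ^ i)
          + 2 * A * r powr (17/16) * ((2 * 2 powr (127/100)) ^ i / 2 ^ i)" by (simp add: algebra_simps)
      also have "(32 ^ i / 2 ^ i :: real) = 16 ^ i" by (simp add: power_divide[symmetric])
      also have "(2 * 2 powr (127/100)) ^ i / 2 ^ i = (2 powr (127/100) :: real) ^ i" by (simp add: power_mult_distrib)
      finally show "(2 / 2 ^ i) ^ 1 * real (card {p\<in>R \<times> R. 1 / 2 ^ i \<le> v p})
          \<le> 2 * A * (r\<^sup>2 / (real Y)\<^sup>2) * 16 ^ i + 2 * A * r powr (17/16) * (2 powr (127/100)) ^ i" by simp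
    qed
    also have "\<dots> = 2 * A * (r\<^sup>2 / (real Y)\<^sup>2) * (\<Sum>i\<le>n. 16 ^ i) + 2 * A * r powr (17/16) * (\<Sum>i\<le>n. (2 powr (127/100)) ^ i)"
      by (simp only: sum.distrib sum_distrib_left)
    also have "\<dots> \<le> 2 * A * (r\<^sup>2 / (real Y)\<^sup>2) * (512 / \<eta> ^ 8) + 2 * A * r powr (17/16) * (32 * \<eta> powr (-127/50))"
    proof (intro add_mono mult_left_mono)
      have "(\<Sum>i\<le>n. 16 ^ i) \<le> 2 * (16::real) ^ n" by (rule geometric_sum_le_twice_last) simp
      also have "(16::real) ^ n = (2 ^ n) ^ 4"
      proof -
        have "((2::real) ^ n) ^ 4 = (2 ^ 4) ^ n" by (simp only: power_mult[symmetric] mult.commute)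
        then show ?thesis by simp
      qed
      also have "((2::real) ^ n) ^ 4 \<le> (4 / \<eta>\<^sup>2) ^ 4" using pow_n by (intro power_mono) auto
      finally show "(\<Sum>i\<le>n. 16 ^ i) \<le> 512 / \<eta> ^ 8" by (simp add: power_divide power_mult[symmetric])
      have "(2::real) powr 1 \<le> 2 powr (127/100)" by (intro powr_mono) auto
      then have "(\<Sum>i\<le>n. (2 powr (127/100)) ^ i) \<le> 2 * ((2::real) powr (127/100)) ^ n"
        by (intro geometric_sum_le_twice_last) simp
      also have "((2::real) powr (127/100)) ^ n = (2 ^ n) powr (127/100)"
        by (simp add: powr_realpow[symmetric] powr_powr mult.commute)
      also have "((2::real) ^ n) powr (127/100) \<le> (4 / \<eta>\<^sup>2) powr (127/100)" using pow_n by (intro powr_mono2) auto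
      also have "(4 / \<eta>\<^sup>2) powr (127/100) = 4 powr (127/100) * \<eta> powr (-127/50)"
      proof -
        have "\<eta>\<^sup>2 = \<eta> powr 2" using lam by (simp add: powr_numeral)
        then have "(\<eta>\<^sup>2) powr (127/100) = \<eta> powr (127/50)" by (simp only: powr_powr) simp
        then show ?thesis using lam by (simp add: powr_divide powr_minus_divide)
      qed
      also have "(4::real) powr (127/100) \<le> 4 powr 2" by (intro powr_mono) auto
      finally show "(\<Sum>i\<le>n. (2 powr (127/100)) ^ i) \<le> 32 * \<eta> powr (-127/50)" by (simp add: mult_right_mono)
    qed (use A in auto)
    \<comment> \<open>For large \<open>Y\<close> the factor \<open>1 / Y^2\<close> makes this term
      at most half of \<open>\<eta>^2 / 2\<close> times \<open>r^2\<close>, so it is absorbed by the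
      left side.\<close>
    also have "2 * A * (r\<^sup>2 / (real Y)\<^sup>2) * (512 / \<eta> ^ 8) \<le> \<eta>\<^sup>2 / 4 * r\<^sup>2"
    proof -
      have "4096 * A \<le> \<eta> ^ 12 * real Y" using large C(3) by linarith
      also have "\<eta> ^ 12 * real Y \<le> \<eta> ^ 10 * (real Y)\<^sup>2"
        using lam y by (intro mult_mono power_decreasing) (auto simp: power2_eq_square)
      finally have "r\<^sup>2 * (4096 * A) \<le> r\<^sup>2 * (\<eta> ^ 10 * (real Y)\<^sup>2)" by (intro mult_left_mono) auto
      then have "r\<^sup>2 * (4096 * A) / (4 * ((real Y)\<^sup>2 * \<eta> ^ 8)) \<le> r\<^sup>2 * (\<eta> ^ 10 * (real Y)\<^sup>2) / (4 * ((real Y)\<^sup>2 * \<eta> ^ 8))"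
        by (rule divide_right_mono) simp
      moreover have pow10: "\<eta> ^ 10 = \<eta>\<^sup>2 * \<eta> ^ 8" by (simp add: power_add[symmetric])
      have "r\<^sup>2 * (\<eta> ^ 10 * (real Y)\<^sup>2) / (4 * ((real Y)\<^sup>2 * \<eta> ^ 8)) = \<eta>\<^sup>2 / 4 * r\<^sup>2"
      proof -
        have cancel: "s * (t * e * z) / (4 * (z * e)) = t / 4 * s" if "e \<noteq> 0" "z \<noteq> 0" for s t e z :: real
          using that by simp
        show ?thesis unfolding pow10 by (rule cancel) (use lam y in auto)
      qed
      ultimately show ?thesis by simp
    qed
    finally have "\<eta>\<^sup>2 / 4 * r\<^sup>2 \<le> 64 * A * r powr (17/16) * \<eta> powr (-127/50)" by simp
    then have le: "\<eta>\<^sup>2 * r\<^sup>2 \<le> 256 * A * r powr (17/16) * \<eta> powr (-127/50)" by simp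
    have "r powr (15/16) \<le> 256 * A * \<eta> powr (-227/50)"
    proof -
      have "r\<^sup>2 = r powr (15/16) * r powr (17/16)" "\<eta>\<^sup>2 = \<eta> powr 2"
        using r lam by (simp_all add: powr_add[symmetric] powr_numeral)
      then have "r powr (17/16) * (\<eta> powr 2 * r powr (15/16)) \<le> r powr (17/16) * (256 * A * \<eta> powr (-127/50))"
        using le by (simp add: mult_ac)
      then have "\<eta> powr 2 * r powr (15/16) \<le> 256 * A * \<eta> powr (-127/50)"
        using r by (subst (asm) mult_le_cancel_left_pos) auto
      then have le': "\<eta> powr (-2) * (\<eta> powr 2 * r powr (15/16)) \<le> \<eta> powr (-2) * (256 * A * \<eta> powr (-127/50))"
        by (intro mult_left_mono) auto
      have "\<eta> powr (-2) * \<eta> powr 2 = 1" using powr_add[of \<eta> "-2" 2] lam by simp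
      then have "r powr (15/16) = \<eta> powr (-2) * (\<eta> powr 2 * r powr (15/16))"
        by (simp only: mult.assoc[symmetric] mult_1)
      also note le'
      also have "\<eta> powr (-2) * (256 * A * \<eta> powr (-127/50)) = 256 * A * (\<eta> powr (-2) * \<eta> powr (-127/50))"
        by (simp only: mult_ac)
      also have "\<eta> powr (-2) * \<eta> powr (-127/50) = \<eta> powr (-227/50)" by (simp add: powr_add[symmetric])
      finally show ?thesis .
    qed
    then have "(r powr (15/16)) powr (16/15) \<le> (256 * A * \<eta> powr (-227/50)) powr (16/15)"
      using r by (intro powr_mono2) auto
    then have "r \<le> (256 * A) powr (16/15) * \<eta> powr (-227/50 * (16/15))"
      using r by (simp add: powr_mult powr_powr)
    also have "\<dots> \<le> C * \<eta> powr (-97/20)"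
      using C lam by (intro mult_mono powr_mono') auto
    finally show ?thesis by (simp add: r_def)
  qed
  show ?thesis using C(1) main by (intro exI[of _ C]) blast
qed

text \<open>Apart from the diagonal \<open>y = y'\<close>, symmetry allows \<open>y > y'\<close>.
  Then \<open>(y - y') (y + y') = (z' - z) (z' + z)\<close>, and the triple
  \<open>(y - y', y + y', z' - z)\<close>, whose last entry divides the product of the first two,
  determines the solution.\<close>

lemma card_square_quadruples_le:
  "card (SIGMA p:{1..Y} \<times> {1..Y}. {p'\<in>{1..Y} \<times> {1..Y}. (fst p')\<^sup>2 + (snd p')\<^sup>2 = (fst p)\<^sup>2 + (snd p)\<^sup>2})
    \<le> Y\<^sup>2 + 2 * (\<Sum>n=1..2 * Y. divisor_count n)\<^sup>2"
proof -
  let ?S = "{1..Y} \<times> {1..Y}"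
  define E where "E = (SIGMA p:?S. {p'\<in>?S. (fst p')\<^sup>2 + (snd p')\<^sup>2 = (fst p)\<^sup>2 + (snd p)\<^sup>2})"
  define D where "D = {e\<in>E. fst (fst e) = fst (snd e)}"
  define U where "U = {e\<in>E. fst (snd e) < fst (fst e)}"
  define L where "L = {e\<in>E. fst (fst e) < fst (snd e)}"
  have finE: "finite E" unfolding E_def by (intro finite_SigmaI) auto
  have "card D \<le> card ?S"
  proof (rule card_inj_on_le[where f = fst])
    show "inj_on fst D"
    proof (rule inj_onI)
      fix e f assume ef: "e \<in> D" "f \<in> D" "fst e = fst f"
      obtain y z y' z' where e: "e = ((y, z), (y', z'))" by (metis surj_pair)
      obtain v w v' w' where f: "f = ((v, w), (v', w'))" by (metis surj_pair)
      have "y' = y" "z'\<^sup>2 = z\<^sup>2" "v' = v" "w'\<^sup>2 = w\<^sup>2" using ef by (auto simp: D_def E_def e f)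
      then show "e = f" using ef(3) by (simp add: e f power2_eq_iff_nonneg)
    qed
    show "fst ` D \<subseteq> ?S" by (auto simp: D_def E_def)
  qed simp
  then have D: "card D \<le> Y\<^sup>2" by (simp add: card_cartesian_product power2_eq_square)
  have "card L \<le> card U"
  proof (rule card_inj_on_le[where f = "\<lambda>e. (snd e, fst e)"])
    show "inj_on (\<lambda>e. (snd e, fst e)) L" by (auto intro!: inj_onI prod_eqI)
    show "(\<lambda>e. (snd e, fst e)) ` L \<subseteq> U" by (auto simp: L_def U_def E_def)
    show "finite U" using finE by (simp add: U_def)
  qed
  moreover have "card U \<le> (\<Sum>n=1..2 * Y. divisor_count n)\<^sup>2"
  proof -
    let ?T = "SIGMA q:{1..2 * Y} \<times> {1..2 * Y}. {c. c dvd fst q * snd q}"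
    define \<phi> where "\<phi> e = ((fst (fst e) - fst (snd e), fst (fst e) + fst (snd e)), snd (snd e) - snd (fst e))"
      for e :: "(nat \<times> nat) \<times> (nat \<times> nat)"
    have finT: "finite ?T"
      by (intro finite_SigmaI finite_cartesian_product) (auto intro!: finite_divisors_nat)
    have ex: "\<exists>a c. e = ((y' + a, z), (y', z + c)) \<and> a > 0 \<and> c > 0 \<and> a * (2 * y' + a) = c * (2 * z + c)
        \<and> 1 \<le> y' \<and> y' + a \<le> Y"
      if "e \<in> U" "fst (snd e) = y'" "snd (fst e) = z" for e y' z
    proof -
      define y z' where "y = fst (fst e)" and "z' = snd (snd e)"
      then have e: "e = ((y, z), (y', z'))" using that by (simp add: prod_eq_iff)
      have rel: "y'\<^sup>2 + z'\<^sup>2 = y\<^sup>2 + z\<^sup>2" "y' < y" "1 \<le> y'" "y \<le> Y" using that(1) by (auto simp: U_def E_def e)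
      have "y'\<^sup>2 < y\<^sup>2" using rel by (intro power_strict_mono) auto
      then have "z\<^sup>2 < z'\<^sup>2" using rel by linarith
      then have "z < z'" by (rule power_less_imp_less_base) simp
      then obtain c where c: "z' = z + c" "c > 0" by (metis less_imp_add_positive)
      obtain a where a: "y = y' + a" "a > 0" using rel(2) by (metis less_imp_add_positive)
      have "a * (2 * y' + a) = c * (2 * z + c)"
        using rel(1) unfolding a c by (simp add: power2_eq_square algebra_simps)
      then show ?thesis using a c rel e by blast
    qed
    have "card U \<le> card ?T"
    proof (rule card_inj_on_le[where f = \<phi>])
      show "inj_on \<phi> U"
      proof (rule inj_onI)
        fix e f assume ef: "e \<in> U" "f \<in> U" "\<phi> e = \<phi> f"
        obtain y z a c where e: "e = ((y + a, z), (y, z + c))" "a > 0" "c > 0" "a * (2 * y + a) = c * (2 * z + c)"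
          using ex[OF ef(1) refl refl] by blast
        obtain y' z' a' c' where f: "f = ((y' + a', z'), (y', z' + c'))" "a' * (2 * y' + a') = c' * (2 * z' + c')"
          using ex[OF ef(2) refl refl] by blast
        have eqs: "a' = a" "c' = c" "y' = y" using ef(3) by (auto simp: \<phi>_def e f)
        have "c * (2 * z + c) = c * (2 * z' + c)" using e(4) f(2) unfolding eqs by linarith
        then have "z = z'" using e(3) by simp
        then show "e = f" by (simp add: e f eqs)
      qed
      show "\<phi> ` U \<subseteq> ?T"
      proof
        fix t assume "t \<in> \<phi> ` U"
        then obtain e where "e \<in> U" "t = \<phi> e" by blast
        then obtain y z a c where e: "e = ((y + a, z), (y, z + c))" "a > 0" "c > 0" "a * (2 * y + a) = c * (2 * z + c)"
          "1 \<le> y" "y + a \<le> Y"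
          using ex[OF \<open>e \<in> U\<close> refl refl] by blast
        have "t = ((a, 2 * y + a), c)" using \<open>t = \<phi> e\<close> by (simp add: \<phi>_def e)
        moreover have "c dvd a * (2 * y + a)" unfolding e(4) by simp
        ultimately show "t \<in> ?T" using e by auto
      qed
    qed (rule finT)
    also have "card ?T = (\<Sum>q\<in>{1..2 * Y} \<times> {1..2 * Y}. divisor_count (fst q * snd q))"
      unfolding divisor_count_def by (intro card_SigmaI) (auto intro!: finite_divisors_nat)
    also have "\<dots> \<le> (\<Sum>q\<in>{1..2 * Y} \<times> {1..2 * Y}. divisor_count (fst q) * divisor_count (snd q))"
      by (intro sum_mono divisor_count_mult_le) auto
    also have "\<dots> = (\<Sum>n=1..2 * Y. divisor_count n)\<^sup>2"
      by (simp add: power2_eq_square sum_product sum.cartesian_product case_prod_unfold)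
    finally show ?thesis .
  qed
  moreover have "E = D \<union> (U \<union> L)" by (auto simp: D_def U_def L_def)
  then have "card E \<le> card D + (card U + card L)"
    by (metis add_left_mono card_Un_le order_trans)
  ultimately have "card E \<le> Y\<^sup>2 + 2 * (\<Sum>n=1..2 * Y. divisor_count n)\<^sup>2" using D by linarith
  then show ?thesis by (simp only: E_def)
qed

text \<open>The square of \<open>square_sum\<close> has frequencies that are sums of two squares;
  these are at most \<open>2 Y^2 < G\<close>, so they stay distinct modulo \<open>G\<close>, and
  Parseval reduces the moment to counting solutions of
  \<open>y^2 + z^2 = y'^2 + z'^2\<close>.\<close>

lemma square_sum_fourth_moment:
  assumes a: "\<And>y. cmod (a y) \<le> 1" and G: "2 * Y\<^sup>2 < G"
  shows "(\<Sum>j<G. cmod (square_sum a Y G j) ^ 4) \<le> real G * real (Y\<^sup>2 + 2 * (\<Sum>n=1..2 * Y. divisor_count n)\<^sup>2)"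
proof -
  let ?S = "{1..Y} \<times> {1..Y}"
  define s where "s p = (fst p)\<^sup>2 + (snd p)\<^sup>2" for p :: "nat \<times> nat"
  define b where "b n = (\<Sum>p\<in>{p\<in>?S. s p = n}. a (fst p) * a (snd p))" for n
  have s_lt: "s ` ?S \<subseteq> {..<G}"
  proof -
    have "s p \<le> Y\<^sup>2 + Y\<^sup>2" if "p \<in> ?S" for p
      unfolding s_def using that by (intro add_mono power_mono) auto
    then show ?thesis using G by fastforce
  qed
  have sq: "(square_sum a Y G j)\<^sup>2 = (\<Sum>n<G. b n * add_char (real j * real n / real G))" for j
  proof -
    have "(square_sum a Y G j)\<^sup>2 = (\<Sum>p\<in>?S. a (fst p) * a (snd p) * add_char (real j * real (s p) / real G))"
      unfolding square_sum_def power2_eq_square sum_product sum.cartesian_product case_prod_unfold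
      by (intro sum.cong refl)
         (simp add: s_def add_char_add[symmetric] power2_eq_square add_divide_distrib distrib_left mult_ac
           ring_distribs flip: add_char_add)
    also have "\<dots> = (\<Sum>n<G. \<Sum>p\<in>{p\<in>?S. s p = n}. a (fst p) * a (snd p) * add_char (real j * real (s p) / real G))"
      by (rule sum.group[symmetric]) (use s_lt in auto)
    also have "\<dots> = (\<Sum>n<G. b n * add_char (real j * real n / real G))"
      by (intro sum.cong refl) (simp add: b_def sum_distrib_right)
    finally show ?thesis .
  qed
  have b_le: "cmod (b n) \<le> real (card {p\<in>?S. s p = n})" for n
  proof -
    have "cmod (b n) \<le> (\<Sum>p\<in>{p\<in>?S. s p = n}. 1)" unfolding b_def
    proof (rule sum_norm_le)
      fix p
      have "cmod (a (fst p)) * cmod (a (snd p)) \<le> 1 * 1" using a by (intro mult_mono) auto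
      then show "cmod (a (fst p) * a (snd p)) \<le> 1" by (simp add: norm_mult)
    qed
    then show ?thesis by simp
  qed
  have "(\<Sum>j<G. cmod (square_sum a Y G j) ^ 4) = (\<Sum>j<G. (cmod ((square_sum a Y G j)\<^sup>2))\<^sup>2)"
    by (simp add: norm_power power_mult[symmetric])
  also have "\<dots> = real G * (\<Sum>n<G. (cmod (b n))\<^sup>2)" unfolding sq by (rule parseval) simp
  also have "(\<Sum>n<G. (cmod (b n))\<^sup>2) \<le> (\<Sum>n<G. (real (card {p\<in>?S. s p = n}))\<^sup>2)"
    using b_le by (intro sum_mono power_mono) auto
  also have "\<dots> = (\<Sum>n<G. \<Sum>p\<in>{p\<in>?S. s p = n}. real (card {p'\<in>?S. s p' = s p}))"
    by (intro sum.cong refl) (simp add: power2_eq_square)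
  also have "\<dots> = (\<Sum>p\<in>?S. real (card {p'\<in>?S. s p' = s p}))"
    by (rule sum.group) (use s_lt in auto)
  also have "\<dots> = real (card (SIGMA p:?S. {p'\<in>?S. s p' = s p}))" by simp
  also have "\<dots> \<le> real (Y\<^sup>2 + 2 * (\<Sum>n=1..2 * Y. divisor_count n)\<^sup>2)"
    using card_square_quadruples_le[of Y] unfolding s_def by (simp only: of_nat_le_iff)
  finally show ?thesis by (simp add: mult_left_mono)
qed

text \<open>The loss \<open>Y powr (1/24)\<close> is affordable, as this moment is used only at
  points where the sum is smaller than \<open>Y\<close> by a factor of about
  \<open>Y powr (1/12)\<close>.\<close>

lemma square_sum_fourth_moment_powr:
  "\<exists>C>0. \<forall>Y G a. Y > 0 \<longrightarrow> 2 * Y\<^sup>2 < G \<longrightarrow> (\<forall>y. cmod (a y) \<le> 1) \<longrightarrow>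
    (\<Sum>j<G. cmod (square_sum a Y G j) ^ 4) \<le> C * real G * real Y powr (49/24)"
proof -
  obtain C where C: "C > 0" "\<And>Q. Q > 0 \<Longrightarrow> (harm Q :: real) ^ 4 \<le> C * real Q powr (1/24)"
    using harm_power_le_powr[of "1/24" 4] by auto
  have "(\<Sum>j<G. cmod (square_sum a Y G j) ^ 4) \<le> (1 + 16 * C) * real G * real Y powr (49/24)"
    if Y: "Y > 0" and G: "2 * Y\<^sup>2 < G" and a: "\<And>y. cmod (a y) \<le> 1" for Y G a
  proof -
    have y: "real Y \<ge> 1" using Y by simp
    have "(\<Sum>n=1..2 * Y. real (divisor_count n))\<^sup>2 \<le> (real (2 * Y) * harm (2 * Y) ^ 2)\<^sup>2"
      by (intro power_mono sum_divisor_count_le sum_nonneg) auto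
    also have "\<dots> = 4 * (real Y)\<^sup>2 * harm (2 * Y) ^ 4" by (simp add: power_mult_distrib power_mult[symmetric])
    also have "\<dots> \<le> 4 * (real Y)\<^sup>2 * (C * real (2 * Y) powr (1/24))"
      using Y by (intro mult_left_mono C(2)) auto
    also have "\<dots> \<le> 4 * (real Y)\<^sup>2 * (C * (2 * real Y powr (1/24)))"
    proof -
      have "(2::real) powr (1/24) \<le> 2 powr 1" by (intro powr_mono) auto
      then have "real (2 * Y) powr (1/24) \<le> 2 * real Y powr (1/24)" by (simp add: powr_mult mult_right_mono)
      then show ?thesis using C by (intro mult_left_mono) auto
    qed
    finally have d: "(\<Sum>n=1..2 * Y. real (divisor_count n))\<^sup>2 \<le> 8 * C * ((real Y)\<^sup>2 * real Y powr (1/24))"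
      using C by (simp add: mult_ac)
    have pw: "(real Y)\<^sup>2 * real Y powr (1/24) = real Y powr (49/24)"
    proof -
      have "(real Y)\<^sup>2 = real Y powr 2" using y by (simp add: powr_numeral)
      then show ?thesis by (simp only: powr_add[symmetric]) simp
    qed
    have "(real Y)\<^sup>2 * 1 \<le> (real Y)\<^sup>2 * real Y powr (1/24)"
      using y by (intro mult_left_mono ge_one_powr_ge_zero) auto
    then have "real (Y\<^sup>2 + 2 * (\<Sum>n=1..2 * Y. divisor_count n)\<^sup>2) \<le> (1 + 16 * C) * real Y powr (49/24)"
      using d unfolding pw by (simp add: distrib_right)
    then have "real G * real (Y\<^sup>2 + 2 * (\<Sum>n=1..2 * Y. divisor_count n)\<^sup>2) \<le> real G * ((1 + 16 * C) * real Y powr (49/24))"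
      by (intro mult_left_mono) auto
    then show ?thesis using square_sum_fourth_moment[where a = a, OF a G] by (simp add: mult_ac)
  qed
  moreover have "1 + 16 * C > 0" using C by simp
  ultimately show ?thesis by blast
qed

text \<open>Heights down to about \<open>Y powr (-1/12)\<close>, the range of the level set bound,
  contribute a geometric series of ratio \<open>(1/2) powr (5 - 97/20)\<close>. Below them, one
  factor of the height times the fourth moment gives \<open>O(Y powr (-1/24))\<close>. For bounded
  \<open>Y\<close> the trivial estimate is enough.\<close>

lemma square_sum_fifth_moment:
  "\<exists>C>0. \<forall>Y G a. Y > 0 \<longrightarrow> 2 * Y\<^sup>2 < G \<longrightarrow> G \<le> 65 * Y\<^sup>2 \<longrightarrow> (\<forall>y. cmod (a y) \<le> 1) \<longrightarrow>
    (\<Sum>j<G. (cmod (square_sum a Y G j) / real Y) ^ 5) \<le> C"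
proof -
  obtain C1 where C1: "C1 > 0" and level: "\<And>Y G a R \<eta>. Y > 0 \<Longrightarrow> Y\<^sup>2 < G \<Longrightarrow> G \<le> 65 * Y\<^sup>2 \<Longrightarrow>
    \<forall>y. cmod (a y) \<le> 1 \<Longrightarrow> R \<subseteq> {..<G} \<Longrightarrow>
    0 < \<eta> \<Longrightarrow> \<eta> \<le> 1 \<Longrightarrow> C1 \<le> \<eta> ^ 12 * real Y \<Longrightarrow> \<forall>j\<in>R. \<eta> * real Y \<le> cmod (square_sum a Y G j) \<Longrightarrow>
    real (card R) \<le> C1 * \<eta> powr (-97/20)"
    using level_set_bound by blast
  obtain C2 where C2: "C2 > 0" and fourth: "\<And>Y G a. Y > 0 \<Longrightarrow> 2 * Y\<^sup>2 < G \<Longrightarrow> \<forall>y. cmod (a y) \<le> 1 \<Longrightarrow>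
    (\<Sum>j<G. cmod (square_sum a Y G j) ^ 4) \<le> C2 * real G * real Y powr (49/24)"
    using square_sum_fourth_moment_powr by blast
  define x where "x = (1/2::real) powr (3/20)"
  have x: "0 < x" "x < 1" using powr_less_mono'[of "1/2::real" 0 "3/20"] by (auto simp: x_def)
  define C where "C = 65 * C1\<^sup>2 + 32 * C1 / (1 - x) + 130 * C1 powr (1/12) * C2"
  have C: "C > 0" "65 * C1\<^sup>2 \<le> C" "32 * C1 / (1 - x) + 130 * C1 powr (1/12) * C2 \<le> C"
    using C1 C2 x by (auto simp: C_def intro!: add_pos_nonneg)
  have "(\<Sum>j<G. (cmod (square_sum a Y G j) / real Y) ^ 5) \<le> C"
    if Y: "Y > 0" and G: "2 * Y\<^sup>2 < G" "G \<le> 65 * Y\<^sup>2" and a: "\<forall>y. cmod (a y) \<le> 1" for Y G a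
  proof -
    define v where "v j = cmod (square_sum a Y G j) / real Y" for j
    have v: "0 \<le> v j" "v j \<le> 1" for j
      using cmod_square_sum_le[of a Y G j] a Y by (auto simp: v_def)
    have "real G \<le> real (65 * Y\<^sup>2)" using G(2) by (simp only: of_nat_le_iff)
    then have G': "real G \<le> 65 * (real Y)\<^sup>2" by simp
    have "(\<Sum>j<G. v j ^ 5) \<le> C"
    proof (cases "C1 \<le> real Y")
      case False
      have "(\<Sum>j<G. v j ^ 5) \<le> (\<Sum>j<G. 1)" using v by (intro sum_mono power_le_one) auto
      also have "\<dots> \<le> 65 * (real Y)\<^sup>2" using G' by simp
      also have "\<dots> \<le> 65 * C1\<^sup>2" using False by (intro mult_left_mono power_mono) auto
      finally show ?thesis using C(2) by linarith
    next
      case True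
      have "\<exists>n. (1 / 2 ^ Suc n) ^ 12 * real Y < C1"
      proof -
        obtain n where n: "(1/2::real) ^ n < C1 / real Y"
          using real_arch_pow_inv[of "C1 / real Y" "1/2"] C1 Y by auto
        have "(1 / 2 ^ Suc n :: real) ^ 12 \<le> (1/2) ^ n"
        proof -
          have "(1 / 2 ^ Suc n :: real) ^ 12 = (1/2) ^ (Suc n * 12)"
            by (simp only: power_mult power_one_over)
          also have "\<dots> \<le> (1/2) ^ n" by (intro power_decreasing) auto
          finally show ?thesis .
        qed
        then have "(1 / 2 ^ Suc n) ^ 12 * real Y \<le> (1/2) ^ n * real Y" by (rule mult_right_mono) simp
        also have "\<dots> < C1" using n Y by (simp add: pos_less_divide_eq)
        finally show ?thesis by blast
      qed
      \<comment> \<open>The last usable level: all levels up to \<open>n\<close> are in the range of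
        the level set bound, and failure at the next one makes \<open>1 / 2^n\<close> small.\<close>
      then obtain n where n: "(1 / 2 ^ Suc n) ^ 12 * real Y < C1"
        "\<And>m. m < n \<Longrightarrow> \<not> (1 / 2 ^ Suc m) ^ 12 * real Y < C1"
        using exists_least_iff[of "\<lambda>n. (1 / 2 ^ Suc n) ^ 12 * real Y < C1"] by blast
      have big: "C1 \<le> (1 / 2 ^ i) ^ 12 * real Y" if "i \<le> n" for i
      proof (cases i)
        case 0
        then show ?thesis using True by simp
      next
        case (Suc m)
        then show ?thesis using n(2)[of m] that by simp
      qed
      let ?A = "{j\<in>{..<G}. 1 / 2 ^ n \<le> v j}"
      have "(\<Sum>j\<in>?A. v j ^ 5) \<le> (\<Sum>i\<le>n. (2 / 2 ^ i) ^ 5 * real (card {j\<in>{..<G}. 1 / 2 ^ i \<le> v j}))"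
        using v by (intro dyadic_sum_le) auto
      also have "\<dots> \<le> (\<Sum>i\<le>n. 32 * C1 * x ^ i)"
      proof (intro sum_mono)
        fix i assume i: "i \<in> {..n}"
        have "real (card {j\<in>{..<G}. 1 / 2 ^ i \<le> v j}) \<le> C1 * (1 / 2 ^ i) powr (-97/20)"
        proof (rule level[OF Y _ G(2) a])
          show "Y\<^sup>2 < G" using G(1) by linarith
          show "C1 \<le> (1 / 2 ^ i) ^ 12 * real Y" using big i by simp
          show "\<forall>j\<in>{j\<in>{..<G}. 1 / 2 ^ i \<le> v j}. 1 / 2 ^ i * real Y \<le> cmod (square_sum a Y G j)"
            using Y by (simp add: v_def field_simps)
        qed auto
        then have "(2 / 2 ^ i) ^ 5 * real (card {j\<in>{..<G}. 1 / 2 ^ i \<le> v j})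
            \<le> (2 / 2 ^ i) ^ 5 * (C1 * (1 / 2 ^ i) powr (-97/20))" by (intro mult_left_mono) auto
        also have "\<dots> = 32 * C1 * ((1 / 2 ^ i) ^ 5 * (1 / 2 ^ i) powr (-97/20))" by (simp add: power_divide)
        also have "(1 / 2 ^ i :: real) ^ 5 * (1 / 2 ^ i) powr (-97/20) = x ^ i"
        proof -
          define z where "z = (1/2 :: real) ^ i"
          have z: "z > 0" by (simp add: z_def)
          have "z ^ 5 * z powr (-97/20) = z powr 5 * z powr (-97/20)" using z by (simp add: powr_numeral)
          also have "\<dots> = z powr (3/20)" by (simp only: powr_add[symmetric]) simp
          also have "\<dots> = x ^ i"
            unfolding z_def x_def by (simp add: powr_power powr_realpow[symmetric] powr_powr) (simp add: mult.commute)
          finally show ?thesis by (simp add: z_def power_one_over)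
        qed
        finally show "(2 / 2 ^ i) ^ 5 * real (card {j\<in>{..<G}. 1 / 2 ^ i \<le> v j}) \<le> 32 * C1 * x ^ i" .
      qed
      also have "\<dots> = 32 * C1 * (\<Sum>i<Suc n. x ^ i)" by (simp only: sum_distrib_left lessThan_Suc_atMost)
      also have "(\<Sum>i<Suc n. x ^ i) \<le> 1 / (1 - x)"
        unfolding sum_gp_strict using x by (auto simp: divide_right_mono)
      finally have part1: "(\<Sum>j\<in>?A. v j ^ 5) \<le> 32 * C1 / (1 - x)" using C1 by simp
      have small: "1 / 2 ^ n \<le> 2 * C1 powr (1/12) * real Y powr (-1/12)"
      proof -
        define z where "z = (1 :: real) / 2 ^ Suc n"
        have z: "z > 0" by (simp add: z_def)
        have "z ^ 12 \<le> C1 / real Y" using n(1) Y by (simp add: z_def pos_le_divide_eq)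
        then have "(z ^ 12) powr (1/12) \<le> (C1 / real Y) powr (1/12)" using z by (intro powr_mono2) auto
        moreover have "(z ^ 12) powr (1/12) = z"
        proof -
          have "z ^ 12 = z powr 12" using z by (simp add: powr_numeral)
          then show ?thesis using z by (simp only: powr_powr) simp
        qed
        moreover have "(C1 / real Y) powr (1/12) = C1 powr (1/12) * real Y powr (-1/12)"
          using C1 by (simp add: powr_divide powr_minus_divide)
        ultimately show ?thesis by (simp add: z_def)
      qed
      have "(\<Sum>j\<in>{..<G} - ?A. v j ^ 5) \<le> (\<Sum>j\<in>{..<G} - ?A. 1 / 2 ^ n * v j ^ 4)"
      proof (intro sum_mono)
        fix j assume "j \<in> {..<G} - ?A"
        then have "v j \<le> 1 / 2 ^ n" by auto
        then have "v j * v j ^ 4 \<le> 1 / 2 ^ n * v j ^ 4" using v by (intro mult_right_mono) auto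
        then show "v j ^ 5 \<le> 1 / 2 ^ n * v j ^ 4" by (simp add: eval_nat_numeral)
      qed
      also have "\<dots> \<le> (\<Sum>j<G. 1 / 2 ^ n * v j ^ 4)" using v by (intro sum_mono2) auto
      also have "\<dots> = 1 / 2 ^ n * ((\<Sum>j<G. cmod (square_sum a Y G j) ^ 4) / real Y ^ 4)"
        by (simp add: v_def power_divide sum_distrib_left sum_divide_distrib)
      also have "\<dots> \<le> (2 * C1 powr (1/12) * real Y powr (-1/12)) * ((C2 * (65 * (real Y)\<^sup>2) * real Y powr (49/24)) / real Y ^ 4)"
      proof (intro mult_mono small divide_right_mono)
        have "C2 * real G * real Y powr (49/24) \<le> C2 * (65 * (real Y)\<^sup>2) * real Y powr (49/24)"
          using G' C2 by (intro mult_left_mono mult_right_mono) auto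
        then show "(\<Sum>j<G. cmod (square_sum a Y G j) ^ 4) \<le> C2 * (65 * (real Y)\<^sup>2) * real Y powr (49/24)"
          using fourth[OF Y G(1) a] by linarith
      qed (auto intro!: sum_nonneg divide_nonneg_nonneg)
      also have "\<dots> = 130 * C1 powr (1/12) * C2 * (real Y powr (-1/12) * real Y powr (49/24) * ((real Y)\<^sup>2 / real Y ^ 4))"
        by simp
      also have "(real Y)\<^sup>2 / real Y ^ 4 = real Y powr (-2)"
        using Y by (simp add: powr_minus_divide powr_numeral power2_eq_square power4_eq_xxxx)
      also have "real Y powr (-1/12) * real Y powr (49/24) * real Y powr (-2) = real Y powr (-1/24)"
        by (simp only: powr_add[symmetric]) simp
      also have "130 * C1 powr (1/12) * C2 * real Y powr (-1/24) \<le> 130 * C1 powr (1/12) * C2 * 1"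
      proof (intro mult_left_mono)
        have "real Y powr (-1/24) \<le> real Y powr 0" using Y by (intro powr_mono) auto
        then show "real Y powr (-1/24) \<le> 1" using Y by simp
      qed (use C1 C2 in auto)
      finally have part2: "(\<Sum>j\<in>{..<G} - ?A. v j ^ 5) \<le> 130 * C1 powr (1/12) * C2" by simp
      have "(\<Sum>j<G. v j ^ 5) = (\<Sum>j\<in>{..<G} - ?A. v j ^ 5) + (\<Sum>j\<in>?A. v j ^ 5)"
        by (rule sum.subset_diff) auto
      then show ?thesis using part1 part2 C(3) by linarith
    qed
    then show ?thesis by (simp add: v_def)
  qed
  then show ?thesis using C(1) by blast
qed

section \<open>Quadratic recurrence\<close>

text \<open>Simultaneous Dirichlet approximation with denominators up to \<open>N ^ R\<close>: the
  range of \<open>q\<close> depends on the number of frequencies, not on the frequencies.\<close>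

lemma dirichlet_chord:
  fixes \<epsilon> :: real
  assumes "\<epsilon> > 0"
  shows "\<exists>L. \<forall>A::real set. finite A \<longrightarrow> card A \<le> R \<longrightarrow> (\<exists>q\<in>{1..L::nat}. \<forall>\<alpha>\<in>A. chord (real q * \<alpha>) \<le> \<epsilon>)"
proof -
  obtain N :: nat where N: "2 * pi / \<epsilon> < real N" using reals_Archimedean2 by blast
  have "0 < 2 * pi / \<epsilon>" using assms by simp
  then have N0: "N > 0" using N by (intro Nat.gr0I) auto
  have N1: "2 * pi / real N \<le> \<epsilon>" using N N0 assms by (simp add: field_simps)
  have "\<exists>q\<in>{1..N ^ R}. \<forall>\<alpha>\<in>A. chord (real q * \<alpha>) \<le> \<epsilon>"
    if A: "finite A" "card A \<le> R" for A :: "real set"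
  proof -
    obtain h where h: "bij_betw h {0..<card A} A" using ex_bij_betw_nat_finite[OF A(1)] by blast
    obtain q p where q: "0 < q" "q \<le> int (N ^ card A)"
      "\<And>i. i < card A \<Longrightarrow> \<bar>of_int q * h i - of_int (p i)\<bar> < 1 / N"
      using Dirichlet_approx_simult[OF N0, of "card A" h] by metis
    have "N ^ card A \<le> N ^ R" using A N0 by (intro power_increasing) auto
    moreover have "nat q \<le> N ^ card A" using q(2) by (simp only: nat_le_iff)
    ultimately have "nat q \<in> {1..N ^ R}" using q(1) by simp
    moreover have "chord (real (nat q) * \<alpha>) \<le> \<epsilon>" if "\<alpha> \<in> A" for \<alpha>
    proof -
      have "\<alpha> \<in> h ` {0..<card A}" using h \<open>\<alpha> \<in> A\<close> by (simp add: bij_betw_def)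
      then obtain i where i: "i < card A" "\<alpha> = h i" by auto
      have "chord (real (nat q) * \<alpha>) = chord (of_int q * h i - of_int (p i))"
        using q(1) i by simp
      also have "\<dots> \<le> 2 * pi * \<bar>of_int q * h i - of_int (p i)\<bar>" by (rule chord_upper)
      also have "\<dots> \<le> 2 * pi * (1 / N)" using q(3)[OF i(1)] by (intro mult_left_mono) auto
      finally show ?thesis using N1 by simp
    qed
    ultimately show ?thesis by blast
  qed
  then show ?thesis by blast
qed

text \<open>The next term is found by Dirichlet approximation of the at most \<open>R t\<close>
  numbers \<open>2 \<alpha> n i\<close> with \<open>i < t\<close>. Thereby all cross terms in the
  square of a sum of the \<open>n i\<close>, multiplied by \<alpha>, are close to integers.\<close>

lemma almost_orthogonal_sequence:
  fixes \<epsilon> :: real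
  assumes "\<epsilon> > 0"
  shows "\<exists>L. \<forall>A::real set. finite A \<longrightarrow> card A \<le> R \<longrightarrow>
    (\<exists>n::nat \<Rightarrow> nat. (\<forall>i<t. n i \<in> {1..L}) \<and>
      (\<forall>j<t. \<forall>i<j. \<forall>\<alpha>\<in>A. chord (real (n j) * (2 * \<alpha> * real (n i))) \<le> \<epsilon>))"
proof (induction t)
  case (Suc t)
  then obtain L where L: "\<And>A::real set. finite A \<Longrightarrow> card A \<le> R \<Longrightarrow>
    (\<exists>n::nat \<Rightarrow> nat. (\<forall>i<t. n i \<in> {1..L}) \<and>
      (\<forall>j<t. \<forall>i<j. \<forall>\<alpha>\<in>A. chord (real (n j) * (2 * \<alpha> * real (n i))) \<le> \<epsilon>))" by blast
  obtain L' where L': "\<And>A::real set. finite A \<Longrightarrow> card A \<le> R * t \<Longrightarrow>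
    (\<exists>q\<in>{1..L'::nat}. \<forall>\<alpha>\<in>A. chord (real q * \<alpha>) \<le> \<epsilon>)"
    using dirichlet_chord[OF assms] by blast
  show ?case
  proof (intro exI[of _ "max L L'"] allI impI)
    fix A :: "real set" assume A: "finite A" "card A \<le> R"
    obtain n where n: "\<forall>i<t. n i \<in> {1..L}"
      "\<forall>j<t. \<forall>i<j. \<forall>\<alpha>\<in>A. chord (real (n j) * (2 * \<alpha> * real (n i))) \<le> \<epsilon>"
      using L[OF A] by blast
    let ?A' = "(\<lambda>(\<alpha>, i). 2 * \<alpha> * real (n i)) ` (A \<times> {..<t})"
    have "card ?A' \<le> card (A \<times> {..<t})" using A by (intro card_image_le) auto
    also have "\<dots> \<le> R * t" using A by (simp add: card_cartesian_product)
    finally obtain q where q: "q \<in> {1..L'}" "\<forall>\<alpha>\<in>?A'. chord (real q * \<alpha>) \<le> \<epsilon>"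
      using L'[of ?A'] A by blast
    show "\<exists>n::nat \<Rightarrow> nat. (\<forall>i<Suc t. n i \<in> {1..max L L'}) \<and>
      (\<forall>j<Suc t. \<forall>i<j. \<forall>\<alpha>\<in>A. chord (real (n j) * (2 * \<alpha> * real (n i))) \<le> \<epsilon>)"
    proof (intro exI[of _ "n(t := q)"] conjI allI impI ballI)
      fix i assume "i < Suc t"
      then show "(n(t := q)) i \<in> {1..max L L'}" using n q by (auto simp: less_Suc_eq le_max_iff_disj)
    next
      fix j i \<alpha> assume "j < Suc t" "i < j" "\<alpha> \<in> A"
      then show "chord (real ((n(t := q)) j) * (2 * \<alpha> * real ((n(t := q)) i))) \<le> \<epsilon>"
        using n(2) q(2) by (auto simp: less_Suc_eq)
    qed
  qed
qed auto

text \<open>Adding \<open>n k\<close> to a block sum \<open>S\<close> creates the cross term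
  \<open>2 \<alpha> S n k\<close>, which splits into at most \<open>t\<close> parts, each of
  \<open>chord\<close> at most \<epsilon>.\<close>

lemma chord_square_of_sum:
  fixes n :: "nat \<Rightarrow> nat"
  assumes orth: "\<And>j' i. j' < t \<Longrightarrow> i < j' \<Longrightarrow> chord (real (n j') * (2 * \<alpha> * real (n i))) \<le> \<epsilon>"
    and "j \<le> k" "k \<le> t" "\<epsilon> \<ge> 0"
  shows "chord (\<alpha> * (real (\<Sum>i=j..<k. n i))\<^sup>2 - (\<Sum>i=j..<k. \<alpha> * (real (n i))\<^sup>2)) \<le> real (k - j) * (real t * \<epsilon>)"
  using assms(2,3)
proof (induction rule: dec_induct)
  case (step k)
  let ?S = "real (\<Sum>i=j..<k. n i)"
  have "chord (real (n k) * (2 * \<alpha> * ?S)) = chord (\<Sum>i=j..<k. real (n k) * (2 * \<alpha> * real (n i)))"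
    by (simp add: sum_distrib_left)
  also have "\<dots> \<le> (\<Sum>i=j..<k. chord (real (n k) * (2 * \<alpha> * real (n i))))" by (rule chord_sum)
  also have "\<dots> \<le> (\<Sum>i=j..<k. \<epsilon>)" using step.prems by (intro sum_mono orth) auto
  also have "\<dots> \<le> real t * \<epsilon>" using step.prems \<open>\<epsilon> \<ge> 0\<close> by (auto intro!: mult_right_mono)
  finally have cross: "chord (real (n k) * (2 * \<alpha> * ?S)) \<le> real t * \<epsilon>" .
  have "\<alpha> * (real (\<Sum>i=j..<Suc k. n i))\<^sup>2 - (\<Sum>i=j..<Suc k. \<alpha> * (real (n i))\<^sup>2)
      = (\<alpha> * ?S\<^sup>2 - (\<Sum>i=j..<k. \<alpha> * (real (n i))\<^sup>2)) + real (n k) * (2 * \<alpha> * ?S)"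
    using step.hyps by (simp add: power2_eq_square algebra_simps del: of_nat_sum)
  also have "chord \<dots> \<le> real (k - j) * (real t * \<epsilon>) + real t * \<epsilon>"
    using chord_add cross step.IH step.prems by (meson Suc_leD add_mono order_trans)
  also have "\<dots> = real (Suc k - j) * (real t * \<epsilon>)"
    using step.hyps by (simp add: Suc_diff_le algebra_simps)
  finally show ?case .
qed simp

text \<open>Among the \<open>t + 1\<close> partial sums of \<open>\<alpha> (n i)^2\<close>, taken
  modulo 1 for all \<alpha> at once, two fall into the same one of at most \<open>t = m ^ R\<close>
  cells. Their difference is nearly \<open>\<alpha> q^2\<close> modulo 1 for the block sum
  \<open>q\<close>, because the cross terms are negligible.\<close>

lemma quadratic_recurrence:
  fixes \<epsilon> :: real
  assumes "\<epsilon> > 0"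
  shows "\<exists>H. \<forall>A::real set. finite A \<longrightarrow> card A \<le> R \<longrightarrow> (\<exists>q\<in>{1..H::nat}. \<forall>\<alpha>\<in>A. chord (\<alpha> * (real q)\<^sup>2) \<le> \<epsilon>)"
proof -
  obtain m :: nat where m: "4 * pi / \<epsilon> < real m" using reals_Archimedean2 by blast
  have "0 < 4 * pi / \<epsilon>" using assms by simp
  then have m0: "m > 0" using m by (intro Nat.gr0I) auto
  have m1: "2 * pi / real m \<le> \<epsilon> / 2" using m m0 assms by (simp add: field_simps)
  define t where "t = m ^ R"
  have t0: "t > 0" using m0 by (simp add: t_def)
  \<comment> \<open>At most \<open>t\<close> additions, each with at most \<open>t\<close> cross
    terms, may together cost \<open>\<epsilon>/2\<close>; the other half goes to the width of a
    cell.\<close>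
  define \<epsilon>' where "\<epsilon>' = \<epsilon> / (2 * (real t)\<^sup>2)"
  have e': "\<epsilon>' > 0" using assms t0 by (simp add: \<epsilon>'_def)
  obtain L where L: "\<And>A::real set. finite A \<Longrightarrow> card A \<le> R \<Longrightarrow>
    (\<exists>n::nat \<Rightarrow> nat. (\<forall>i<t. n i \<in> {1..L}) \<and>
      (\<forall>j<t. \<forall>i<j. \<forall>\<alpha>\<in>A. chord (real (n j) * (2 * \<alpha> * real (n i))) \<le> \<epsilon>'))"
    using almost_orthogonal_sequence[OF e', of R t] by blast
  have "\<exists>q\<in>{1..t * L}. \<forall>\<alpha>\<in>A. chord (\<alpha> * (real q)\<^sup>2) \<le> \<epsilon>"
    if A: "finite A" "card A \<le> R" for A :: "real set"
  proof -
    obtain n where n: "\<And>i. i < t \<Longrightarrow> n i \<in> {1..L}"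
      "\<And>j i \<alpha>. j < t \<Longrightarrow> i < j \<Longrightarrow> \<alpha> \<in> A \<Longrightarrow> chord (real (n j) * (2 * \<alpha> * real (n i))) \<le> \<epsilon>'"
      using L[OF A] by blast
    define P where "P k \<alpha> = (\<Sum>i=0..<k. \<alpha> * (real (n i))\<^sup>2)" for k \<alpha>
    define cell where "cell k = restrict (\<lambda>\<alpha>. nat \<lfloor>real m * frac (P k \<alpha>)\<rfloor>) A" for k
    have "cell ` {0..t} \<subseteq> A \<rightarrow>\<^sub>E {0..<m}"
    proof (clarsimp simp: cell_def)
      fix \<alpha> k
      have "real m * frac (P k \<alpha>) < real m * 1"
        using m0 frac_lt_1 by (intro mult_strict_left_mono) auto
      then show "nat \<lfloor>real m * frac (P k \<alpha>)\<rfloor> < m"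
        using m0 by (simp add: nat_less_iff floor_less_iff)
    qed
    then have "card (cell ` {0..t}) \<le> card (A \<rightarrow>\<^sub>E {0..<m})"
      using A by (intro card_mono finite_PiE) auto
    also have "\<dots> = m ^ card A" using A by (simp add: card_PiE)
    also have "\<dots> \<le> t" unfolding t_def using A m0 by (intro power_increasing) auto
    also have "\<dots> < card {0..t}" by simp
    finally have "\<not> inj_on cell {0..t}" by (rule pigeonhole)
    then obtain j k where jk: "j \<le> t" "k \<le> t" "j < k" "cell j = cell k"
      unfolding inj_on_def by (metis atLeastAtMost_iff linorder_neqE_nat)
    define q where "q = (\<Sum>i=j..<k. n i)"
    have "q \<le> (\<Sum>i=j..<k. L)" unfolding q_def using n(1) jk by (intro sum_mono) (simp add: less_le_trans)
    also have "\<dots> \<le> t * L" using jk by auto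
    finally have q_le: "q \<le> t * L" .
    have "n j \<le> q" unfolding q_def using jk by (intro member_le_sum) auto
    moreover have "n j \<ge> 1" using n(1)[of j] jk by auto
    ultimately have q_ge: "1 \<le> q" by linarith
    have "chord (\<alpha> * (real q)\<^sup>2) \<le> \<epsilon>" if \<alpha>: "\<alpha> \<in> A" for \<alpha>
    proof -
      have "nat \<lfloor>real m * frac (P j \<alpha>)\<rfloor> = nat \<lfloor>real m * frac (P k \<alpha>)\<rfloor>"
        using fun_cong[OF jk(4), of \<alpha>] \<alpha> by (simp add: cell_def)
      then have fl: "\<lfloor>real m * frac (P j \<alpha>)\<rfloor> = \<lfloor>real m * frac (P k \<alpha>)\<rfloor>"
        by (simp add: nat_eq_iff2)
      have "\<bar>real m * frac (P k \<alpha>) - real m * frac (P j \<alpha>)\<bar> \<le> 1"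
        using fl by linarith
      then have "real m * \<bar>frac (P k \<alpha>) - frac (P j \<alpha>)\<bar> \<le> 1"
        by (simp add: right_diff_distrib[symmetric] abs_mult)
      then have fr: "\<bar>frac (P k \<alpha>) - frac (P j \<alpha>)\<bar> \<le> 1 / real m"
        using m0 by (simp add: field_simps)
      have "P k \<alpha> - P j \<alpha> = (frac (P k \<alpha>) - frac (P j \<alpha>)) + of_int (\<lfloor>P k \<alpha>\<rfloor> - \<lfloor>P j \<alpha>\<rfloor>)"
        by (simp add: frac_def)
      then have "chord (P k \<alpha> - P j \<alpha>) = chord (frac (P k \<alpha>) - frac (P j \<alpha>))"
        by (metis chord_add_of_int)
      also have "\<dots> \<le> 2 * pi * \<bar>frac (P k \<alpha>) - frac (P j \<alpha>)\<bar>" by (rule chord_upper)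
      also have "\<dots> \<le> 2 * pi * (1 / real m)" using fr by (intro mult_left_mono) auto
      finally have c1: "chord (P k \<alpha> - P j \<alpha>) \<le> \<epsilon> / 2" using m1 by simp
      have Pdiff: "P k \<alpha> - P j \<alpha> = (\<Sum>i=j..<k. \<alpha> * (real (n i))\<^sup>2)"
        unfolding P_def using jk by (simp add: sum_diff_nat_ivl)
      have "chord (\<alpha> * (real q)\<^sup>2 - (P k \<alpha> - P j \<alpha>)) \<le> real (k - j) * (real t * \<epsilon>')"
        unfolding Pdiff q_def using n(2) \<alpha> jk e' by (intro chord_square_of_sum) auto
      also have "\<dots> \<le> real t * (real t * \<epsilon>')" using jk e' by (intro mult_right_mono) auto
      also have "\<dots> = \<epsilon> / 2" using t0 by (simp add: \<epsilon>'_def power2_eq_square)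
      finally have c2: "chord (\<alpha> * (real q)\<^sup>2 - (P k \<alpha> - P j \<alpha>)) \<le> \<epsilon> / 2" .
      show ?thesis using chord_add[of "\<alpha> * (real q)\<^sup>2 - (P k \<alpha> - P j \<alpha>)" "P k \<alpha> - P j \<alpha>"] c1 c2 by simp
    qed
    then show ?thesis using q_ge q_le by (intro bexI[of _ q]) auto
  qed
  then show ?thesis by blast
qed

text \<open>For each \<open>d \<le> Y/(H M)\<close>, recurrence for the frequencies
  \<open>\<alpha> d^2\<close> gives \<open>q \<le> H\<close>, and homogeneity at \<open>d q\<close>
  gives an element \<open>d q m\<close> of \<open>B\<close> with \<open>m \<le> M\<close>; the
  factor \<open>m^2\<close> is paid for by \<open>\<epsilon>' = \<epsilon>/M^2\<close>. As
  \<open>q\<close> and \<open>m\<close> determine \<open>d\<close> from the value, a value arises at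
  most \<open>H M\<close> times.\<close>

lemma homogeneous_bohr_density:
  fixes \<epsilon> :: real
  assumes "\<epsilon> > 0" "M > 0"
  shows "\<exists>c>0. \<exists>Y\<^sub>0. \<forall>Y\<ge>Y\<^sub>0. \<forall>B (A::real set). homogeneous M B \<longrightarrow> finite A \<longrightarrow> card A \<le> R \<longrightarrow>
    (\<exists>B'\<subseteq>{1..Y}. int ` B' \<subseteq> B \<and> c * real Y \<le> real (card B') \<and>
      (\<forall>\<alpha>\<in>A. \<forall>y\<in>B'. chord (\<alpha> * (real y)\<^sup>2) \<le> \<epsilon>))"
proof -
  define \<epsilon>' where "\<epsilon>' = \<epsilon> / (real M)\<^sup>2"
  have e': "\<epsilon>' > 0" using assms by (simp add: \<epsilon>'_def)
  obtain H where H: "\<And>A::real set. finite A \<Longrightarrow> card A \<le> R \<Longrightarrow>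
      (\<exists>q\<in>{1..H::nat}. \<forall>\<alpha>\<in>A. chord (\<alpha> * (real q)\<^sup>2) \<le> \<epsilon>')"
    using quadratic_recurrence[OF e', of R] by blast
  have H0: "H > 0" using H[of "{}"] by auto
  \<comment> \<open>One factor \<open>H M\<close> is lost in the range of \<open>d\<close>, another
    to coincidences among the values \<open>d q m\<close>; the 2 comes from rounding.\<close>
  define c where "c = 1 / (2 * (real (H * M))\<^sup>2)"
  have c: "c > 0" using H0 assms by (simp add: c_def)
  show ?thesis
  proof (intro exI[of _ c] conjI c exI[of _ "H * M"] allI impI)
    fix Y B and A :: "real set"
    assume Y: "H * M \<le> Y" and B: "homogeneous M B" and A: "finite A" "card A \<le> R"
    define D where "D = Y div (H * M)"
    have HM: "H * M > 0" using H0 assms by simp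
    have D1: "D \<ge> 1" using Y HM by (simp add: D_def div_greater_zero_iff Suc_le_eq)
    have "Y = D * (H * M) + Y mod (H * M)" unfolding D_def by (rule div_mult_mod_eq[symmetric])
    moreover have "Y mod (H * M) < H * M" using HM by simp
    moreover have "H * M \<le> D * (H * M)" using D1 by simp
    ultimately have "Y \<le> 2 * (D * (H * M))" by linarith
    then have "real Y \<le> real (2 * (D * (H * M)))" by (simp only: of_nat_le_iff)
    then have D2: "real Y / (2 * real (H * M)) \<le> real D" using HM by (simp add: field_simps)
    have ex: "\<exists>q m. q \<in> {1..H} \<and> m \<in> {1..M} \<and> (\<forall>\<alpha>\<in>A. chord (\<alpha> * (real d)\<^sup>2 * (real q)\<^sup>2) \<le> \<epsilon>')
        \<and> int (d * q * m) \<in> B" if d: "d \<in> {1..D}" for d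
    proof -
      let ?A' = "(\<lambda>\<alpha>. \<alpha> * (real d)\<^sup>2) ` A"
      have "card ?A' \<le> R" using A card_image_le[OF A(1), of "\<lambda>\<alpha>. \<alpha> * (real d)\<^sup>2"] by linarith
      then obtain q where q: "q \<in> {1..H}" "\<forall>\<alpha>\<in>?A'. chord (\<alpha> * (real q)\<^sup>2) \<le> \<epsilon>'"
        using H[of ?A'] A by blast
      have "d * q \<ge> 1" using q d by simp
      then obtain m where m: "m \<in> bracket (real M)" "int (d * q) * m \<in> B"
        using B unfolding homogeneous_def by blast
      then have "nat m \<in> {1..M}" "int (d * q * nat m) = int (d * q) * m" by (auto simp: bracket_def)
      then show ?thesis using q m by (metis (no_types, lifting) image_eqI)
    qed
    define sel where "sel d = (SOME p. fst p \<in> {1..H} \<and> snd p \<in> {1..M}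
        \<and> (\<forall>\<alpha>\<in>A. chord (\<alpha> * (real d)\<^sup>2 * (real (fst p))\<^sup>2) \<le> \<epsilon>') \<and> int (d * fst p * snd p) \<in> B)" for d
    have sel: "fst (sel d) \<in> {1..H}" "snd (sel d) \<in> {1..M}"
      "\<And>\<alpha>. \<alpha> \<in> A \<Longrightarrow> chord (\<alpha> * (real d)\<^sup>2 * (real (fst (sel d)))\<^sup>2) \<le> \<epsilon>'"
      "int (d * fst (sel d) * snd (sel d)) \<in> B" if d: "d \<in> {1..D}" for d
    proof -
      have "\<exists>p. fst p \<in> {1..H} \<and> snd p \<in> {1..M}
        \<and> (\<forall>\<alpha>\<in>A. chord (\<alpha> * (real d)\<^sup>2 * (real (fst p))\<^sup>2) \<le> \<epsilon>') \<and> int (d * fst p * snd p) \<in> B"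
        using ex[OF d] by simp
      then have "fst (sel d) \<in> {1..H} \<and> snd (sel d) \<in> {1..M}
        \<and> (\<forall>\<alpha>\<in>A. chord (\<alpha> * (real d)\<^sup>2 * (real (fst (sel d)))\<^sup>2) \<le> \<epsilon>') \<and> int (d * fst (sel d) * snd (sel d)) \<in> B"
        unfolding sel_def by (rule someI_ex)
      then show "fst (sel d) \<in> {1..H}" "snd (sel d) \<in> {1..M}"
      "\<And>\<alpha>. \<alpha> \<in> A \<Longrightarrow> chord (\<alpha> * (real d)\<^sup>2 * (real (fst (sel d)))\<^sup>2) \<le> \<epsilon>'"
      "int (d * fst (sel d) * snd (sel d)) \<in> B" by auto
    qed
    define y where "y d = d * fst (sel d) * snd (sel d)" for d
    define B' where "B' = y ` {1..D}"
    have y_range: "y d \<in> {1..Y}" if d: "d \<in> {1..D}" for d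
    proof -
      have "y d \<le> D * H * M" unfolding y_def using sel(1,2)[OF d] d by (intro mult_mono) auto
      also have "\<dots> \<le> Y" unfolding D_def by (metis div_times_less_eq_dividend mult.assoc)
      finally show ?thesis using sel(1,2)[OF d] d by (simp add: y_def)
    qed
    have "inj_on (\<lambda>d. (y d, sel d)) {1..D}"
    proof (rule inj_onI)
      fix d d' assume dd: "d \<in> {1..D}" "d' \<in> {1..D}" "(y d, sel d) = (y d', sel d')"
      then have "d * (fst (sel d) * snd (sel d)) = d' * (fst (sel d) * snd (sel d))"
        unfolding y_def by (metis Pair_inject mult.assoc)
      moreover have "fst (sel d) * snd (sel d) > 0" using sel(1,2)[OF dd(1)] by simp
      ultimately show "d = d'" by simp
    qed
    then have "card {1..D} = card ((\<lambda>d. (y d, sel d)) ` {1..D})" by (rule card_image[symmetric])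
    also have "\<dots> \<le> card (B' \<times> ({1..H} \<times> {1..M}))"
    proof (intro card_mono)
      show "(\<lambda>d. (y d, sel d)) ` {1..D} \<subseteq> B' \<times> {1..H} \<times> {1..M}"
      proof
        fix p assume "p \<in> (\<lambda>d. (y d, sel d)) ` {1..D}"
        then obtain d where d: "d \<in> {1..D}" "p = (y d, sel d)" by auto
        then show "p \<in> B' \<times> {1..H} \<times> {1..M}"
          using sel(1,2)[OF d(1)] by (simp add: B'_def mem_Times_iff)
      qed
    qed (auto simp: B'_def)
    also have "\<dots> = card B' * (H * M)" by (simp add: card_cartesian_product)
    finally have "D \<le> card B' * (H * M)" by simp
    then have "real D \<le> real (card B') * real (H * M)" by (metis of_nat_le_iff of_nat_mult)
    then have "real Y / (2 * real (H * M)) \<le> real (card B') * real (H * M)" using D2 by linarith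
    then have card: "c * real Y \<le> real (card B')"
      using HM by (simp add: c_def field_simps power2_eq_square)
    show "\<exists>B'\<subseteq>{1..Y}. int ` B' \<subseteq> B \<and> c * real Y \<le> real (card B') \<and>
      (\<forall>\<alpha>\<in>A. \<forall>y\<in>B'. chord (\<alpha> * (real y)\<^sup>2) \<le> \<epsilon>)"
    proof (intro exI[of _ B'] conjI ballI card)
      show "B' \<subseteq> {1..Y}" using y_range by (auto simp: B'_def)
      show "int ` B' \<subseteq> B" using sel(4) by (auto simp: B'_def y_def)
      fix \<alpha> z assume \<alpha>: "\<alpha> \<in> A" and "z \<in> B'"
      then obtain d where d: "d \<in> {1..D}" "z = y d" by (auto simp: B'_def)
      let ?q = "fst (sel d)" and ?m = "snd (sel d)"
      have "chord (\<alpha> * (real z)\<^sup>2) = chord (real (?m\<^sup>2) * (\<alpha> * (real d)\<^sup>2 * (real ?q)\<^sup>2))"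
        by (simp add: d y_def power_mult_distrib mult_ac)
      also have "\<dots> \<le> real (?m\<^sup>2) * chord (\<alpha> * (real d)\<^sup>2 * (real ?q)\<^sup>2)" by (rule chord_mult_of_nat)
      also have "\<dots> \<le> (real M)\<^sup>2 * \<epsilon>'"
        using sel[OF d(1)] \<alpha> by (intro mult_mono) (auto intro: power_mono)
      also have "\<dots> = \<epsilon>" using assms by (simp add: \<epsilon>'_def)
      finally show "chord (\<alpha> * (real z)\<^sup>2) \<le> \<epsilon>" .
    qed
  qed
qed

section \<open>The counting problem on a grid\<close>

definition trig_sum :: "(int \<Rightarrow> real) \<Rightarrow> nat \<Rightarrow> real \<Rightarrow> complex" where
  "trig_sum f n \<alpha> = (\<Sum>x=1..int n. of_real (f x) * add_char (\<alpha> * of_int x))"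

section \<open>Infinite sums and integrals as finite sums\<close>

lemma infsum_eq_sum_of_support:
  fixes f :: "'a \<Rightarrow> 'b::{comm_monoid_add,t2_space}"
  assumes "finite F" "\<And>x. x \<notin> F \<Longrightarrow> f x = 0"
  shows "(\<Sum>\<^sub>\<infinity>x. f x) = sum f F"
proof -
  have "(\<Sum>\<^sub>\<infinity>x. f x) = (\<Sum>\<^sub>\<infinity>x\<in>F. f x)" by (rule infsum_cong_neutral) (use assms in auto)
  then show ?thesis using assms(1) by simp
qed

lemma fourier_eq_trig_sum:
  assumes "\<And>x. x \<notin> {1..int n} \<Longrightarrow> f x = 0"
  shows "fourier (\<lambda>x. of_real (f x)) \<alpha> = trig_sum f n \<alpha>"
  unfolding fourier_def trig_sum_def by (rule infsum_eq_sum_of_support) (use assms in auto)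

lemma l1_norm_eq_sum:
  fixes f :: "int \<Rightarrow> real"
  assumes "\<And>x. x \<notin> {1..int n} \<Longrightarrow> f x = 0" "\<And>x. f x \<ge> 0"
  shows "l1_norm f = (\<Sum>x=1..int n. f x)"
proof -
  have "l1_norm f = (\<Sum>x=1..int n. norm (f x))"
    unfolding l1_norm_def by (rule infsum_eq_sum_of_support) (use assms in auto)
  then show ?thesis using assms(2) by simp
qed

lemma cmod_trig_sum_le:
  assumes "\<And>x. 0 \<le> f x" "\<And>x. f x \<le> \<nu> x"
  shows "cmod (trig_sum f n \<alpha>) \<le> (\<Sum>x=1..int n. \<nu> x)"
  unfolding trig_sum_def using assms by (intro sum_norm_le) (simp add: norm_mult)

lemma continuous_on_trig_sum: "continuous_on S (trig_sum f n)"
  unfolding trig_sum_def add_char_def by (intro continuous_intros)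

text \<open>The grid sums, averaged over translates in \<open>[0, 1/G]\<close>, equal
  \<open>G\<close> times the integral, and the minimum is at most the average.\<close>

lemma exists_grid_translate:
  fixes F :: "real \<Rightarrow> real"
  assumes G: "G > 0" and cont: "continuous_on UNIV F"
    and int: "(LBINT \<alpha>:{0..1}. F \<alpha>) \<le> C"
  shows "\<exists>t. 0 \<le> t \<and> t \<le> 1 / real G \<and> (\<Sum>j<G. F (t + real j / real G)) \<le> real G * C"
proof -
  define h where "h = 1 / real G"
  have h: "h > 0" using G by (simp add: h_def)
  have co: "continuous_on S F" for S using cont continuous_on_subset by blast
  have intg: "F integrable_on {a..b}" for a b using co by (rule integrable_continuous_interval)
  have "set_integrable lborel {0..1} F" by (intro borel_integrable_atLeastAtMost' co)
  then have lb: "(LBINT \<alpha>:{0..1}. F \<alpha>) = integral {0..1} F" by (rule set_borel_integral_eq_integral(2))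
  have pieces: "integral {0..real m * h} F = (\<Sum>j<m. integral {0..h} (\<lambda>t. F (t + real j * h)))" for m
  proof (induction m)
    case (Suc m)
    have "integral {0..real (Suc m) * h} F = integral {0..real m * h} F + integral {real m * h..real (Suc m) * h} F"
      using h intg by (intro Henstock_Kurzweil_Integration.integral_combine[symmetric]) (auto simp: algebra_simps)
    also have "integral {real m * h..real (Suc m) * h} F = integral {0..h} (\<lambda>t. F (t + real m * h))"
      using integral_shift_real_ivl[of "real m * h" "real m * h" "real (Suc m) * h" F]
      by (simp add: algebra_simps)
    finally show ?case using Suc by simp
  qed simp
  define H where "H t = (\<Sum>j<G. F (t + real j * h))" for t
  have Hc: "continuous_on {0..h} H" unfolding H_def
    by (intro continuous_on_sum continuous_on_compose2[OF cont] continuous_intros) auto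
  obtain t where t: "t \<in> {0..h}" "\<And>s. s \<in> {0..h} \<Longrightarrow> H t \<le> H s"
    using continuous_attains_inf[OF _ _ Hc] h by auto
  have "h * H t = integral {0..h} (\<lambda>_. H t)" using h by simp
  also have "\<dots> \<le> integral {0..h} H"
    using t Hc by (intro integral_le integrable_continuous_interval) auto
  also have "\<dots> = (\<Sum>j<G. integral {0..h} (\<lambda>t. F (t + real j * h)))" unfolding H_def
    by (intro integral_sum integrable_continuous_interval continuous_on_compose2[OF cont] continuous_intros) auto
  also have "\<dots> = integral {0..1} F" using pieces[of G] G by (simp add: h_def)
  also have "\<dots> \<le> C" using int lb by simp
  finally have "H t \<le> real G * C" using G by (simp add: h_def field_simps)
  then show ?thesis using t(1) by (intro exI[of _ t]) (auto simp: H_def h_def)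
qed

lemma restriction_grid:
  assumes G: "G > 0" and supp: "\<And>x. x \<notin> {1..int n} \<Longrightarrow> f x = 0"
    and f: "\<And>x. 0 \<le> f x" "\<And>x. f x \<le> \<nu> x" and p: "p > 0"
    and res: "restriction_estimate N p K \<nu>"
  shows "\<exists>t. 0 \<le> t \<and> t \<le> 1 / real G \<and>
    (\<Sum>j<G. cmod (trig_sum f n (t + real j / real G)) powr p) \<le> real G * (K * l1_norm \<nu> powr p / N)"
proof (rule exists_grid_translate[OF G])
  show "continuous_on UNIV (\<lambda>\<alpha>. cmod (trig_sum f n \<alpha>) powr p)"
    using p by (intro continuous_on_powr' continuous_on_norm continuous_on_trig_sum continuous_on_const) auto
  have "\<forall>x. cmod (complex_of_real (f x)) \<le> \<nu> x" using f by simp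
  then have "(LBINT \<alpha>:{0..1}. cmod (fourier (\<lambda>x. of_real (f x)) \<alpha>) powr p) \<le> K * l1_norm \<nu> powr p / N"
    using res unfolding restriction_estimate_def by (elim allE[of _ "\<lambda>x. complex_of_real (f x)"] mp)
  moreover have "fourier (\<lambda>x. of_real (f x)) \<alpha> = trig_sum f n \<alpha>" for \<alpha>
    by (rule fourier_eq_trig_sum) (rule supp)
  ultimately show "(LBINT \<alpha>:{0..1}. cmod (trig_sum f n \<alpha>) powr p) \<le> K * l1_norm \<nu> powr p / N"
    by simp
qed

text \<open>As \<open>B\<close> is positive, each \<open>y_i\<close> is at most its square and hence
  at most \<open>n\<close>. So the terms have finite support and are summable; being nonnegative,
  any finite part of them bounds the infinite sum from below.\<close>

lemma T1_ge_sum: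
  fixes f :: "int \<Rightarrow> real"
  assumes supp: "\<And>x. x \<notin> {1..int n} \<Longrightarrow> f x = 0" and f: "\<And>x. 0 \<le> f x" and B: "B \<subseteq> {0<..}"
    and B': "finite B'" "int ` B' \<subseteq> B"
  shows "(\<Sum>p\<in>{1..int n} \<times> {1..int n}. \<Sum>w\<in>B' \<times> B' \<times> B'.
      if fst p - snd p = int ((fst w)\<^sup>2 + (fst (snd w))\<^sup>2 + (snd (snd w))\<^sup>2) then f (fst p) * f (snd p) else 0)
    \<le> T\<^sub>1 f B"
proof -
  define S where "S = {(x1::int, x2, y1, y2, y3). x1 - x2 = y1\<^sup>2 + y2\<^sup>2 + y3\<^sup>2}"
  define g where "g = (\<lambda>(x1, x2, y1, y2, y3). f x1 * f x2 * indicator B y1 * indicator B y2 * indicator B y3 :: real)"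
  have T: "T\<^sub>1 f B = infsum g S" by (simp add: T\<^sub>1_def g_def S_def)
  have g_nonneg: "g z \<ge> 0" for z using f by (auto simp: g_def split: prod.split)
  let ?I = "{1..int n}"
  have "g summable_on S"
  proof (rule finite_nonzero_values_imp_summable_on)
    have "{z \<in> S. g z \<noteq> 0} \<subseteq> ?I \<times> ?I \<times> ?I \<times> ?I \<times> ?I"
    proof
      fix z assume z: "z \<in> {z \<in> S. g z \<noteq> 0}"
      obtain x1 x2 y1 y2 y3 where z': "z = (x1, x2, y1, y2, y3)" by (metis surj_pair)
      have x: "x1 \<in> ?I" "x2 \<in> ?I" using z supp by (auto simp: z' g_def)
      have y: "y1 \<in> B" "y2 \<in> B" "y3 \<in> B" using z by (auto simp: z' g_def indicator_def split: if_splits)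
      have pos: "y1 \<ge> 1" "y2 \<ge> 1" "y3 \<ge> 1" using y B by auto
      have eq: "x1 - x2 = y1\<^sup>2 + y2\<^sup>2 + y3\<^sup>2" using z by (auto simp: z' S_def)
      have "y1 \<le> y1\<^sup>2" "y2 \<le> y2\<^sup>2" "y3 \<le> y3\<^sup>2" using pos by (auto intro: self_le_power)
      then have "y1 \<le> int n" "y2 \<le> int n" "y3 \<le> int n" using eq x pos by auto
      then show "z \<in> ?I \<times> ?I \<times> ?I \<times> ?I \<times> ?I" using x pos by (simp add: z')
    qed
    then show "finite {z \<in> S. g z \<noteq> 0}" by (rule finite_subset) simp
  qed
  let ?s = "\<lambda>w. (fst w)\<^sup>2 + (fst (snd w))\<^sup>2 + (snd (snd w))\<^sup>2 :: nat"
  let ?W = "B' \<times> B' \<times> B'"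
  define Z where "Z = {z \<in> (?I \<times> ?I) \<times> ?W. fst (fst z) - snd (fst z) = int (?s (snd z))}"
  define \<iota> where "\<iota> z = (fst (fst z), snd (fst z), int (fst (snd z)), int (fst (snd (snd z))), int (snd (snd (snd z))))"
    for z :: "(int \<times> int) \<times> nat \<times> nat \<times> nat"
  have inj: "inj_on \<iota> Z" by (rule inj_onI) (simp add: \<iota>_def prod_eq_iff)
  have finZ: "finite Z" unfolding Z_def using B' by (intro finite_subset[OF Collect_restrict]) auto
  have "(\<Sum>p\<in>?I \<times> ?I. \<Sum>w\<in>?W. if fst p - snd p = int (?s w) then f (fst p) * f (snd p) else 0)
      = (\<Sum>z\<in>(?I \<times> ?I) \<times> ?W. if fst (fst z) - snd (fst z) = int (?s (snd z)) then f (fst (fst z)) * f (snd (fst z)) else 0)"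
    by (simp only: sum.cartesian_product case_prod_unfold)
  also have "\<dots> = (\<Sum>z\<in>Z. f (fst (fst z)) * f (snd (fst z)))"
    unfolding Z_def using B' by (intro sum.inter_filter[symmetric]) auto
  also have "\<dots> = (\<Sum>z\<in>Z. g (\<iota> z))"
  proof (intro sum.cong refl)
    fix z assume "z \<in> Z"
    then have "int (fst (snd z)) \<in> B" "int (fst (snd (snd z))) \<in> B" "int (snd (snd (snd z))) \<in> B"
      using B'(2) by (auto simp: Z_def)
    then show "f (fst (fst z)) * f (snd (fst z)) = g (\<iota> z)" by (simp add: g_def \<iota>_def)
  qed
  also have "\<dots> = sum g (\<iota> ` Z)" using inj by (simp add: sum.reindex)
  also have "\<dots> \<le> infsum g S"
    using \<open>g summable_on S\<close> finZ g_nonneg by (intro finite_sum_le_infsum) (auto simp: Z_def \<iota>_def S_def)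
  finally show ?thesis by (simp only: T)
qed

text \<open>The difference of the two sides of the equation has absolute value less than
  \<open>4 n \<le> G\<close>, so vanishing modulo \<open>G\<close> is the same as vanishing; the
  translate \<open>t\<close> contributes only a factor that is 1 when the difference is 0.\<close>

lemma T1_ge_grid_sum:
  fixes f :: "int \<Rightarrow> real" and t :: real
  assumes supp: "\<And>x. x \<notin> {1..int n} \<Longrightarrow> f x = 0" and f: "\<And>x. 0 \<le> f x" and B: "B \<subseteq> {0<..}"
    and B': "B' \<subseteq> {1..Y}" "int ` B' \<subseteq> B" and Y: "Y\<^sup>2 \<le> n" and G: "4 * n \<le> G" "G > 0"
  defines "\<alpha> \<equiv> \<lambda>j. t + real j / real G"
  shows "(\<Sum>j<G. (cmod (trig_sum f n (\<alpha> j)))\<^sup>2 * Re ((\<Sum>y\<in>B'. add_char (\<alpha> j * (real y)\<^sup>2)) ^ 3)) \<le> real G * T\<^sub>1 f B"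
proof -
  have finB: "finite B'" using B'(1) finite_subset by blast
  let ?I = "{1..int n}"
  let ?W = "B' \<times> B' \<times> B'"
  let ?s = "\<lambda>w. (fst w)\<^sup>2 + (fst (snd w))\<^sup>2 + (snd (snd w))\<^sup>2 :: nat"
  let ?S = "\<lambda>j. \<Sum>y\<in>B'. add_char (\<alpha> j * (real y)\<^sup>2)"
  have cube: "cnj (?S j) ^ 3 = (\<Sum>w\<in>?W. add_char (- (\<alpha> j * real (?s w))))" for j
  proof -
    have "cnj (?S j) ^ 3 = (\<Sum>y\<in>B'. add_char (- (\<alpha> j * (real y)\<^sup>2))) *
        ((\<Sum>y\<in>B'. add_char (- (\<alpha> j * (real y)\<^sup>2))) * (\<Sum>y\<in>B'. add_char (- (\<alpha> j * (real y)\<^sup>2))))"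
      by (simp add: power3_eq_cube cnj_add_char mult.assoc)
    also have "\<dots> = (\<Sum>w\<in>?W. add_char (- (\<alpha> j * (real (fst w))\<^sup>2)) *
        (add_char (- (\<alpha> j * (real (fst (snd w)))\<^sup>2)) * add_char (- (\<alpha> j * (real (snd (snd w)))\<^sup>2))))"
      by (simp only: sum_product sum.cartesian_product case_prod_unfold)
    also have "\<dots> = (\<Sum>w\<in>?W. add_char (- (\<alpha> j * real (?s w))))"
      by (intro sum.cong refl) (simp add: add_char_add[symmetric] algebra_simps)
    finally show ?thesis .
  qed
  have sq: "complex_of_real ((cmod (trig_sum f n (\<alpha> j)))\<^sup>2)
      = (\<Sum>p\<in>?I \<times> ?I. of_real (f (fst p) * f (snd p)) * add_char (\<alpha> j * of_int (fst p - snd p)))" for j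
    unfolding trig_sum_def norm_sum_add_char_squared sum.cartesian_product case_prod_unfold
    by (simp add: right_diff_distrib)
  have orth: "(\<Sum>j<G. add_char (\<alpha> j * of_int m)) = (if m = 0 then of_nat G else 0)" if m: "\<bar>m\<bar> < int G" for m
  proof -
    have "(\<Sum>j<G. add_char (\<alpha> j * of_int m)) = add_char (t * of_int m) * (\<Sum>j<G. add_char (of_int m * of_nat j / of_nat G))"
      unfolding sum_distrib_left \<alpha>_def
      by (intro sum.cong refl) (simp add: add_char_add[symmetric] algebra_simps)
    moreover have "int G dvd m \<longleftrightarrow> m = 0" using m dvd_imp_le_int[of m "int G"] by force
    ultimately show ?thesis unfolding add_char_orthogonality[OF G(2)] by simp
  qed
  have "complex_of_real (real G * (\<Sum>p\<in>?I \<times> ?I. \<Sum>w\<in>?W. if fst p - snd p = int (?s w) then f (fst p) * f (snd p) else 0))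
    = (\<Sum>p\<in>?I \<times> ?I. \<Sum>w\<in>?W. of_real (f (fst p) * f (snd p)) * (if fst p - snd p - int (?s w) = 0 then of_nat G else 0))"
    unfolding sum_distrib_left of_real_sum by (intro sum.cong refl) simp
  also have "\<dots> = (\<Sum>p\<in>?I \<times> ?I. \<Sum>w\<in>?W. of_real (f (fst p) * f (snd p)) *
      (\<Sum>j<G. add_char (\<alpha> j * of_int (fst p - snd p - int (?s w)))))"
  proof (intro sum.cong refl arg_cong2[where f = "(*)"] orth[symmetric])
    fix p w assume p: "p \<in> ?I \<times> ?I" and w: "w \<in> ?W"
    have sq_le: "y\<^sup>2 \<le> n" if "y \<in> B'" for y
    proof -
      have "y\<^sup>2 \<le> Y\<^sup>2" using B'(1) that by (intro power_mono) auto
      then show ?thesis using Y by linarith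
    qed
    have "(fst w)\<^sup>2 \<le> n" "(fst (snd w))\<^sup>2 \<le> n" "(snd (snd w))\<^sup>2 \<le> n" using w by (auto intro: sq_le)
    then have "?s w \<le> 3 * n" by linarith
    moreover have "1 \<le> fst p" "fst p \<le> int n" "1 \<le> snd p" "snd p \<le> int n" using p by auto
    ultimately show "\<bar>fst p - snd p - int (?s w)\<bar> < int G" using G by linarith
  qed
  also have "\<dots> = (\<Sum>p\<in>?I \<times> ?I. \<Sum>w\<in>?W. \<Sum>j<G. (of_real (f (fst p) * f (snd p)) * add_char (\<alpha> j * of_int (fst p - snd p)))
      * add_char (- (\<alpha> j * real (?s w))))"
  proof -
    have "add_char (\<alpha> j * of_int (d - int m)) = add_char (\<alpha> j * of_int d) * add_char (- (\<alpha> j * real m))" for j d m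
      by (simp add: add_char_add[symmetric] algebra_simps)
    then show ?thesis by (simp only: sum_distrib_left mult.assoc)
  qed
  also have "\<dots> = (\<Sum>j<G. \<Sum>p\<in>?I \<times> ?I. \<Sum>w\<in>?W. (of_real (f (fst p) * f (snd p)) * add_char (\<alpha> j * of_int (fst p - snd p)))
      * add_char (- (\<alpha> j * real (?s w))))"
  proof -
    have "(\<Sum>p\<in>P. \<Sum>w\<in>W. \<Sum>j\<in>J. h p w j) = (\<Sum>j\<in>J. \<Sum>p\<in>P. \<Sum>w\<in>W. h p w j)"
      for P :: "(int \<times> int) set" and W :: "(nat \<times> nat \<times> nat) set" and J :: "nat set" and h :: "_ \<Rightarrow> _ \<Rightarrow> _ \<Rightarrow> complex"
      by (subst (2) sum.swap, rule sum.cong[OF refl], rule sum.swap)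
    then show ?thesis .
  qed
  also have "\<dots> = (\<Sum>j<G. complex_of_real ((cmod (trig_sum f n (\<alpha> j)))\<^sup>2) * cnj (?S j) ^ 3)"
    unfolding sq cube sum_product ..
  finally have "complex_of_real (real G * (\<Sum>p\<in>?I \<times> ?I. \<Sum>w\<in>?W. if fst p - snd p = int (?s w) then f (fst p) * f (snd p) else 0))
      = (\<Sum>j<G. complex_of_real ((cmod (trig_sum f n (\<alpha> j)))\<^sup>2) * cnj (?S j) ^ 3)" .
  from arg_cong[OF this, of Re]
  have "real G * (\<Sum>p\<in>?I \<times> ?I. \<Sum>w\<in>?W. if fst p - snd p = int (?s w) then f (fst p) * f (snd p) else 0)
      = Re (\<Sum>j<G. complex_of_real ((cmod (trig_sum f n (\<alpha> j)))\<^sup>2) * cnj (?S j) ^ 3)"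
    unfolding Re_complex_of_real .
  also have "\<dots> = (\<Sum>j<G. (cmod (trig_sum f n (\<alpha> j)))\<^sup>2 * Re (?S j ^ 3))"
    by (simp only: Re_sum complex_cnj_power[symmetric]) (simp del: cnj_sum complex_cnj_power)
  finally have "real G * (\<Sum>p\<in>?I \<times> ?I. \<Sum>w\<in>?W. if fst p - snd p = int (?s w) then f (fst p) * f (snd p) else 0)
      = (\<Sum>j<G. (cmod (trig_sum f n (\<alpha> j)))\<^sup>2 * Re (?S j ^ 3))" .
  moreover have "real G * (\<Sum>p\<in>?I \<times> ?I. \<Sum>w\<in>?W. if fst p - snd p = int (?s w) then f (fst p) * f (snd p) else 0)
      \<le> real G * T\<^sub>1 f B"
    by (intro mult_left_mono T1_ge_sum supp f B finB B'(2)) auto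
  ultimately show ?thesis by simp
qed

lemma T1_nonneg:
  fixes f :: "int \<Rightarrow> real"
  assumes "\<And>x. 0 \<le> f x"
  shows "0 \<le> T\<^sub>1 f B"
  unfolding T\<^sub>1_def using assms by (intro infsum_nonneg) (auto split: prod.split)

text \<open>Duality: \<open>E\<close> is the pairing of \<open>f\<close> with \<open>h\<close>, and
  Cauchy-Schwarz with weight \<nu> leads to the second moment of \<open>h\<close> against \<nu>.
  Fourier decay replaces \<nu> by the constant density \<open>V/n\<close> at cost
  \<open>\<theta> |A|^2 V^3\<close>, after which Parseval gives \<open>(G/n) V E\<close>. The
  resulting \<open>E^2 \<le> 34 V^2 E + V^4\<close> bounds \<open>E\<close> independently of the
  size of \<open>A\<close>.\<close>

lemma spectrum_energy_le:
  fixes f \<nu> :: "int \<Rightarrow> real" and t :: real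
  assumes f: "\<And>x. 0 \<le> f x" "\<And>x. f x \<le> \<nu> x" and V: "V = (\<Sum>x=1..int n. \<nu> x)" "V > 0"
    and decay: "\<And>\<alpha>. cmod (trig_sum \<nu> n \<alpha> / of_real V - trig_sum (\<lambda>_. 1) n \<alpha> / of_nat n) \<le> \<theta>"
    and n: "n > 0" "n < G" "G \<le> 34 * n" and A: "A \<subseteq> {..<G}" "\<theta> * (real (card A))\<^sup>2 \<le> 1"
  defines "\<alpha> \<equiv> \<lambda>j. t + real j / real G"
  shows "(\<Sum>j\<in>A. (cmod (trig_sum f n (\<alpha> j)))\<^sup>2) \<le> 35 * V\<^sup>2"
proof -
  have finA: "finite A" using A finite_subset by blast
  let ?I = "{1..int n}"
  define F where "F j = trig_sum f n (\<alpha> j)" for j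
  define E where "E = (\<Sum>j\<in>A. (cmod (F j))\<^sup>2)"
  define h where "h x = (\<Sum>j\<in>A. cnj (F j) * add_char (\<alpha> j * of_int x))" for x :: int
  have E0: "E \<ge> 0" by (simp add: E_def sum_nonneg)
  have \<theta>0: "\<theta> \<ge> 0" using decay[of 0] norm_ge_zero order_trans by blast
  have nu: "0 \<le> \<nu> x" for x using f order_trans by blast
  have "complex_of_real E = (\<Sum>j\<in>A. cnj (F j) * F j)"
    unfolding E_def of_real_sum complex_norm_square by (simp add: mult.commute)
  also have "\<dots> = (\<Sum>x\<in>?I. of_real (f x) * h x)"
    unfolding F_def[of "_ :: nat"] h_def
    by (subst trig_sum_def, simp only: sum_distrib_left) (subst sum.swap, simp add: mult_ac)
  finally have "E \<le> cmod (\<Sum>x\<in>?I. of_real (f x) * h x)" by (rule of_real_eq_imp_le_norm)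
  also have "\<dots> \<le> (\<Sum>x\<in>?I. sqrt (\<nu> x) * (sqrt (\<nu> x) * cmod (h x)))"
    using f nu by (intro sum_norm_le) (simp add: norm_mult mult_right_mono mult.assoc[symmetric])
  finally have "E\<^sup>2 \<le> (\<Sum>x\<in>?I. sqrt (\<nu> x) * (sqrt (\<nu> x) * cmod (h x)))\<^sup>2" using E0 by (intro power_mono)
  also have "\<dots> \<le> (\<Sum>x\<in>?I. (sqrt (\<nu> x))\<^sup>2) * (\<Sum>x\<in>?I. (sqrt (\<nu> x) * cmod (h x))\<^sup>2)" by (rule Cauchy_Schwarz_ineq_sum)
  also have "\<dots> = V * (\<Sum>x\<in>?I. \<nu> x * (cmod (h x))\<^sup>2)" using nu by (simp add: V power_mult_distrib)
  finally have E2: "E\<^sup>2 \<le> V * (\<Sum>x\<in>?I. \<nu> x * (cmod (h x))\<^sup>2)" .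
  have expand: "complex_of_real (\<Sum>x\<in>?I. w x * (cmod (h x))\<^sup>2)
      = (\<Sum>j\<in>A. \<Sum>k\<in>A. cnj (F j) * F k * trig_sum w n (\<alpha> j - \<alpha> k))" for w :: "int \<Rightarrow> real"
  proof -
    have "complex_of_real (\<Sum>x\<in>?I. w x * (cmod (h x))\<^sup>2)
        = (\<Sum>x\<in>?I. of_real (w x) * (\<Sum>j\<in>A. \<Sum>k\<in>A. cnj (F j) * cnj (cnj (F k)) * add_char (\<alpha> j * of_int x - \<alpha> k * of_int x)))"
      by (simp only: of_real_sum of_real_mult h_def norm_sum_add_char_squared)
    also have "\<dots> = (\<Sum>x\<in>?I. \<Sum>j\<in>A. \<Sum>k\<in>A. cnj (F j) * F k * (of_real (w x) * add_char ((\<alpha> j - \<alpha> k) * of_int x)))"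
      by (simp add: sum_distrib_left left_diff_distrib right_diff_distrib mult_ac)
    also have "\<dots> = (\<Sum>j\<in>A. \<Sum>k\<in>A. \<Sum>x\<in>?I. cnj (F j) * F k * (of_real (w x) * add_char ((\<alpha> j - \<alpha> k) * of_int x)))"
      by (subst sum.swap, rule sum.cong[OF refl], rule sum.swap)
    finally show ?thesis by (simp add: trig_sum_def sum_distrib_left)
  qed
  have "complex_of_real (\<Sum>x\<in>?I. \<nu> x * (cmod (h x))\<^sup>2) - of_real (V / real n) * complex_of_real (\<Sum>x\<in>?I. 1 * (cmod (h x))\<^sup>2)
      = (\<Sum>j\<in>A. \<Sum>k\<in>A. cnj (F j) * F k * (trig_sum \<nu> n (\<alpha> j - \<alpha> k) - of_real (V / real n) * trig_sum (\<lambda>_. 1) n (\<alpha> j - \<alpha> k)))"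
    unfolding expand by (simp add: sum_subtractf sum_distrib_left right_diff_distrib mult_ac)
  then have "cmod (complex_of_real ((\<Sum>x\<in>?I. \<nu> x * (cmod (h x))\<^sup>2) - V / real n * (\<Sum>x\<in>?I. 1 * (cmod (h x))\<^sup>2)))
      = cmod (\<Sum>j\<in>A. \<Sum>k\<in>A. cnj (F j) * F k * (trig_sum \<nu> n (\<alpha> j - \<alpha> k) - of_real (V / real n) * trig_sum (\<lambda>_. 1) n (\<alpha> j - \<alpha> k)))"
    by (simp only: of_real_diff of_real_mult)
  also have "\<dots> \<le> (\<Sum>j\<in>A. \<Sum>k\<in>A. V * V * (V * \<theta>))"
  proof (intro sum_norm_le)
    fix j k
    have F: "cmod (F i) \<le> V" for i unfolding F_def V by (rule cmod_trig_sum_le[OF f])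
    have "trig_sum \<nu> n (\<alpha> j - \<alpha> k) - of_real (V / real n) * trig_sum (\<lambda>_. 1) n (\<alpha> j - \<alpha> k)
        = of_real V * (trig_sum \<nu> n (\<alpha> j - \<alpha> k) / of_real V - trig_sum (\<lambda>_. 1) n (\<alpha> j - \<alpha> k) / of_nat n)"
      using V(2) n(1) by (simp add: field_simps)
    then have "cmod (trig_sum \<nu> n (\<alpha> j - \<alpha> k) - of_real (V / real n) * trig_sum (\<lambda>_. 1) n (\<alpha> j - \<alpha> k)) \<le> V * \<theta>"
      using V(2) decay[of "\<alpha> j - \<alpha> k"] by (simp add: norm_mult)
    then show "cmod (cnj (F j) * F k * (trig_sum \<nu> n (\<alpha> j - \<alpha> k) - of_real (V / real n) * trig_sum (\<lambda>_. 1) n (\<alpha> j - \<alpha> k)))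
        \<le> V * V * (V * \<theta>)"
      unfolding norm_mult complex_mod_cnj using F V(2) \<theta>0 by (intro mult_mono) auto
  qed
  also have "\<dots> = V ^ 3 * (\<theta> * (real (card A))\<^sup>2)" by (simp add: power2_eq_square power3_eq_cube)
  also have "\<dots> \<le> V ^ 3 * 1" using A(2) V(2) by (intro mult_left_mono) auto
  finally have err: "\<bar>(\<Sum>x\<in>?I. \<nu> x * (cmod (h x))\<^sup>2) - V / real n * (\<Sum>x\<in>?I. 1 * (cmod (h x))\<^sup>2)\<bar> \<le> V ^ 3"
    by (simp only: norm_of_real mult_1_right)
  have "(\<Sum>x\<in>?I. 1 * (cmod (h x))\<^sup>2) = (\<Sum>x\<in>int ` {1..n}. (cmod (h x))\<^sup>2)"
    using image_int_atLeastAtMost[of 1 n] by simp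
  also have "\<dots> = (\<Sum>x=1..n. (cmod (h (int x)))\<^sup>2)" by (subst sum.reindex) auto
  also have "\<dots> = (\<Sum>x=1..n. (cmod (\<Sum>j\<in>A. cnj (F j) * add_char (real x * real j / real G)))\<^sup>2)"
  proof (rule sum.cong[OF refl])
    fix x
    have "add_char (\<alpha> j * real x) = add_char (t * real x) * add_char (real x * real j / real G)" for j
      by (simp add: \<alpha>_def add_char_add[symmetric] algebra_simps)
    then have "h (int x) = add_char (t * real x) * (\<Sum>j\<in>A. cnj (F j) * add_char (real x * real j / real G))"
      unfolding h_def sum_distrib_left
      by (intro sum.cong refl) (simp add: mult_ac)
    then show "(cmod (h (int x)))\<^sup>2 = (cmod (\<Sum>j\<in>A. cnj (F j) * add_char (real x * real j / real G)))\<^sup>2"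
      by (simp add: norm_mult)
  qed
  also have "\<dots> \<le> (\<Sum>x<G. (cmod (\<Sum>j\<in>A. cnj (F j) * add_char (real x * real j / real G)))\<^sup>2)"
    using n by (intro sum_mono2) auto
  also have "\<dots> = real G * E" unfolding parseval[OF A(1)] E_def by simp
  finally have "V / real n * (\<Sum>x\<in>?I. 1 * (cmod (h x))\<^sup>2) \<le> V / real n * (real G * E)"
    using V(2) by (intro mult_left_mono) auto
  also have "\<dots> = (V * E) * (real G / real n)" by simp
  also have "\<dots> \<le> (V * E) * 34"
  proof (intro mult_left_mono)
    have "real G \<le> real (34 * n)" using n(3) by (simp only: of_nat_le_iff)
    then show "real G / real n \<le> 34" using n(1) by (simp add: field_simps)
  qed (use V(2) E0 in auto)
  finally have "(\<Sum>x\<in>?I. \<nu> x * (cmod (h x))\<^sup>2) \<le> 34 * V * E + V ^ 3" using err by linarith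
  then have "V * (\<Sum>x\<in>?I. \<nu> x * (cmod (h x))\<^sup>2) \<le> V * (34 * V * E + V ^ 3)" using V(2) by (intro mult_left_mono) auto
  then have main: "E * E \<le> 34 * (V\<^sup>2 * E) + V\<^sup>2 * V\<^sup>2"
    using E2 by (simp add: power2_eq_square power3_eq_cube algebra_simps)
  have "E \<le> 35 * V\<^sup>2"
  proof (rule ccontr)
    assume "\<not> E \<le> 35 * V\<^sup>2"
    then have gt: "35 * V\<^sup>2 < E" by simp
    have V2: "V\<^sup>2 > 0" using V(2) by simp
    have "35 * V\<^sup>2 * E < E * E" using gt V2 by (intro mult_strict_right_mono) linarith+
    moreover have "V\<^sup>2 * V\<^sup>2 \<le> V\<^sup>2 * E" using gt V2 by (intro mult_left_mono) linarith+
    ultimately show False using main by simp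
  qed
  then show ?thesis by (simp add: E_def F_def)
qed

text \<open>With \<open>z\<close> the normalised sum, \<open>z^3 - 1 = (z - 1) (z^2 + z + 1)\<close>
  has modulus at most \<open>1/10\<close> times \<open>3.31\<close>, which is below 1/2; this is
  where the closeness \<open>1/10\<close> comes from.\<close>

lemma Re_cube_near_card:
  fixes g :: "nat \<Rightarrow> real"
  assumes fin: "finite B" and near: "\<And>y. y \<in> B \<Longrightarrow> chord (g y) \<le> 1 / 10"
  shows "real (card B) ^ 3 / 2 \<le> Re ((\<Sum>y\<in>B. add_char (g y)) ^ 3)"
proof (cases "B = {}")
  case False
  define b where "b = real (card B)"
  have b: "b > 0" using fin False by (simp add: b_def card_gt_0_iff)
  define z where "z = (\<Sum>y\<in>B. add_char (g y)) / of_real b"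
  have S: "(\<Sum>y\<in>B. add_char (g y)) = of_real b * z" using b by (simp add: z_def)
  have "of_real b * (z - 1) = (\<Sum>y\<in>B. add_char (g y) - 1)"
    by (simp only: right_diff_distrib S[symmetric] sum_subtractf) (simp add: b_def)
  then have "b * cmod (z - 1) = cmod (\<Sum>y\<in>B. add_char (g y) - 1)"
    using b by (metis abs_of_pos norm_mult norm_of_real)
  also have "\<dots> \<le> (\<Sum>y\<in>B. 1 / 10)" using near by (intro sum_norm_le) (simp add: chord_def)
  also have "\<dots> = b * (1 / 10)" by (simp add: b_def)
  finally have z1: "cmod (z - 1) \<le> 1 / 10" using b by (subst (asm) mult_le_cancel_left_pos) auto
  have "cmod z \<le> cmod (z - 1) + cmod 1" using norm_triangle_ineq[of "z - 1" 1] by simp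
  then have z2: "cmod z \<le> 11 / 10" using z1 by simp
  have "cmod (z\<^sup>2 + z + 1) \<le> cmod (z\<^sup>2) + cmod z + 1"
    using norm_triangle_ineq[of "z\<^sup>2 + z" 1] norm_triangle_ineq[of "z\<^sup>2" z] by simp
  also have "\<dots> \<le> (11/10)\<^sup>2 + 11/10 + 1" using z2 by (intro add_mono) (auto simp: norm_power intro: power_mono)
  finally have "cmod (z - 1) * cmod (z\<^sup>2 + z + 1) \<le> 1/10 * ((11/10)\<^sup>2 + 11/10 + 1)"
    using z1 by (intro mult_mono) auto
  moreover have "z ^ 3 - 1 = (z - 1) * (z\<^sup>2 + z + 1)" by (simp add: power2_eq_square power3_eq_cube algebra_simps)
  ultimately have "cmod (z ^ 3 - 1) \<le> 1 / 2" by (simp add: norm_mult power2_eq_square)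
  then have "1 / 2 \<le> Re (z ^ 3)"
    using abs_Re_le_cmod[of "z ^ 3 - 1"] by (simp add: abs_le_iff)
  then have "b ^ 3 * (1 / 2) \<le> b ^ 3 * Re (z ^ 3)" using b by (intro mult_left_mono) auto
  also have "b ^ 3 * Re (z ^ 3) = Re (of_real (b ^ 3) * z ^ 3)" by simp
  also have "of_real (b ^ 3) * z ^ 3 = (\<Sum>y\<in>B. add_char (g y)) ^ 3" unfolding S by (simp add: power_mult_distrib)
  finally show ?thesis by (simp add: b_def)
qed simp

text \<open>Since \<open>1.998 / 4.995 + 3 / 5 = 1\<close>, this replaces Hoelder's inequality.\<close>

lemma interpolate_powr:
  fixes u v :: real
  assumes "0 \<le> u" "u \<le> \<kappa>" "0 \<le> v"
  shows "u\<^sup>2 * v ^ 3 \<le> \<kappa> powr (1/500) * (u powr 4.995 + v ^ 5)"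
proof (cases "u = 0 \<or> v = 0")
  case True
  then show ?thesis using assms by (auto intro!: mult_nonneg_nonneg)
next
  case False
  then have u: "u > 0" and v: "v > 0" using assms by auto
  have key: "u powr 1.998 * v powr 3 \<le> u powr 4.995 + v powr 5"
  proof (cases "v powr 5 \<le> u powr 4.995")
    case True
    then have "(v powr 5) powr (3/5) \<le> (u powr 4.995) powr (3/5)" by (intro powr_mono2) auto
    then have "v powr 3 \<le> u powr 2.997" by (simp only: powr_powr) simp
    then have "u powr 1.998 * v powr 3 \<le> u powr 1.998 * u powr 2.997" by (intro mult_left_mono) auto
    also have "\<dots> = u powr 4.995" by (simp only: powr_add[symmetric]) simp
    finally show ?thesis using powr_ge_zero[of v "5"] by linarith
  next
    case False
    then have "(u powr 4.995) powr (2/5) \<le> (v powr 5) powr (2/5)" by (intro powr_mono2) auto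
    then have "u powr 1.998 \<le> v powr 2" by (simp only: powr_powr) simp
    then have "u powr 1.998 * v powr 3 \<le> v powr 2 * v powr 3" by (intro mult_right_mono) auto
    also have "\<dots> = v powr 5" by (simp only: powr_add[symmetric]) simp
    finally show ?thesis using powr_ge_zero[of u "4.995"] by linarith
  qed
  have "u\<^sup>2 = u powr 2" "v ^ 3 = v powr 3" "v ^ 5 = v powr 5" using u v by (simp_all add: powr_numeral)
  moreover have "u powr 2 = u powr (1/500) * u powr 1.998" by (simp only: powr_add[symmetric]) simp
  ultimately have "u\<^sup>2 * v ^ 3 = u powr (1/500) * (u powr 1.998 * v powr 3)" by simp
  also have "\<dots> \<le> \<kappa> powr (1/500) * (u powr 4.995 + v powr 5)"
    using assms key by (intro mult_mono powr_mono2) auto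
  finally show ?thesis using v by (simp add: powr_numeral)
qed

text \<open>In units of \<open>b^3 \<delta>^2 V^2\<close>, the single point 0 gives at least 1/8,
  the set between \<open>A\<close> and \<open>A'\<close> at least -1/32, and the rest at least -1/32
  because \<open>c y \<le> b\<close>. What remains is at least 1/16, stated with \<open>c y\<close>
  in place of \<open>b\<close>.\<close>

lemma grid_sum_lower_bound:
  fixes F S :: "nat \<Rightarrow> complex"
  assumes G: "G > 0" and A: "A \<subseteq> A'" "A' \<subseteq> {..<G}" "0 \<in> A"
    and off: "\<And>j. j < G \<Longrightarrow> j \<notin> A' \<Longrightarrow> cmod (F j) \<le> \<kappa> * V" and \<kappa>: "\<kappa> \<ge> 0"
    and on: "\<And>j. j \<in> A \<Longrightarrow> b ^ 3 / 2 \<le> Re (S j ^ 3)"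
    and S: "\<And>j. cmod (S j) \<le> b" and F0: "\<delta> / 2 * V \<le> cmod (F 0)" and V: "V > 0" and \<delta>: "\<delta> > 0"
    and mid: "(\<Sum>j\<in>A' - A. (cmod (F j))\<^sup>2) \<le> \<delta>\<^sup>2 / 32 * V\<^sup>2"
    and moments: "(\<Sum>j<G. (cmod (F j) / V) powr 4.995 + (cmod (S j) / y) ^ 5) \<le> D"
    and y: "y > 0" and c: "c > 0" "c * y \<le> b" and small: "\<kappa> powr (1/500) * D \<le> c ^ 3 * \<delta>\<^sup>2 / 32"
  shows "c ^ 3 * y ^ 3 * \<delta>\<^sup>2 / 16 * V\<^sup>2 \<le> (\<Sum>j<G. (cmod (F j))\<^sup>2 * Re (S j ^ 3))"
proof -
  let ?g = "\<lambda>j. (cmod (F j))\<^sup>2 * Re (S j ^ 3)"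
  have b: "b \<ge> 0" using S[of 0] norm_ge_zero order_trans by blast
  have finA': "finite A'" using A(2) finite_subset by blast
  have finA: "finite A" using A(1) finA' finite_subset by blast
  have Re_ge: "- (cmod (S j) ^ 3) \<le> Re (S j ^ 3)" for j
    using abs_Re_le_cmod[of "S j ^ 3"] by (simp add: norm_power abs_le_iff)
  have split: "(\<Sum>j<G. ?g j) = (\<Sum>j\<in>{..<G} - A'. ?g j) + ((\<Sum>j\<in>A' - A. ?g j) + (\<Sum>j\<in>A. ?g j))"
    using A finA' sum.subset_diff[of A' "{..<G}" ?g] sum.subset_diff[of A A' ?g] by simp
  have s1: "b ^ 3 / 2 * (\<delta>\<^sup>2 / 4 * V\<^sup>2) \<le> (\<Sum>j\<in>A. ?g j)"
  proof -
    have "(\<delta> / 2 * V)\<^sup>2 \<le> (cmod (F 0))\<^sup>2" using F0 V \<delta> by (intro power_mono) auto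
    then have "(\<delta> / 2 * V)\<^sup>2 * (b ^ 3 / 2) \<le> (cmod (F 0))\<^sup>2 * (b ^ 3 / 2)"
      using b by (intro mult_right_mono) auto
    moreover have "(\<delta> / 2 * V)\<^sup>2 * (b ^ 3 / 2) = b ^ 3 / 2 * (\<delta>\<^sup>2 / 4 * V\<^sup>2)"
      by (simp add: power_mult_distrib power_divide)
    ultimately have "b ^ 3 / 2 * (\<delta>\<^sup>2 / 4 * V\<^sup>2) \<le> (cmod (F 0))\<^sup>2 * (b ^ 3 / 2)" by linarith
    also have "\<dots> \<le> ?g 0" using on[OF A(3)] by (intro mult_left_mono) auto
    also have "\<dots> \<le> (\<Sum>j\<in>A. ?g j)"
    proof (rule member_le_sum[OF A(3) _ finA])
      fix j assume "j \<in> A - {0}"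
      then have "b ^ 3 / 2 \<le> Re (S j ^ 3)" using on by blast
      moreover have "0 \<le> b ^ 3 / 2" using b by simp
      ultimately have "0 \<le> Re (S j ^ 3)" by linarith
      then show "0 \<le> ?g j" by simp
    qed
    finally show ?thesis .
  qed
  have s2: "- (b ^ 3 * (\<delta>\<^sup>2 / 32 * V\<^sup>2)) \<le> (\<Sum>j\<in>A' - A. ?g j)"
  proof -
    have "- (b ^ 3 * (\<delta>\<^sup>2 / 32 * V\<^sup>2)) \<le> - (b ^ 3 * (\<Sum>j\<in>A' - A. (cmod (F j))\<^sup>2))"
      unfolding neg_le_iff_le using b by (intro mult_left_mono mid) auto
    also have "\<dots> = (\<Sum>j\<in>A' - A. (cmod (F j))\<^sup>2 * - (b ^ 3))"
      by (simp add: sum_distrib_left sum_negf mult.commute)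
    also have "\<dots> \<le> (\<Sum>j\<in>A' - A. ?g j)"
    proof (intro sum_mono mult_left_mono)
      fix j
      have "cmod (S j) ^ 3 \<le> b ^ 3" using S by (intro power_mono) auto
      then show "- (b ^ 3) \<le> Re (S j ^ 3)" using Re_ge[of j] by linarith
    qed auto
    finally show ?thesis .
  qed
  have s3: "- (V\<^sup>2 * y ^ 3 * (c ^ 3 * \<delta>\<^sup>2 / 32)) \<le> (\<Sum>j\<in>{..<G} - A'. ?g j)"
  proof -
    have "(\<Sum>j\<in>{..<G} - A'. (cmod (F j))\<^sup>2 * cmod (S j) ^ 3)
        \<le> (\<Sum>j\<in>{..<G} - A'. V\<^sup>2 * y ^ 3 * (\<kappa> powr (1/500) * ((cmod (F j) / V) powr 4.995 + (cmod (S j) / y) ^ 5)))"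
    proof (intro sum_mono)
      fix j assume "j \<in> {..<G} - A'"
      then have "cmod (F j) / V \<le> \<kappa>" using off[of j] V by (simp add: pos_divide_le_eq)
      then have "(cmod (F j) / V)\<^sup>2 * (cmod (S j) / y) ^ 3
          \<le> \<kappa> powr (1/500) * ((cmod (F j) / V) powr 4.995 + (cmod (S j) / y) ^ 5)"
        using V y by (intro interpolate_powr) auto
      then have "V\<^sup>2 * y ^ 3 * ((cmod (F j) / V)\<^sup>2 * (cmod (S j) / y) ^ 3)
          \<le> V\<^sup>2 * y ^ 3 * (\<kappa> powr (1/500) * ((cmod (F j) / V) powr 4.995 + (cmod (S j) / y) ^ 5))"
        using y by (intro mult_left_mono) auto
      moreover have "V\<^sup>2 * y ^ 3 * ((cmod (F j) / V)\<^sup>2 * (cmod (S j) / y) ^ 3) = (cmod (F j))\<^sup>2 * cmod (S j) ^ 3"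
        using V y by (simp add: power_divide)
      ultimately show "(cmod (F j))\<^sup>2 * cmod (S j) ^ 3
          \<le> V\<^sup>2 * y ^ 3 * (\<kappa> powr (1/500) * ((cmod (F j) / V) powr 4.995 + (cmod (S j) / y) ^ 5))" by simp
    qed
    also have "\<dots> = V\<^sup>2 * y ^ 3 * (\<kappa> powr (1/500) * (\<Sum>j\<in>{..<G} - A'. (cmod (F j) / V) powr 4.995 + (cmod (S j) / y) ^ 5))"
      by (simp only: sum_distrib_left)
    also have "\<dots> \<le> V\<^sup>2 * y ^ 3 * (\<kappa> powr (1/500) * D)"
    proof (intro mult_left_mono)
      have "(\<Sum>j\<in>{..<G} - A'. (cmod (F j) / V) powr 4.995 + (cmod (S j) / y) ^ 5)
          \<le> (\<Sum>j<G. (cmod (F j) / V) powr 4.995 + (cmod (S j) / y) ^ 5)"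
        using y by (intro sum_mono2) auto
      then show "(\<Sum>j\<in>{..<G} - A'. (cmod (F j) / V) powr 4.995 + (cmod (S j) / y) ^ 5) \<le> D" using moments by linarith
    qed (use y in auto)
    also have "\<dots> \<le> V\<^sup>2 * y ^ 3 * (c ^ 3 * \<delta>\<^sup>2 / 32)" using small y by (intro mult_left_mono) auto
    finally have "- (V\<^sup>2 * y ^ 3 * (c ^ 3 * \<delta>\<^sup>2 / 32)) \<le> - (\<Sum>j\<in>{..<G} - A'. (cmod (F j))\<^sup>2 * cmod (S j) ^ 3)" by simp
    also have "\<dots> = (\<Sum>j\<in>{..<G} - A'. (cmod (F j))\<^sup>2 * - (cmod (S j) ^ 3))" by (simp add: sum_negf)
    also have "\<dots> \<le> (\<Sum>j\<in>{..<G} - A'. ?g j)" using Re_ge by (intro sum_mono mult_left_mono) auto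
    finally show ?thesis .
  qed
  have "(c * y) ^ 3 \<le> b ^ 3" using c y by (intro power_mono) auto
  then have cb: "c ^ 3 * y ^ 3 * (V\<^sup>2 * \<delta>\<^sup>2) \<le> b ^ 3 * (V\<^sup>2 * \<delta>\<^sup>2)" by (intro mult_right_mono) (auto simp: power_mult_distrib)
  define p q where "p = b ^ 3 * (V\<^sup>2 * \<delta>\<^sup>2)" and "q = c ^ 3 * y ^ 3 * (V\<^sup>2 * \<delta>\<^sup>2)"
  have "b ^ 3 / 2 * (\<delta>\<^sup>2 / 4 * V\<^sup>2) = p / 8" by (simp add: p_def)
  with s1 have "p / 8 \<le> (\<Sum>j\<in>A. ?g j)" by simp
  moreover have "b ^ 3 * (\<delta>\<^sup>2 / 32 * V\<^sup>2) = p / 32" by (simp add: p_def)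
  with s2 have "- (p / 32) \<le> (\<Sum>j\<in>A' - A. ?g j)" by simp
  moreover have "V\<^sup>2 * y ^ 3 * (c ^ 3 * \<delta>\<^sup>2 / 32) = q / 32" by (simp add: q_def)
  with s3 have "- (q / 32) \<le> (\<Sum>j\<in>{..<G} - A'. ?g j)" by simp
  moreover have "q \<le> p" unfolding p_def q_def by (rule cb)
  ultimately have "q / 16 \<le> (\<Sum>j\<in>{..<G} - A'. ?g j) + ((\<Sum>j\<in>A' - A. ?g j) + (\<Sum>j\<in>A. ?g j))" by argo
  moreover have "c ^ 3 * y ^ 3 * \<delta>\<^sup>2 / 16 * V\<^sup>2 = q / 16" by (simp add: q_def mult_ac)
  ultimately show ?thesis unfolding split by linarith
qed

text \<open>The sums over consecutive differences telescope to at most the total, so they cannot all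
  exceed their share.\<close>

lemma level_pigeonhole:
  fixes g :: "nat \<Rightarrow> real" and A :: "nat \<Rightarrow> nat set"
  assumes J: "J > 0" and fin: "\<And>i. finite (A i)" and mono: "\<And>i. A i \<subseteq> A (Suc i)" and g: "\<And>j. g j \<ge> 0"
    and total: "sum g (A J) \<le> E"
  shows "\<exists>i<J. sum g (A (Suc i) - A i) \<le> E / real J"
proof (rule ccontr)
  assume "\<not> ?thesis"
  then have gt: "E / real J < sum g (A (Suc i) - A i)" if "i < J" for i using that by auto
  have "E = (\<Sum>i<J. E / real J)" using J by simp
  also have "\<dots> < (\<Sum>i<J. sum g (A (Suc i) - A i))" using J gt by (intro sum_strict_mono) auto
  also have "\<dots> = (\<Sum>i<J. sum g (A (Suc i)) - sum g (A i))"
    using fin mono by (intro sum.cong refl sum_diff) auto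
  also have "\<dots> = sum g (A J) - sum g (A 0)" by (rule sum_lessThan_telescope)
  also have "\<dots> \<le> sum g (A J)" using g by (simp add: sum_nonneg)
  finally show False using total by simp
qed

text \<open>For \<open>16 n t \<le> 1\<close> every phase \<open>t x\<close> with
  \<open>1 \<le> x \<le> n\<close> has \<open>chord\<close> at most 1/2, so at most half of the mass
  can cancel.\<close>

lemma cmod_trig_sum_near_zero:
  assumes f: "\<And>x. 0 \<le> f x" and t: "0 \<le> t" "16 * real n * t \<le> 1"
  shows "(\<Sum>x=1..int n. f x) / 2 \<le> cmod (trig_sum f n t)"
proof -
  let ?s = "\<Sum>x=1..int n. f x"
  have "trig_sum f n t - of_real ?s = (\<Sum>x=1..int n. of_real (f x) * (add_char (t * of_int x) - 1))"
    by (simp add: trig_sum_def sum_subtractf right_diff_distrib)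
  also have "cmod \<dots> \<le> (\<Sum>x=1..int n. f x * (1 / 2))"
  proof (intro sum_norm_le)
    fix x assume x: "x \<in> {1..int n}"
    have "chord (t * of_int x) \<le> 2 * pi * \<bar>t * of_int x\<bar>" by (rule chord_upper)
    also have "\<dots> \<le> 2 * 4 * (t * real n)"
      using pi_less_4 t x by (intro mult_mono) (auto simp: abs_mult intro!: mult_left_mono)
    also have "\<dots> \<le> 1 / 2" using t by (simp add: mult_ac)
    finally have "f x * chord (t * of_int x) \<le> f x * (1 / 2)" using f by (intro mult_left_mono)
    then show "cmod (of_real (f x) * (add_char (t * of_int x) - 1)) \<le> f x * (1 / 2)"
      using f by (simp add: norm_mult chord_def)
  qed
  also have "\<dots> = ?s / 2" by (simp add: sum_divide_distrib)
  finally have "cmod (trig_sum f n t - of_real ?s) \<le> ?s / 2" .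
  moreover have "?s = cmod (of_real ?s)" using f unfolding norm_of_real by (simp add: sum_nonneg)
  moreover have "cmod (of_real ?s) \<le> cmod (trig_sum f n t) + cmod (trig_sum f n t - of_real ?s)"
    using norm_triangle_ineq2[of "of_real ?s" "trig_sum f n t"] by (simp add: norm_minus_commute)
  ultimately show ?thesis by linarith
qed

section \<open>Choice of parameters and conclusion\<close>

lemma grid_parameters:
  fixes N :: real
  assumes N: "(real m + 3)\<^sup>2 \<le> N"
  defines "n \<equiv> nat \<lfloor>N\<rfloor>" and "Y \<equiv> nat \<lfloor>sqrt N\<rfloor>" and "G \<equiv> nat \<lceil>16 * N\<rceil>"
  shows "4 \<le> N" "real n \<le> N" "n > 0" "Y\<^sup>2 \<le> n" "m \<le> Y" "Y > 0" "sqrt N \<le> 2 * real Y"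
    "2 * Y\<^sup>2 < G" "G \<le> 65 * Y\<^sup>2" "16 * n \<le> G" "n < G" "G \<le> 34 * n" "real G \<le> 17 * N" "G > 0"
proof -
  have "(3::real)\<^sup>2 \<le> (real m + 3)\<^sup>2" by (intro power_mono) auto
  then have N9: "9 \<le> N" using N by simp
  then show N4: "4 \<le> N" by simp
  have sqrtN: "real m + 3 \<le> sqrt N" using N real_le_rsqrt by blast
  show n_le: "real n \<le> N" unfolding n_def using N4 by (intro of_nat_floor) simp
  have n_gt: "N < real n + 1" unfolding n_def using N4 by linarith
  show n0: "n > 0" using n_gt N4 by (intro Nat.gr0I) auto
  have Y_le: "real Y \<le> sqrt N" unfolding Y_def using N4 by (intro of_nat_floor) simp
  have Y_gt: "sqrt N < real Y + 1" unfolding Y_def using sqrtN by linarith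
  have mY: "real m + 1 < real Y" using sqrtN Y_gt by linarith
  then show "m \<le> Y" by simp
  show Y0: "Y > 0" using mY by (intro Nat.gr0I) auto
  then have Y1: "real Y \<ge> 1" by simp
  show "sqrt N \<le> 2 * real Y" using Y_gt Y1 by linarith
  have "(real Y)\<^sup>2 \<le> (sqrt N)\<^sup>2" using Y_le by (intro power_mono) auto
  then have "real (Y\<^sup>2) \<le> N" using N4 by simp
  then show Y2n: "Y\<^sup>2 \<le> n" unfolding n_def by (rule le_nat_floor)
  have G_ge: "16 * N \<le> real G" unfolding G_def by (rule real_nat_ceiling_ge)
  have G_lt: "real G < 16 * N + 1" unfolding G_def using N4 by linarith
  have "real (16 * n) \<le> real G" using n_le G_ge by simp
  then show G16: "16 * n \<le> G" by (simp only: of_nat_le_iff)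
  then show "n < G" "G > 0" "2 * Y\<^sup>2 < G" using n0 Y2n by linarith+
  have "real G < real (32 * n + 17)" using G_lt n_gt by simp
  \<comment> \<open>The 3 in the lower bound for \<open>N\<close> gives \<open>N \<ge> 9\<close>,
    hence \<open>n > 8\<close> and \<open>32 n + 16 \<le> 34 n\<close>.\<close>
  then have "G < 32 * n + 17" by (simp only: of_nat_less_iff)
  moreover have "8 < n" using n_gt N9 by linarith
  ultimately show "G \<le> 34 * n" by linarith
  have "(sqrt N)\<^sup>2 < (real Y + 1)\<^sup>2" using Y_gt N4 by (intro power_strict_mono) auto
  also have "\<dots> \<le> (2 * real Y)\<^sup>2" using Y1 by (intro power_mono) auto
  finally have "N < 4 * (real Y)\<^sup>2" using N4 by (simp add: power_mult_distrib)
  then have "real G < 64 * (real Y)\<^sup>2 + 1" using G_lt by linarith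
  then have "real G < real (64 * Y\<^sup>2 + 1)" by simp
  then have "G < 64 * Y\<^sup>2 + 1" by (simp only: of_nat_less_iff)
  moreover have "Y\<^sup>2 > 0" using Y0 by simp
  ultimately show "G \<le> 65 * Y\<^sup>2" by linarith
  show "real G \<le> 17 * N" using G_lt N4 by linarith
qed

theorem theorem5p5:
  fixes \<delta> :: real and K M :: nat
  assumes "\<delta> > 0" and "K \<ge> 1" and "M \<ge> 1"
  shows "\<exists>N\<^sub>0 c\<^sub>0 \<theta> :: real. N\<^sub>0 > 0 \<and> c\<^sub>0 > 0 \<and> \<theta> > 0 \<and>
    (\<forall>N::real. N \<ge> N\<^sub>0 \<longrightarrow>
      (\<forall>(B :: int set) (\<nu> :: int \<Rightarrow> real).
        B \<subseteq> {0<..} \<longrightarrow> homogeneous M B \<longrightarrow>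
        (\<forall>x. \<nu> x \<ge> 0) \<longrightarrow> (\<forall>x. x \<notin> bracket N \<longrightarrow> \<nu> x = 0) \<longrightarrow>
        restriction_estimate N 4.995 (real K) \<nu> \<longrightarrow>
        fourier_decay N \<theta> \<nu> \<longrightarrow>
        (\<forall>f :: int \<Rightarrow> real.
          (\<forall>x. f x \<ge> 0) \<longrightarrow> (\<forall>x. x \<notin> bracket N \<longrightarrow> f x = 0) \<longrightarrow>
          (\<forall>x. f x \<le> \<nu> x) \<longrightarrow> l1_norm f \<ge> \<delta> * l1_norm \<nu> \<longrightarrow>
          T\<^sub>1 f B \<ge> c\<^sub>0 * (l1_norm \<nu>)\<^sup>2 * sqrt N)))"
proof -
  obtain C where C: "C > 0" and fifth: "\<And>Y G a. Y > 0 \<Longrightarrow> 2 * Y\<^sup>2 < G \<Longrightarrow> G \<le> 65 * Y\<^sup>2 \<Longrightarrow> \<forall>y. cmod (a y) \<le> 1 \<Longrightarrow>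
      (\<Sum>j<G. (cmod (square_sum a Y G j) / real Y) ^ 5) \<le> C"
    using square_sum_fifth_moment by blast
  \<comment> \<open>As \<open>G \<le> 17 N\<close>, the restriction estimate becomes a normalised
    grid moment of at most \<open>17 K\<close>; \<open>C\<close> is the fifth moment of the
    squares.\<close>
  define D where "D = 17 * real K + C"
  have D: "D > 0" using C by (simp add: D_def add_nonneg_pos)
  define dense where "dense R c Y\<^sub>0 \<longleftrightarrow> c > 0 \<and> (\<forall>Y\<ge>Y\<^sub>0. \<forall>B (A::real set). homogeneous M B \<longrightarrow> finite A \<longrightarrow> card A \<le> R \<longrightarrow>
      (\<exists>B'\<subseteq>{1..Y}. int ` B' \<subseteq> B \<and> c * real Y \<le> real (card B') \<and>
        (\<forall>\<alpha>\<in>A. \<forall>y\<in>B'. chord (\<alpha> * (real y)\<^sup>2) \<le> 1 / 10)))" for R c Y\<^sub>0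
  have "\<exists>c Y\<^sub>0. dense R c Y\<^sub>0" for R
    unfolding dense_def using homogeneous_bohr_density[of "1 / 10" M R] assms(3) by auto
  then obtain cc YY where dense: "\<And>R. dense R (cc R) (YY R)" by metis
  have cc: "cc R > 0" for R using dense[of R] by (simp add: dense_def)
  \<comment> \<open>By Chebyshev's inequality with exponent 4.995, at most \<open>R k\<close> grid
    points satisfy \<open>|F| \<ge> k V\<close>.\<close>
  define R where "R k = nat \<lceil>17 * real K * k powr (-4.995)\<rceil>" for k :: real
  \<comment> \<open>The density available for the frequencies above one threshold determines the
    next: the exponent 500 undoes the \<open>1/500\<close> of the interpolation, and
    \<open>min\<close> keeps the sequence decreasing. Nothing here depends on \<open>N\<close>,
    \<open>B\<close>, \<nu> or \<open>f\<close>.\<close>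
  define \<kappa> where "\<kappa> = rec_nat (\<delta> / 2) (\<lambda>_ k. min k ((cc (R k) ^ 3 * \<delta>\<^sup>2 / (32 * D)) powr 500))"
  have \<kappa>_0: "\<kappa> 0 = \<delta> / 2"
    and \<kappa>_Suc: "\<kappa> (Suc i) = min (\<kappa> i) ((cc (R (\<kappa> i)) ^ 3 * \<delta>\<^sup>2 / (32 * D)) powr 500)" for i
    by (simp_all add: \<kappa>_def)
  have \<kappa>_pos: "\<kappa> i > 0" for i
    by (induction i) (use assms(1) cc D in \<open>auto simp: \<kappa>_0 \<kappa>_Suc less_imp_neq[symmetric]\<close>)
  have \<kappa>_le: "\<kappa> (Suc i) \<le> \<kappa> i" for i by (simp add: \<kappa>_Suc)
  have \<kappa>_le_0: "\<kappa> i \<le> \<delta> / 2" for i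
  proof (induction i)
    case (Suc i)
    then show ?case using \<kappa>_le[of i] by linarith
  qed (simp add: \<kappa>_0)
  have \<kappa>_small: "\<kappa> (Suc i) powr (1/500) * D \<le> cc (R (\<kappa> i)) ^ 3 * \<delta>\<^sup>2 / 32" for i
  proof -
    let ?z = "cc (R (\<kappa> i)) ^ 3 * \<delta>\<^sup>2 / (32 * D)"
    have z: "?z > 0" using cc D assms(1) by simp
    have cancel: "(x powr 500) powr (1/500) = x" if "x > 0" for x :: real
      using that by (simp only: powr_powr) simp
    have "\<kappa> (Suc i) powr (1/500) \<le> (?z powr 500) powr (1/500)"
      using \<kappa>_pos[of "Suc i"] by (intro powr_mono2) (auto simp: \<kappa>_Suc)
    also have "\<dots> = ?z" by (rule cancel[OF z])
    finally have "\<kappa> (Suc i) powr (1/500) * D \<le> ?z * D" using D by (intro mult_right_mono) auto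
    then show ?thesis using D by simp
  qed
  \<comment> \<open>\<open>1120\<close> is 35 times 32: an energy \<open>35 V^2\<close> shared among
    \<open>J\<close> gaps leaves at most \<open>\<delta>^2 V^2 / 32\<close> in one of them.\<close>
  define J where "J = nat \<lceil>1120 / \<delta>\<^sup>2\<rceil>"
  have "0 < 1120 / \<delta>\<^sup>2" using assms(1) by simp
  then have J: "J > 0" "1120 / \<delta>\<^sup>2 \<le> real J" unfolding J_def by linarith+
  \<comment> \<open>The energy bound is applied only to the deepest level set, which contains all
    the others; adding 1 keeps the denominator positive.\<close>
  define \<theta> where "\<theta> = 1 / (real (R (\<kappa> J)) + 1)\<^sup>2"
  have \<theta>: "\<theta> > 0" by (simp add: \<theta>_def add_nonneg_pos)
  \<comment> \<open>The index selected later depends on \<open>f\<close>, so the density here and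
    the threshold \<open>m\<close> below are taken uniformly over all \<open>i < J\<close>.\<close>
  define c where "c = Min ((\<lambda>i. cc (R (\<kappa> i))) ` {..<J})"
  have c: "c > 0" unfolding c_def using J(1) cc by (subst Min_gr_iff) auto
  have c_le: "c \<le> cc (R (\<kappa> i))" if "i < J" for i unfolding c_def using that by (intro Min_le) auto
  define m where "m = Max ((\<lambda>i. YY (R (\<kappa> i))) ` {..<J})"
  have m_ge: "YY (R (\<kappa> i)) \<le> m" if "i < J" for i unfolding m_def using that by (intro Max_ge) auto
  \<comment> \<open>\<open>2176\<close> is 16 times 8 times 17: from the grid lower bound, from
    \<open>Y \<ge> sqrt N / 2\<close> cubed, and from \<open>G \<le> 17 N\<close>.\<close>
  have main: "c ^ 3 * \<delta>\<^sup>2 / 2176 * (l1_norm \<nu>)\<^sup>2 * sqrt N \<le> T\<^sub>1 f B"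
    if N: "(real m + 3)\<^sup>2 \<le> N" and B: "B \<subseteq> {0<..}" "homogeneous M B"
      and nu: "\<And>x. 0 \<le> \<nu> x" "\<And>x. x \<notin> bracket N \<Longrightarrow> \<nu> x = 0"
      and res: "restriction_estimate N 4.995 (real K) \<nu>" and decay: "fourier_decay N \<theta> \<nu>"
      and f: "\<And>x. 0 \<le> f x" "\<And>x. x \<notin> bracket N \<Longrightarrow> f x = 0" "\<And>x. f x \<le> \<nu> x" "\<delta> * l1_norm \<nu> \<le> l1_norm f"
    for N B \<nu> and f :: "int \<Rightarrow> real"
  proof -
    define n where "n = nat \<lfloor>N\<rfloor>"
    define Y where "Y = nat \<lfloor>sqrt N\<rfloor>"
    define G where "G = nat \<lceil>16 * N\<rceil>"
    note par = grid_parameters[OF N, folded n_def Y_def G_def]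
    have br: "bracket N = {1..int n}" using par(1) by (simp add: bracket_def n_def)
    note nu' = nu(2)[unfolded br] and f' = f(2)[unfolded br]
    define V where "V = l1_norm \<nu>"
    have V_eq: "V = (\<Sum>x=1..int n. \<nu> x)" unfolding V_def using nu' nu(1) by (rule l1_norm_eq_sum)
    have f_eq: "l1_norm f = (\<Sum>x=1..int n. f x)" using f' f(1) by (rule l1_norm_eq_sum)
    show ?thesis
    proof (cases "V > 0")
      \<comment> \<open>Here \<open>V = 0\<close>, so the asserted lower bound is 0; the other case
        may divide by \<open>V\<close>.\<close>
      case False
      moreover have "V \<ge> 0" unfolding V_eq using nu(1) by (simp add: sum_nonneg)
      ultimately show ?thesis using T1_nonneg[of f B] f(1) by (simp add: V_def)
    next
      case V: True
      have decay': "cmod (trig_sum \<nu> n \<alpha> / of_real V - trig_sum (\<lambda>_. 1) n \<alpha> / of_nat n) \<le> \<theta>" for \<alpha>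
      proof -
        have "fourier (\<lambda>x. of_real (\<nu> x)) \<alpha> = trig_sum \<nu> n \<alpha>" by (rule fourier_eq_trig_sum) (rule nu')
        moreover have "fourier (indicator (bracket N)) \<alpha> = trig_sum (\<lambda>_. 1) n \<alpha>"
          unfolding fourier_def trig_sum_def br
          by (subst infsum_eq_sum_of_support[of "{1..int n}"]) (auto simp: indicator_def)
        moreover have "l1_norm (indicator (bracket N) :: int \<Rightarrow> complex) = real n"
          unfolding l1_norm_def br by (subst infsum_eq_sum_of_support[of "{1..int n}"]) (auto simp: indicator_def)
        ultimately show ?thesis using decay unfolding fourier_decay_def V_def
          by (metis of_real_of_nat_eq)
      qed
      obtain t where t: "0 \<le> t" "t \<le> 1 / real G" and
        tp: "(\<Sum>j<G. cmod (trig_sum f n (t + real j / real G)) powr 4.995) \<le> real G * (real K * V powr 4.995 / N)"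
        using restriction_grid[OF par(14) f' f(1,3) _ res] unfolding V_def by auto
      define \<alpha> where "\<alpha> j = t + real j / real G" for j
      define F where "F j = trig_sum f n (\<alpha> j)" for j
      have F_moment: "(\<Sum>j<G. (cmod (F j) / V) powr 4.995) \<le> 17 * real K"
      proof -
        have "(\<Sum>j<G. (cmod (F j) / V) powr 4.995) = (\<Sum>j<G. cmod (F j) powr 4.995) / V powr 4.995"
          using V by (simp add: powr_divide sum_divide_distrib)
        also have "\<dots> \<le> real G * (real K * V powr 4.995 / N) / V powr 4.995"
          using tp by (intro divide_right_mono) (auto simp: F_def \<alpha>_def)
        also have "\<dots> = real K * (real G / N)" using V by simp
        also have "\<dots> \<le> real K * 17" using par(1,13) by (intro mult_left_mono) (auto simp: pos_divide_le_eq)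
        finally show ?thesis by simp
      qed
      define A where "A i = {j\<in>{..<G}. \<kappa> i * V \<le> cmod (F j)}" for i
      have A_sub: "A i \<subseteq> {..<G}" for i by (auto simp: A_def)
      have A_fin: "finite (A i)" for i by (simp add: A_def)
      have A_mono: "A i \<subseteq> A (Suc i)" for i
        using \<kappa>_le[of i] V by (auto simp: A_def intro: order_trans[OF mult_right_mono])
      have A_card: "card (A i) \<le> R (\<kappa> i)" for i
      proof -
        have "real (card (A i)) * \<kappa> i powr 4.995 = (\<Sum>j\<in>A i. \<kappa> i powr 4.995)" by simp
        also have "\<dots> \<le> (\<Sum>j\<in>A i. (cmod (F j) / V) powr 4.995)"
          using V \<kappa>_pos[of i] by (intro sum_mono powr_mono2) (auto simp: A_def pos_le_divide_eq)
        also have "\<dots> \<le> (\<Sum>j<G. (cmod (F j) / V) powr 4.995)" using A_sub by (intro sum_mono2) auto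
        also note F_moment
        finally have "real (card (A i)) \<le> 17 * real K * \<kappa> i powr (-4.995)"
          using \<kappa>_pos[of i] by (simp add: powr_minus_divide pos_le_divide_eq)
        then have "real (card (A i)) \<le> real (R (\<kappa> i))"
          unfolding R_def using real_nat_ceiling_ge order_trans by blast
        then show ?thesis by simp
      qed
      have "\<theta> * (real (card (A J)))\<^sup>2 \<le> \<theta> * (real (R (\<kappa> J)) + 1)\<^sup>2"
        using \<theta> A_card[of J] by (intro mult_left_mono power_mono) auto
      then have \<theta>A: "\<theta> * (real (card (A J)))\<^sup>2 \<le> 1" by (simp add: \<theta>_def)
      have energy: "(\<Sum>j\<in>A J. (cmod (F j))\<^sup>2) \<le> 35 * V\<^sup>2"
        unfolding F_def \<alpha>_def
        by (rule spectrum_energy_le[OF f(1,3) V_eq V decay' par(3,11,12) A_sub \<theta>A])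
      obtain i where i: "i < J" "(\<Sum>j\<in>A (Suc i) - A i. (cmod (F j))\<^sup>2) \<le> 35 * V\<^sup>2 / real J"
        using level_pigeonhole[OF J(1) A_fin A_mono _ energy] by auto
      have mid: "(\<Sum>j\<in>A (Suc i) - A i. (cmod (F j))\<^sup>2) \<le> \<delta>\<^sup>2 / 32 * V\<^sup>2"
      proof -
        have "35 / real J \<le> 35 / (1120 / \<delta>\<^sup>2)" using J assms(1) by (intro divide_left_mono) auto
        then have "35 / real J * V\<^sup>2 \<le> \<delta>\<^sup>2 / 32 * V\<^sup>2" by (intro mult_right_mono) auto
        then show ?thesis using i(2) by simp
      qed
      have "YY (R (\<kappa> i)) \<le> Y" using m_ge[OF i(1)] par(5) by simp
      moreover have "card (\<alpha> ` A i) \<le> R (\<kappa> i)" using card_image_le[OF A_fin] A_card order_trans by blast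
      ultimately obtain B' where B': "B' \<subseteq> {1..Y}" "int ` B' \<subseteq> B" "cc (R (\<kappa> i)) * real Y \<le> real (card B')"
        "\<And>\<beta> y. \<beta> \<in> \<alpha> ` A i \<Longrightarrow> y \<in> B' \<Longrightarrow> chord (\<beta> * (real y)\<^sup>2) \<le> 1 / 10"
        using dense[of "R (\<kappa> i)"] B(2) A_fin[of i] unfolding dense_def by (metis finite_imageI)
      have finB': "finite B'" using B'(1) finite_subset by blast
      define S where "S j = (\<Sum>y\<in>B'. add_char (\<alpha> j * (real y)\<^sup>2))" for j
      \<comment> \<open>The shift \<open>t\<close> of the grid becomes a unimodular factor of the
        weights, so the fifth moment bound on the unshifted grid applies.\<close>
      define a where "a y = (if y \<in> B' then add_char (t * (real y)\<^sup>2) else 0)" for y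
      have S_eq: "S j = square_sum a Y G j" for j
      proof -
        have "square_sum a Y G j = (\<Sum>y\<in>B'. a y * add_char (real y ^ 2 * real j / real G))"
          unfolding square_sum_def using B'(1) by (intro sum.mono_neutral_right) (auto simp: a_def)
        also have "\<dots> = S j" unfolding S_def
          by (intro sum.cong refl) (simp add: a_def \<alpha>_def add_char_add[symmetric] algebra_simps)
        finally show ?thesis ..
      qed
      have S_moment: "(\<Sum>j<G. (cmod (S j) / real Y) ^ 5) \<le> C"
        unfolding S_eq by (rule fifth[OF par(6,8,9)]) (simp add: a_def)
      have "cc (R (\<kappa> i)) ^ 3 * real Y ^ 3 * \<delta>\<^sup>2 / 16 * V\<^sup>2 \<le> (\<Sum>j<G. (cmod (F j))\<^sup>2 * Re (S j ^ 3))"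
      proof (rule grid_sum_lower_bound[where A = "A i" and A' = "A (Suc i)" and \<kappa> = "\<kappa> (Suc i)"
            and b = "real (card B')" and D = D, OF par(14) A_mono A_sub _ _ _ _ _ _ V assms(1) mid _ _ cc B'(3) \<kappa>_small])
        have F0: "\<delta> / 2 * V \<le> cmod (F 0)"
        proof -
          have "16 * real n \<le> real G" using par(10) by (metis of_nat_le_iff of_nat_mult of_nat_numeral)
          then have "16 * real n * t \<le> real G * (1 / real G)" using t par(14) by (intro mult_mono) auto
          then have "(\<Sum>x=1..int n. f x) / 2 \<le> cmod (trig_sum f n t)"
            using par(14) t(1) f(1) by (intro cmod_trig_sum_near_zero) auto
          then show ?thesis using f(4) by (simp add: F_def \<alpha>_def f_eq V_def)
        qed
        then show "\<delta> / 2 * V \<le> cmod (F 0)" .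
        \<comment> \<open>Every threshold is at most \<open>\<delta>/2\<close>, so the near-zero
          frequency \<open>j = 0\<close> lies in every level set.\<close>
        have "\<kappa> i * V \<le> \<delta> / 2 * V" using \<kappa>_le_0[of i] V by (intro mult_right_mono) auto
        then show "0 \<in> A i" using F0 par(14) by (simp add: A_def)
        show "cmod (F j) \<le> \<kappa> (Suc i) * V" if "j < G" "j \<notin> A (Suc i)" for j using that by (simp add: A_def)
        show "0 \<le> \<kappa> (Suc i)" using \<kappa>_pos less_imp_le by blast
        show "real (card B') ^ 3 / 2 \<le> Re (S j ^ 3)" if "j \<in> A i" for j
          unfolding S_def using B'(4) that by (intro Re_cube_near_card finB') auto
        show "cmod (S j) \<le> real (card B')" for j
        proof -
          have "cmod (S j) \<le> (\<Sum>y\<in>B'. 1)" unfolding S_def by (intro sum_norm_le) simp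
          then show ?thesis by simp
        qed
        show "(\<Sum>j<G. (cmod (F j) / V) powr 4.995 + (cmod (S j) / real Y) ^ 5) \<le> D"
          using F_moment S_moment by (simp add: sum.distrib D_def)
        show "0 < real Y" using par(6) by simp
      qed
      also have "\<dots> \<le> real G * T\<^sub>1 f B"
        unfolding F_def S_def \<alpha>_def using par(10,14)
        by (intro T1_ge_grid_sum[where Y = Y] f' f(1) B(1) B'(1,2) par(4)) auto
      also have "\<dots> \<le> 17 * N * T\<^sub>1 f B" using par(13) T1_nonneg[of f B] f(1) by (intro mult_right_mono) auto
      finally have upper: "cc (R (\<kappa> i)) ^ 3 * real Y ^ 3 * \<delta>\<^sup>2 / 16 * V\<^sup>2 \<le> 17 * N * T\<^sub>1 f B" .
      have "c ^ 3 * (sqrt N / 2) ^ 3 * (\<delta>\<^sup>2 / 16 * V\<^sup>2) \<le> cc (R (\<kappa> i)) ^ 3 * real Y ^ 3 * (\<delta>\<^sup>2 / 16 * V\<^sup>2)"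
        using c c_le[OF i(1)] par(1,7) cc by (intro mult_right_mono mult_mono power_mono) (auto intro: less_imp_le)
      also have "\<dots> \<le> 17 * N * T\<^sub>1 f B" using upper by simp
      also have "c ^ 3 * (sqrt N / 2) ^ 3 * (\<delta>\<^sup>2 / 16 * V\<^sup>2) = 17 * N * (c ^ 3 * \<delta>\<^sup>2 / 2176 * V\<^sup>2 * sqrt N)"
        using par(1) by (simp add: power_divide power3_eq_cube)
      finally show ?thesis using par(1) by (simp add: V_def mult_ac)
    qed
  qed
  show ?thesis
  proof (rule exI[of _ "(real m + 3)\<^sup>2"], rule exI[of _ "c ^ 3 * \<delta>\<^sup>2 / 2176"], rule exI[of _ \<theta>],
      intro conjI allI impI)
    show "0 < (real m + 3)\<^sup>2" by (simp add: add_nonneg_pos)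
    show "0 < c ^ 3 * \<delta>\<^sup>2 / 2176" using c assms(1) by simp
    show "0 < \<theta>" by (rule \<theta>)
  qed (rule main; blast)
qed

end
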